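(* Let $f$ be the germ at the origin of a real-analytic planar map, having an elliptic fixed point at the origin with rational rotation number $\omega_0=\frac{p}{q}\in(0,\tfrac12)$, $\gcd(p,q)=1$, $q\ge3$, and suppose $f$ admits a real-analytic first integral $I_1$, defined in a neighbourhood $U$ of the origin, with a non-degenerate local minimum at $(0,0)$. If $f$ admits a second first integral $I_2$, real-meromorphic on $U$, having no pole at the origin, functionally independent of $I_1$ in an open and dense subset of $U\setminus\{(0,0)\}$, then $f$ is real-analytically conjugate to its linear part.
   Context: A real-analytic planar map germ $f$ with $f(0,0)=(0,0)$ has an elliptic fixed point at the origin with rotation number $\omega_0\in(0,\tfrac12)$ if the eigenvalues of its linear part $L=d_{(0,0)}f$ are $\mu=e^{i2\pi\omega_0}$ and $\bar\mu$. The plane is identified with $\mathbb{C}$ via $z=x+iy$, and it is assumed that in this coordinate $L(z)=\mu z$. A first integral of $f$ is a function $I$ defined in a neighbourhood of the origin with $I\circ f=I$ near the origin (wherever both sides are defined, in the meromorphic case). A non-degenerate local minimum at $(0,0)$ means a critical point there with positive definite Hessian. A real-meromorphic function with no pole at the origin is a quotient $P/Q$ of real-analytic functions with $Q(0,0)\neq0$. Functional independence of two functions on an open set means that their differentials are linearly independent at every point of it. Two germs $f,g$ fixing the origin are real-analytically conjugate if there is a germ of real-analytic diffeomorphism $\phi$ fixing the origin with $\phi^{-1}\circ f\circ\phi=g$. *)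

theory Defs
  imports "HOL-Analysis.Analysis"
begin

text \<open>
  The plane is the type \<open>complex\<close>, regarded as a two-dimensional real vector space with
  coordinates \<open>x = Re z\<close>, \<open>y = Im z\<close>. A germ at the origin is represented by a total function;
  identities between germs are required only eventually in \<open>nhds 0\<close>.
\<close>

section \<open>Real-analytic functions on the plane\<close>

text \<open>
  The germ at \<open>c\<close> is a convergent double power series in the real coordinates. One definition
  serves both functions into \<open>real\<close> and planar maps into \<open>complex\<close> (with coefficients in the target).
\<close>

definition real_analytic_at :: "(complex \<Rightarrow> 'b::euclidean_space) \<Rightarrow> complex \<Rightarrow> bool" where
  "real_analytic_at F c \<longleftrightarrow>
     (\<exists>(a :: nat \<Rightarrow> nat \<Rightarrow> 'b) r. r > 0 \<and>
        (\<forall>z\<in>ball c r.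
           ((\<lambda>(i, j). (Re (z - c) ^ i * Im (z - c) ^ j) *\<^sub>R a i j) has_sum F z) UNIV))"

definition real_analytic_on :: "(complex \<Rightarrow> 'b::euclidean_space) \<Rightarrow> complex set \<Rightarrow> bool" where
  "real_analytic_on F U \<longleftrightarrow> (\<forall>c\<in>U. real_analytic_at F c)"

text \<open>
  A real-meromorphic function on \<open>U\<close> without pole at the origin, as a partial function: \<open>D\<close> is the
  domain of definition given by the representation \<open>P/Q\<close>, and the values of \<open>I\<close> outside \<open>D\<close>
  are irrelevant. The density condition excludes a denominator vanishing identically on some
  open part of \<open>U\<close>.
\<close>

definition real_meromorphic_no_pole0_on ::
    "(complex \<Rightarrow> real) \<Rightarrow> complex set \<Rightarrow> complex set \<Rightarrow> bool" where
  "real_meromorphic_no_pole0_on I D U \<longleftrightarrow>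
     (\<exists>P Q :: complex \<Rightarrow> real. real_analytic_on P U \<and> real_analytic_on Q U \<and> Q 0 \<noteq> 0 \<and>
        D = {z \<in> U. Q z \<noteq> 0} \<and> U \<subseteq> closure D \<and> (\<forall>z\<in>D. I z = P z / Q z))"

section \<open>Elliptic fixed points\<close>

definition linear_part :: "(complex \<Rightarrow> complex) \<Rightarrow> complex \<Rightarrow> complex" where
  "linear_part f = frechet_derivative f (at 0)"

text \<open>
  The matrix of a real-linear map of the plane in the real basis \<open>1, \<i>\<close>. Its entries are
  real; they are embedded into \<open>complex\<close> so that non-real eigenvalues make sense.
\<close>

definition plane_matrix :: "(complex \<Rightarrow> complex) \<Rightarrow> complex^2^2" where
  "plane_matrix T =
     vector [vector [of_real (Re (T 1)), of_real (Re (T \<i>))],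
             vector [of_real (Im (T 1)), of_real (Im (T \<i>))]]"

definition eigenvalues :: "complex^2^2 \<Rightarrow> complex set" where
  "eigenvalues A = {l. \<exists>v. v \<noteq> 0 \<and> A *v v = l *s v}"

definition elliptic_fixed_point0 :: "(complex \<Rightarrow> complex) \<Rightarrow> real \<Rightarrow> bool" where
  "elliptic_fixed_point0 f \<omega> \<longleftrightarrow>
     f 0 = 0 \<and> 0 < \<omega> \<and> \<omega> < 1/2 \<and>
     eigenvalues (plane_matrix (linear_part f)) = {cis (2 * pi * \<omega>), cnj (cis (2 * pi * \<omega>))}"

section \<open>First integrals\<close>

definition first_integral ::
    "(complex \<Rightarrow> complex) \<Rightarrow> (complex \<Rightarrow> real) \<Rightarrow> complex set \<Rightarrow> bool" where
  "first_integral f I D \<longleftrightarrow> (\<forall>\<^sub>F z in nhds 0. z \<in> D \<and> f z \<in> D \<longrightarrow> I (f z) = I z)"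

text \<open>
  \<open>g\<close> is the gradient field of \<open>I\<close> near \<open>c\<close>, and \<open>H\<close>, the derivative of the gradient at \<open>c\<close>,
  is the Hessian as a linear operator; its quadratic form is \<open>H h \<bullet> h\<close>.
\<close>

definition nondegenerate_local_min :: "(complex \<Rightarrow> real) \<Rightarrow> complex \<Rightarrow> bool" where
  "nondegenerate_local_min I c \<longleftrightarrow>
     (\<exists>g H. (\<forall>\<^sub>F z in nhds c. GDERIV I z :> g z) \<and> g c = 0 \<and>
            (g has_derivative H) (at c) \<and> (\<forall>h. h \<noteq> 0 \<longrightarrow> H h \<bullet> h > 0))"

definition functionally_independent_on ::
    "(complex \<Rightarrow> real) \<Rightarrow> (complex \<Rightarrow> real) \<Rightarrow> complex set \<Rightarrow> bool" where
  "functionally_independent_on I J W \<longleftrightarrow>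
     (\<forall>z\<in>W. I differentiable (at z) \<and> J differentiable (at z) \<and>
        (\<forall>a b :: real.
           (\<forall>h. a * frechet_derivative I (at z) h + b * frechet_derivative J (at z) h = 0)
             \<longrightarrow> a = 0 \<and> b = 0))"

section \<open>Real-analytic conjugacy of germs\<close>

text \<open>\<open>\<psi>\<close> is the inverse germ of \<open>\<phi>\<close>.\<close>

definition real_analytically_conjugate0 ::
    "(complex \<Rightarrow> complex) \<Rightarrow> (complex \<Rightarrow> complex) \<Rightarrow> bool" where
  "real_analytically_conjugate0 f g \<longleftrightarrow>
     (\<exists>\<phi> \<psi> :: complex \<Rightarrow> complex.
        real_analytic_at \<phi> 0 \<and> real_analytic_at \<psi> 0 \<and> \<phi> 0 = 0 \<and> \<psi> 0 = 0 \<and>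
        (\<forall>\<^sub>F z in nhds 0. \<psi> (\<phi> z) = z) \<and> (\<forall>\<^sub>F z in nhds 0. \<phi> (\<psi> z) = z) \<and>
        (\<forall>\<^sub>F z in nhds 0. \<psi> (f (\<phi> z)) = g z))"

end

theory Submission
  imports Defs "HOL-Library.Landau_Symbols"
    "HOL-Computational_Algebra.Formal_Power_Series" "HOL-Computational_Algebra.Polynomial"
begin

text \<open>
  The map \<open>g = f\<^sup>q\<close> is tangent to the identity and preserves \<open>I\<^sub>1\<close> and \<open>I\<^sub>2\<close>. If \<open>g\<close> is not the identity,
  let \<open>\<eta>\<close> be the leading homogeneous part of \<open>g - id\<close>. The leading form \<open>J\<^sub>m\<close> of any first integral of
  \<open>g\<close> satisfies \<open>dJ\<^sub>m(\<eta>) = 0\<close>. For \<open>I\<^sub>1\<close> this form \<open>F\<close> is a definite quadratic form, so the differentials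
  of \<open>J\<^sub>m\<close> and \<open>F\<close> are proportional, and by homogeneity \<open>J\<^sub>m\<close> is a multiple of a power of \<open>F\<close>.
  Subtracting that multiple of a power of \<open>I\<^sub>1\<close> and iterating, \<open>I\<^sub>2\<close> agrees to every order with a polynomial
  in \<open>I\<^sub>1\<close>, so the analytic Jacobian of \<open>(I\<^sub>1, I\<^sub>2)\<close> vanishes near \<open>0\<close>, against independence.
  Hence \<open>f\<^sup>q = id\<close>, and averaging \<open>L\<^sup>-\<^sup>k \<circ> f\<^sup>k\<close> over \<open>k < q\<close> gives a linearizing coordinate.

  Analyticity of compositions and of inverse germs is obtained by working in the Banach algebra
  of double power series with absolutely summable coefficients: evaluation at a point is
  a continuous homomorphism, and the inverse is the fixed point of a contraction of that algebra.
\<close>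

section \<open>The Banach algebra of absolutely convergent power series\<close>

text \<open>Two obstacles shape the argument. The successive corrections to the polynomial in
  \<open>I\<^sub>1\<close> define a formal series, and nothing is known about its convergence. The
  Jacobian avoids the question: polynomials in \<open>I\<^sub>1\<close> do not contribute to it, so
  it inherits the vanishing order of the remainder, and an analytic germ that vanishes to every
  order is zero. The other point is that the exponent of F is an integer. Definiteness makes
  F^(-m/2) smooth away from the origin, connectedness of the punctured plane yields one constant for
  all directions, and the symmetry p -> -p excludes odd m.

  The algebra is the one-variable construction applied twice. The norm is the sum of the norms of
  the coefficients, since the Cauchy product then makes it submultiplicative and evaluation at
  points of [-1, 1] does not increase it. Germs on small squares are reached by substituting \<rho>
  x and \<rho> y for the variables; a small \<rho> makes the substituted series small.\<close>

definition l1_fps :: "'a::real_normed_vector fps set" where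
  "l1_fps = {a. summable (\<lambda>n. norm (fps_nth a n))}"

lemma l1_fpsD: "a \<in> l1_fps \<Longrightarrow> summable (\<lambda>n. norm (fps_nth a n))"
  by (simp add: l1_fps_def)

lemma l1_fps_finite: "(\<And>n. n \<ge> N \<Longrightarrow> fps_nth a n = 0) \<Longrightarrow> a \<in> l1_fps"
  unfolding l1_fps_def mem_Collect_eq by (rule summable_finite[of "{..<N}"]) (auto simp: not_less)

lemma l1_fps_zero: "0 \<in> l1_fps" and l1_fps_one: "1 \<in> l1_fps" and l1_fps_X: "fps_X \<in> l1_fps"
  and l1_fps_const: "fps_const c \<in> l1_fps"
  by (rule l1_fps_finite[of 2]; simp)+

lemma l1_fps_add:
  assumes "a \<in> l1_fps" "b \<in> l1_fps"
  shows "a + b \<in> l1_fps"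
proof -
  have "summable (\<lambda>n. norm (fps_nth a n) + norm (fps_nth b n))"
    using assms unfolding l1_fps_def by (intro summable_add) auto
  then show ?thesis
    unfolding l1_fps_def mem_Collect_eq
    by (rule summable_comparison_test') (simp add: norm_triangle_ineq)
qed

lemma l1_fps_uminus: "a \<in> l1_fps \<Longrightarrow> - a \<in> l1_fps"
  by (simp add: l1_fps_def)

lemma l1_fps_diff: "a \<in> l1_fps \<Longrightarrow> b \<in> l1_fps \<Longrightarrow> a - b \<in> l1_fps"
  using l1_fps_add[OF _ l1_fps_uminus] by fastforce

lemma norm_fps_mult_nth:
  fixes a b :: "'a::{comm_ring_1, real_normed_algebra_1} fps"
  shows "norm (fps_nth (a * b) n) \<le> (\<Sum>i\<le>n. norm (fps_nth a i) * norm (fps_nth b (n - i)))"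
  unfolding fps_mult_nth atLeast0AtMost by (rule sum_norm_le) (rule norm_mult_ineq)

text \<open>The norms of the coefficients of a product are dominated by the Cauchy product of the
  two norm series. The second claim becomes submultiplicativity of the norm of
  \<open>'a l1ps\<close>.\<close>

lemma l1_fps_mult:
  fixes a b :: "'a::{comm_ring_1, real_normed_algebra_1} fps"
  assumes "a \<in> l1_fps" "b \<in> l1_fps"
  shows "a * b \<in> l1_fps"
    and "(\<Sum>n. norm (fps_nth (a * b) n)) \<le> (\<Sum>n. norm (fps_nth a n)) * (\<Sum>n. norm (fps_nth b n))"
proof -
  let ?c = "\<lambda>n. \<Sum>i\<le>n. norm (fps_nth a i) * norm (fps_nth b (n - i))"
  have c: "?c sums ((\<Sum>n. norm (fps_nth a n)) * (\<Sum>n. norm (fps_nth b n)))"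
    by (rule Cauchy_product_sums) (use assms in \<open>auto simp: l1_fps_def\<close>)
  have s: "summable (\<lambda>n. norm (fps_nth (a * b) n))"
    by (rule summable_comparison_test'[OF sums_summable[OF c]]) (simp add: norm_fps_mult_nth)
  then show "a * b \<in> l1_fps" by (simp add: l1_fps_def)
  show "(\<Sum>n. norm (fps_nth (a * b) n)) \<le> (\<Sum>n. norm (fps_nth a n)) * (\<Sum>n. norm (fps_nth b n))"
    using suminf_le[OF norm_fps_mult_nth s sums_summable[OF c]] sums_unique[OF c] by simp
qed

typedef (overloaded) 'a l1ps = "l1_fps :: 'a::real_normed_vector fps set"
  by (rule exI[of _ 0]) (simp add: l1_fps_def)

setup_lifting type_definition_l1ps

lift_definition l1_nth :: "'a::real_normed_vector l1ps \<Rightarrow> nat \<Rightarrow> 'a" is fps_nth .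

instantiation l1ps :: ("{comm_ring_1, real_normed_algebra_1}") real_normed_algebra_1
begin

lift_definition zero_l1ps :: "'a l1ps" is 0 by (rule l1_fps_zero)
lift_definition one_l1ps :: "'a l1ps" is 1 by (rule l1_fps_one)
lift_definition plus_l1ps :: "'a l1ps \<Rightarrow> 'a l1ps \<Rightarrow> 'a l1ps" is "(+)" by (rule l1_fps_add)
lift_definition minus_l1ps :: "'a l1ps \<Rightarrow> 'a l1ps \<Rightarrow> 'a l1ps" is "(-)" by (rule l1_fps_diff)
lift_definition uminus_l1ps :: "'a l1ps \<Rightarrow> 'a l1ps" is "uminus" by (rule l1_fps_uminus)
lift_definition times_l1ps :: "'a l1ps \<Rightarrow> 'a l1ps \<Rightarrow> 'a l1ps" is "(*)" by (rule l1_fps_mult)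
text \<open>Scaling is multiplication by a constant series, so the scaling laws come from ring laws
  and from \<open>fps_const\<close> being a ring homomorphism.\<close>

lift_definition scaleR_l1ps :: "real \<Rightarrow> 'a l1ps \<Rightarrow> 'a l1ps" is "\<lambda>r a. fps_const (of_real r) * a"
  by (rule l1_fps_mult(1)[OF l1_fps_const])
lift_definition norm_l1ps :: "'a l1ps \<Rightarrow> real" is "\<lambda>a. \<Sum>n. norm (fps_nth a n)" .

definition sgn_l1ps :: "'a l1ps \<Rightarrow> 'a l1ps" where "sgn_l1ps a = inverse (norm a) *\<^sub>R a"
definition dist_l1ps :: "'a l1ps \<Rightarrow> 'a l1ps \<Rightarrow> real" where "dist_l1ps a b = norm (a - b)"
definition uniformity_l1ps :: "('a l1ps \<times> 'a l1ps) filter" where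
  "uniformity_l1ps = (INF e\<in>{0 <..}. principal {(x, y). dist x y < e})"
definition open_l1ps :: "'a l1ps set \<Rightarrow> bool" where
  "open_l1ps S = (\<forall>x\<in>S. \<forall>\<^sub>F (x', y) in uniformity. x' = x \<longrightarrow> y \<in> S)"

instance
proof
  fix a b c :: "'a l1ps" and r s :: real
  show "a + b + c = a + (b + c)" by transfer (rule add.assoc)
  show "a + b = b + a" by transfer (rule add.commute)
  show "0 + a = a" by transfer (rule add_0)
  show "- a + a = 0" by transfer (rule left_minus)
  show "a - b = a + - b" by transfer (rule diff_conv_add_uminus)
  show "a * b * c = a * (b * c)" by transfer (rule mult.assoc)
  show "(a + b) * c = a * c + b * c" by transfer (rule distrib_right)
  show "a * (b + c) = a * b + a * c" by transfer (rule distrib_left)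
  show "1 * a = a" by transfer (rule mult_1)
  show "a * 1 = a" by transfer (rule mult_1_right)
  show "(0::'a l1ps) \<noteq> 1" by transfer (rule zero_neq_one)
  show "r *\<^sub>R (a + b) = r *\<^sub>R a + r *\<^sub>R b" by transfer (rule distrib_left)
  show "(r + s) *\<^sub>R a = r *\<^sub>R a + s *\<^sub>R a"
    by transfer (simp add: distrib_right flip: fps_const_add)
  show "r *\<^sub>R s *\<^sub>R a = (r * s) *\<^sub>R a"
    by transfer (simp add: mult.assoc flip: fps_const_mult)
  show "1 *\<^sub>R a = a" by transfer simp
  show "r *\<^sub>R a * b = r *\<^sub>R (a * b)" by transfer (rule mult.assoc)
  show "a * r *\<^sub>R b = r *\<^sub>R (a * b)" by transfer (rule mult.left_commute)
  show "sgn a = inverse (norm a) *\<^sub>R a" by (rule sgn_l1ps_def)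
  show "dist a b = norm (a - b)" by (rule dist_l1ps_def)
  show "uniformity = (INF e\<in>{0 <..}. principal {(x::'a l1ps, y). dist x y < e})"
    by (rule uniformity_l1ps_def)
  show "open U = (\<forall>x\<in>U. \<forall>\<^sub>F (x', y) in uniformity. x' = x \<longrightarrow> y \<in> U)" for U :: "'a l1ps set"
    by (rule open_l1ps_def)
  show "norm (a * b) \<le> norm a * norm b" by transfer (rule l1_fps_mult)
  show "norm (1 :: 'a l1ps) = 1"
    by transfer (subst suminf_finite[of "{0}"]; simp)
  show "norm a = 0 \<longleftrightarrow> a = 0"
    by transfer (auto simp: suminf_eq_zero_iff fps_eq_iff dest: l1_fpsD)
  show "norm (a + b) \<le> norm a + norm b"
  proof transfer
    fix a b :: "'a fps" assume ab: "a \<in> l1_fps" "b \<in> l1_fps"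
    have "(\<Sum>n. norm (fps_nth (a + b) n)) \<le> (\<Sum>n. norm (fps_nth a n) + norm (fps_nth b n))"
      by (rule suminf_le[OF _ l1_fpsD[OF l1_fps_add] summable_add])
        (use ab in \<open>auto simp: norm_triangle_ineq dest: l1_fpsD\<close>)
    then show "(\<Sum>n. norm (fps_nth (a + b) n)) \<le> (\<Sum>n. norm (fps_nth a n)) + (\<Sum>n. norm (fps_nth b n))"
      using ab by (simp add: suminf_add l1_fpsD)
  qed
  show "norm (r *\<^sub>R a) = \<bar>r\<bar> * norm a"
  proof transfer
    fix a :: "'a fps" and r :: real assume "a \<in> l1_fps"
    moreover have "norm (fps_nth (fps_const (of_real r) * a) n) = \<bar>r\<bar> * norm (fps_nth a n)" for n
      by (metis fps_mult_left_const_nth norm_scaleR scaleR_conv_of_real)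
    ultimately show "(\<Sum>n. norm (fps_nth (fps_const (of_real r) * a) n)) = \<bar>r\<bar> * (\<Sum>n. norm (fps_nth a n))"
      by (simp only: suminf_mult[OF l1_fpsD])
  qed
qed

end

instance l1ps :: ("{comm_ring_1, real_normed_algebra_1}") comm_ring_1
proof
  fix a b c :: "'a l1ps"
  show "a * b = b * a" by transfer (rule mult.commute)
qed (simp_all add: distrib_right)

lemma summable_l1_nth: "summable (\<lambda>n. norm (l1_nth a n))"
  by transfer (rule l1_fpsD)

lemma norm_l1_def: "norm a = (\<Sum>n. norm (l1_nth a n))"
  by transfer simp

lemma l1_nth_simps [simp]:
  "l1_nth (a - b) n = l1_nth a n - l1_nth b n"
  "l1_nth (a + b) n = l1_nth a n + l1_nth b n"
  "l1_nth (r *\<^sub>R a) n = r *\<^sub>R l1_nth a n"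
  by (transfer; simp add: scaleR_conv_of_real)+

lemma l1_nth_mult: "l1_nth (a * b) n = (\<Sum>i\<le>n. l1_nth a i * l1_nth b (n - i))"
  by transfer (simp add: fps_mult_nth atLeast0AtMost)

lemma sum_norm_l1_nth_le: 
  fixes a :: "'a::{comm_ring_1, real_normed_algebra_1} l1ps"
  shows "(\<Sum>n<K. norm (l1_nth a n)) \<le> norm a"
  unfolding norm_l1_def by (rule sum_le_suminf[OF summable_l1_nth]) auto

lemma norm_l1_nth_le: 
  fixes a :: "'a::{comm_ring_1, real_normed_algebra_1} l1ps"
  shows "norm (l1_nth a n) \<le> norm a"
proof -
  have "norm (l1_nth a n) \<le> (\<Sum>i<Suc n. norm (l1_nth a i))"
    by (rule member_le_sum) auto
  with sum_norm_l1_nth_le[of a "Suc n"] show ?thesis by linarith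
qed

lemma summable_partial_sums_bounded:
  fixes f :: "nat \<Rightarrow> real"
  assumes "\<And>n. f n \<ge> 0" "\<And>K. (\<Sum>n<K. f n) \<le> e"
  shows "summable f" "suminf f \<le> e"
proof -
  show "summable f"
    using assms by (intro bounded_imp_summable[of f e]) (auto simp flip: lessThan_Suc_atMost simp del: sum.lessThan_Suc)
  then show "suminf f \<le> e" by (rule suminf_le_const) (use assms in auto)
qed

text \<open>Completeness of an l1 space: the coefficients converge one by one, and the Cauchy
  estimate restricted to finitely many coefficients survives the limit, uniformly in their
  number.\<close>

instance l1ps :: ("{comm_ring_1, real_normed_algebra_1, banach}") banach
proof
  fix X :: "nat \<Rightarrow> 'a l1ps" assume X: "Cauchy X"
  have "Cauchy (\<lambda>m. l1_nth (X m) n)" for n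
  proof (rule CauchyI)
    fix e :: real assume "e > 0"
    with X obtain M where M: "\<forall>m\<ge>M. \<forall>k\<ge>M. norm (X m - X k) < e" by (meson CauchyD)
    have "norm (l1_nth (X m) n - l1_nth (X k) n) < e" if "m \<ge> M" "k \<ge> M" for m k
      using norm_l1_nth_le[of "X m - X k" n] M that by fastforce
    then show "\<exists>M. \<forall>m\<ge>M. \<forall>k\<ge>M. norm (l1_nth (X m) n - l1_nth (X k) n) < e" by blast
  qed
  then have "\<forall>n. \<exists>l. (\<lambda>m. l1_nth (X m) n) \<longlonglongrightarrow> l"
    by (simp add: Cauchy_convergent_iff convergent_def)
  then obtain b where b: "\<And>n. (\<lambda>m. l1_nth (X m) n) \<longlonglongrightarrow> b n" by metis
  \<comment> \<open>Uniformity in \<open>K\<close> is the point: it gives summability of the limit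
    coefficients and afterwards convergence in norm.\<close>
  have tail: "\<exists>M. \<forall>m\<ge>M. \<forall>K. (\<Sum>n<K. norm (l1_nth (X m) n - b n)) \<le> e" if e: "e > 0" for e
  proof -
    from X e obtain M where M: "\<forall>m\<ge>M. \<forall>k\<ge>M. norm (X m - X k) < e" by (meson CauchyD)
    have "(\<Sum>n<K. norm (l1_nth (X m) n - b n)) \<le> e" if m: "m \<ge> M" for m K
    proof (rule LIMSEQ_le_const2)
      show "(\<lambda>k. \<Sum>n<K. norm (l1_nth (X m) n - l1_nth (X k) n)) \<longlonglongrightarrow> (\<Sum>n<K. norm (l1_nth (X m) n - b n))"
        by (intro tendsto_intros b)
      have "(\<Sum>n<K. norm (l1_nth (X m) n - l1_nth (X k) n)) \<le> e" if "k \<ge> M" for k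
        using sum_norm_l1_nth_le[of "X m - X k" K] M m that by fastforce
      then show "\<exists>N. \<forall>k\<ge>N. (\<Sum>n<K. norm (l1_nth (X m) n - l1_nth (X k) n)) \<le> e" by blast
    qed
    then show ?thesis by blast
  qed
  have "Abs_fps b \<in> l1_fps"
  proof -
    obtain m where m: "\<And>K. (\<Sum>n<K. norm (l1_nth (X m) n - b n)) \<le> 1"
      using tail[of 1] by auto
    have "summable (\<lambda>n. norm (l1_nth (X m) n - b n))"
      by (rule summable_partial_sums_bounded[OF _ m]) auto
    then have "summable (\<lambda>n. norm (l1_nth (X m) n - b n) + norm (l1_nth (X m) n))"
      by (intro summable_add summable_l1_nth)
    then have "summable (\<lambda>n. norm (b n))"
      by (rule summable_comparison_test')
        (metis add.commute norm_minus_commute real_norm_def abs_norm_cancel norm_triangle_sub)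
    then show ?thesis by (simp add: l1_fps_def)
  qed
  then have B: "l1_nth (Abs_l1ps (Abs_fps b)) = b"
    by (simp add: l1_nth.rep_eq Abs_l1ps_inverse fun_eq_iff)
  have "X \<longlonglongrightarrow> Abs_l1ps (Abs_fps b)"
  proof (rule LIMSEQ_I)
    fix e :: real assume "e > 0"
    then obtain M where M: "\<forall>m\<ge>M. \<forall>K. (\<Sum>n<K. norm (l1_nth (X m) n - b n)) \<le> e / 2"
      using tail[of "e/2"] by auto
    have "norm (X m - Abs_l1ps (Abs_fps b)) < e" if "m \<ge> M" for m
    proof -
      have "norm (X m - Abs_l1ps (Abs_fps b)) \<le> e/2"
        unfolding norm_l1_def by (rule summable_partial_sums_bounded) (use M that B in auto)
      with \<open>e > 0\<close> show ?thesis by linarith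
    qed
    then show "\<exists>M. \<forall>m\<ge>M. norm (X m - Abs_l1ps (Abs_fps b)) < e" by blast
  qed
  then show "convergent X" by (auto simp: convergent_def)
qed

section \<open>Evaluation at points of [-1, 1] as a continuous homomorphism\<close>

definition l1_eval :: "real \<Rightarrow> 'a::{comm_ring_1, real_normed_algebra_1, banach} l1ps \<Rightarrow> 'a" where
  "l1_eval x a = (\<Sum>n. x ^ n *\<^sub>R l1_nth a n)"

context
  fixes x :: real
  assumes x: "\<bar>x\<bar> \<le> 1"
begin

lemma norm_l1_eval_term: "norm (x ^ n *\<^sub>R l1_nth a n) \<le> norm (l1_nth a n)"
  using x by (simp add: power_abs mult_left_le_one_le power_le_one)

lemma summable_l1_eval: "summable (\<lambda>n. norm (x ^ n *\<^sub>R l1_nth a n))"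
  by (rule summable_comparison_test'[OF summable_l1_nth[of a]]) (use norm_l1_eval_term[of _ a] in auto)

lemma l1_eval_sums: "(\<lambda>n. x ^ n *\<^sub>R l1_nth a n) sums l1_eval x a"
  unfolding l1_eval_def by (rule summable_sums[OF summable_norm_cancel[OF summable_l1_eval]])

lemma norm_l1_eval_le: "norm (l1_eval x a) \<le> norm a"
proof -
  have "norm (l1_eval x a) \<le> (\<Sum>n. norm (x ^ n *\<^sub>R l1_nth a n))"
    unfolding l1_eval_def by (rule summable_norm[OF summable_l1_eval])
  also have "\<dots> \<le> norm a"
    unfolding norm_l1_def by (rule suminf_le[OF norm_l1_eval_term summable_l1_eval summable_l1_nth])
  finally show ?thesis .
qed

lemma bounded_linear_l1_eval: "bounded_linear (l1_eval x)"
proof (rule bounded_linear_intro[of _ 1])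
  fix a b :: "'a l1ps" and r :: real
  show "l1_eval x (a + b) = l1_eval x a + l1_eval x b"
    using sums_add[OF l1_eval_sums[of a] l1_eval_sums[of b]]
    by (auto simp: l1_eval_def scaleR_add_right sums_iff)
  show "l1_eval x (r *\<^sub>R a) = r *\<^sub>R l1_eval x a"
    using sums_scaleR_right[OF l1_eval_sums[of a], of r]
    by (auto simp: l1_eval_def sums_iff mult.commute)
qed (simp add: norm_l1_eval_le)

text \<open>Cauchy product of absolutely convergent series. Together with bounded linearity this
  supplies the hypotheses of \<open>pser_hom\<close>.\<close>

lemma l1_eval_mult: "l1_eval x (a * b) = l1_eval x a * l1_eval x b"
proof -
  have "l1_eval x a * l1_eval x b =
      (\<Sum>n. \<Sum>i\<le>n. (x ^ i *\<^sub>R l1_nth a i) * (x ^ (n - i) *\<^sub>R l1_nth b (n - i)))"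
    unfolding l1_eval_def by (rule Cauchy_product[OF summable_l1_eval summable_l1_eval])
  also have "\<dots> = (\<Sum>n. x ^ n *\<^sub>R l1_nth (a * b) n)"
    by (intro suminf_cong) (simp add: l1_nth_mult scaleR_sum_right flip: power_add)
  finally show ?thesis by (simp add: l1_eval_def)
qed

end

lemma l1_eval_one [simp]: "l1_eval x 1 = 1"
  unfolding l1_eval_def by transfer (subst suminf_finite[of "{0}"]; simp)

lift_definition l1_X :: "'a::{comm_ring_1, real_normed_algebra_1} l1ps" is fps_X by (rule l1_fps_X)
lift_definition l1_const :: "'a::real_normed_vector \<Rightarrow> 'a l1ps" is fps_const by (rule l1_fps_const)

lemma norm_l1_X [simp]: "norm (l1_X :: 'a::{comm_ring_1, real_normed_algebra_1} l1ps) = 1"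
  by transfer (subst suminf_finite[of "{1}"]; simp)

lemma norm_l1_const [simp]: "norm (l1_const c) = norm c"
  by transfer (subst suminf_finite[of "{0}"]; simp)

lemma l1_eval_X [simp]: "l1_eval x l1_X = of_real x"
  unfolding l1_eval_def by transfer (subst suminf_finite[of "{1}"]; simp add: of_real_def)

lemma l1_eval_const [simp]: "l1_eval x (l1_const c) = c"
  unfolding l1_eval_def by transfer (subst suminf_finite[of "{0}"]; simp)

section \<open>Double power series in a commutative Banach algebra\<close>

text \<open>A sort that contains \<open>real\<close> and is closed under \<open>l1ps\<close>: one
  estimate serves the reals and, by iteration, series in two variables.\<close>

class comm_banach_algebra_1 = comm_ring_1 + real_normed_algebra_1 + banach

instance real :: comm_banach_algebra_1 ..
instance l1ps :: (comm_banach_algebra_1) comm_banach_algebra_1 ..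

text \<open>The coefficients stay real while the arguments range over any algebra of the class. With
  real arguments this is a function value; with arguments in \<open>real l1ps l1ps\<close> it is the
  substitution of two power series.\<close>

definition pser :: "(nat \<Rightarrow> nat \<Rightarrow> real) \<Rightarrow> 'a \<Rightarrow> 'a \<Rightarrow> 'a::comm_banach_algebra_1" where
  "pser a u v = (\<Sum>\<^sub>\<infinity>(i, j). a i j *\<^sub>R (u ^ i * v ^ j))"

definition pser_conv :: "(nat \<Rightarrow> nat \<Rightarrow> real) \<Rightarrow> real \<Rightarrow> bool" where
  "pser_conv a r \<longleftrightarrow> r > 0 \<and> (\<lambda>(i, j). \<bar>a i j\<bar> * r ^ (i + j)) summable_on UNIV"

definition hpart :: "nat \<Rightarrow> (nat \<Rightarrow> nat \<Rightarrow> real) \<Rightarrow> 'a \<Rightarrow> 'a \<Rightarrow> 'a::comm_banach_algebra_1" where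
  "hpart n a u v = (\<Sum>i\<le>n. a i (n - i) *\<^sub>R (u ^ i * v ^ (n - i)))"

definition tail :: "nat \<Rightarrow> (nat \<Rightarrow> nat \<Rightarrow> real) \<Rightarrow> nat \<Rightarrow> nat \<Rightarrow> real" where
  "tail N a i j = (if i + j < N then 0 else a i j)"

lemma pser_convD: "pser_conv a r \<Longrightarrow> r > 0"
  by (simp add: pser_conv_def)

lemma pser_conv_mono:
  assumes "pser_conv a r" "0 < s" "s \<le> r"
  shows "pser_conv a s"
  unfolding pser_conv_def
proof (intro conjI)
  show "(\<lambda>(i, j). \<bar>a i j\<bar> * s ^ (i + j)) summable_on UNIV"
    by (rule summable_on_comparison_test[where f = "\<lambda>(i, j). \<bar>a i j\<bar> * r ^ (i + j)"])
      (use assms in \<open>auto simp: pser_conv_def intro!: mult_left_mono power_mono\<close>)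
qed fact

lemma pser_conv_tail:
  assumes "pser_conv a r"
  shows "pser_conv (tail N a) r"
  unfolding pser_conv_def
proof (intro conjI)
  show "(\<lambda>(i, j). \<bar>tail N a i j\<bar> * r ^ (i + j)) summable_on UNIV"
    by (rule summable_on_comparison_test[where f = "\<lambda>(i, j). \<bar>a i j\<bar> * r ^ (i + j)"])
      (use assms in \<open>auto simp: pser_conv_def tail_def\<close>)
qed (rule pser_convD[OF assms])

lemma norm_power_mult_le:
  fixes u v :: "'a::comm_banach_algebra_1"
  assumes "norm u \<le> r" "norm v \<le> r"
  shows "norm (u ^ i * v ^ j) \<le> r ^ (i + j)"
proof -
  have "norm (u ^ i * v ^ j) \<le> norm u ^ i * norm v ^ j"
    by (meson norm_mult_ineq norm_power_ineq mult_mono norm_ge_zero order_trans zero_le_power)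
  also have "\<dots> \<le> r ^ i * r ^ j"
    using assms order_trans[OF norm_ge_zero assms(1)] by (intro mult_mono power_mono) auto
  finally show ?thesis by (simp add: power_add)
qed

lemma pser_abs_summable:
  fixes u v :: "'a::comm_banach_algebra_1"
  assumes "pser_conv a r" "norm u \<le> r" "norm v \<le> r"
  shows "(\<lambda>(i, j). a i j *\<^sub>R (u ^ i * v ^ j)) abs_summable_on UNIV"
proof (rule Infinite_Sum.abs_summable_on_comparison_test')
  show "(\<lambda>(i, j). \<bar>a i j\<bar> * r ^ (i + j)) summable_on UNIV"
    using assms(1) by (simp add: pser_conv_def)
qed (use assms(2,3) in \<open>auto intro!: mult_left_mono norm_power_mult_le\<close>)

lemma pser_has_sum:
  fixes u v :: "'a::comm_banach_algebra_1"
  assumes "pser_conv a r" "norm u \<le> r" "norm v \<le> r"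
  shows "((\<lambda>(i, j). a i j *\<^sub>R (u ^ i * v ^ j)) has_sum pser a u v) UNIV"
  unfolding pser_def by (rule has_sum_infsum[OF abs_summable_summable[OF pser_abs_summable[OF assms]]])

text \<open>A continuous homomorphism passes through the infinite sum. Applied to evaluation at a
  point, this turns a substitution carried out in the algebra into pointwise composition.\<close>

lemma pser_hom:
  fixes T :: "'a::comm_banach_algebra_1 \<Rightarrow> 'b::comm_banach_algebra_1"
  assumes "bounded_linear T" "\<And>u v. T (u * v) = T u * T v" "T 1 = 1"
    and "pser_conv a r" "norm u \<le> r" "norm v \<le> r"
  shows "T (pser a u v) = pser a (T u) (T v)"
proof -
  interpret bounded_linear T by fact
  have pow: "T (u ^ i) = T u ^ i" for u i
    by (induction i) (simp_all add: assms(2,3))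
  have "((\<lambda>x. T (case x of (i, j) \<Rightarrow> a i j *\<^sub>R (u ^ i * v ^ j))) has_sum T (pser a u v)) UNIV"
    by (rule has_sum_bounded_linear[OF assms(1) pser_has_sum[OF assms(4-6)]])
  then have "((\<lambda>(i, j). a i j *\<^sub>R (T u ^ i * T v ^ j)) has_sum T (pser a u v)) UNIV"
    by (simp add: case_prod_unfold scale pow assms(2))
  then show ?thesis unfolding pser_def by (simp add: infsumI)
qed

lemma pser_zero: "pser a 0 0 = a 0 0 *\<^sub>R 1"
proof -
  have "((\<lambda>(i, j). a i j *\<^sub>R (0 ^ i * 0 ^ j :: 'a)) has_sum a 0 0 *\<^sub>R 1) UNIV"
    by (rule has_sum_finite_neutralI[of "{(0, 0)}"]) (auto simp: power_0_left split: if_splits)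
  then show ?thesis unfolding pser_def by (rule infsumI)
qed

lemma pser_split:
  fixes u v :: "'a::comm_banach_algebra_1"
  assumes "pser_conv a r" "norm u \<le> r" "norm v \<le> r"
  shows "pser a u v = (\<Sum>n<N. hpart n a u v) + pser (tail N a) u v"
proof -
  define g where "g i j = a i j *\<^sub>R (u ^ i * v ^ j)" for i j
  have fin: "finite {(i, j). i + j < N}"
    by (rule finite_subset[of _ "{..<N} \<times> {..<N}"]) auto
  \<comment> \<open>The finite part is extended by zero to all index pairs, so that it can be added
    term by term to the tail.\<close>
  have "((\<lambda>x. (if fst x + snd x < N then g (fst x) (snd x) else 0)) has_sum (\<Sum>(i, j)\<in>{(i, j). i + j < N}. g i j)) UNIV"
    by (rule has_sum_finite_neutralI[OF fin]) (auto intro!: sum.cong)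
  moreover have "((\<lambda>(i, j). tail N a i j *\<^sub>R (u ^ i * v ^ j)) has_sum pser (tail N a) u v) UNIV"
    by (rule pser_has_sum[OF pser_conv_tail]) fact+
  ultimately have "((\<lambda>x. (if fst x + snd x < N then g (fst x) (snd x) else 0) +
      (case x of (i, j) \<Rightarrow> tail N a i j *\<^sub>R (u ^ i * v ^ j))) has_sum
      (\<Sum>(i, j)\<in>{(i, j). i + j < N}. g i j) + pser (tail N a) u v) UNIV"
    by (rule has_sum_add)
  also have "(\<lambda>x. (if fst x + snd x < N then g (fst x) (snd x) else 0) +
      (case x of (i, j) \<Rightarrow> tail N a i j *\<^sub>R (u ^ i * v ^ j))) = (\<lambda>(i, j). a i j *\<^sub>R (u ^ i * v ^ j))"
    by (auto simp: fun_eq_iff tail_def g_def)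
  finally have "pser a u v = (\<Sum>(i, j)\<in>{(i, j). i + j < N}. g i j) + pser (tail N a) u v"
    unfolding pser_def[of a] by (rule infsumI)
  also have "(\<Sum>(i, j)\<in>{(i, j). i + j < N}. g i j) = (\<Sum>n<N. hpart n a u v)"
    by (simp add: sum.triangle_reindex hpart_def g_def)
  finally show ?thesis .
qed

section \<open>Lipschitz estimates for double power series\<close>

lemma norm_power_Suc_diff_le:
  fixes u u' :: "'a::comm_banach_algebra_1"
  assumes "norm u \<le> s" "norm u' \<le> s"
  shows "norm (u ^ Suc n - u' ^ Suc n) \<le> real (Suc n) * s ^ n * norm (u - u')"
proof (induction n)
  case (Suc n)
  have "s \<ge> 0" using assms(1) norm_ge_zero order_trans by blast
  have "norm (u ^ Suc (Suc n) - u' ^ Suc (Suc n)) =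
      norm (u * (u ^ Suc n - u' ^ Suc n) + (u - u') * u' ^ Suc n)"
    by (simp add: algebra_simps)
  also have "\<dots> \<le> norm u * norm (u ^ Suc n - u' ^ Suc n) + norm (u - u') * norm (u' ^ Suc n)"
    by (rule order_trans[OF norm_triangle_ineq add_mono[OF norm_mult_ineq norm_mult_ineq]])
  also have "\<dots> \<le> s * (real (Suc n) * s ^ n * norm (u - u')) + norm (u - u') * s ^ Suc n"
    using Suc assms \<open>s \<ge> 0\<close>
    by (intro add_mono mult_mono order_trans[OF norm_power_ineq power_mono]) auto
  also have "\<dots> = real (Suc (Suc n)) * s ^ Suc n * norm (u - u')"
    by (simp add: algebra_simps)
  finally show ?case .
qed simp

text \<open>The factor \<open>s ^ (i + j) / s\<close> stands for the power with exponent i + j - 1;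
  it also makes sense in degree 0, where the prefactor vanishes.\<close>

lemma norm_monom_diff_le:
  fixes u v u' v' :: "'a::comm_banach_algebra_1"
  assumes "norm u \<le> s" "norm v \<le> s" "norm u' \<le> s" "norm v' \<le> s" "s > 0"
  shows "norm (u ^ i * v ^ j - u' ^ i * v' ^ j) \<le>
    real (i + j) * s ^ (i + j) / s * (norm (u - u') + norm (v - v'))"
proof -
  have p: "norm (x ^ k - y ^ k) \<le> real k * s ^ k / s * norm (x - y)"
    if "norm x \<le> s" "norm y \<le> s" for x y :: 'a and k
    using norm_power_Suc_diff_le[OF that, of "k - 1"] \<open>s > 0\<close> by (cases k) auto
  have "norm (u ^ i * v ^ j - u' ^ i * v' ^ j) = norm ((u ^ i - u' ^ i) * v ^ j + u' ^ i * (v ^ j - v' ^ j))"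
    by (simp add: algebra_simps)
  also have "\<dots> \<le> norm (u ^ i - u' ^ i) * norm (v ^ j) + norm (u' ^ i) * norm (v ^ j - v' ^ j)"
    by (rule order_trans[OF norm_triangle_ineq add_mono[OF norm_mult_ineq norm_mult_ineq]])
  also have "\<dots> \<le> (real i * s ^ i / s * norm (u - u')) * s ^ j + s ^ i * (real j * s ^ j / s * norm (v - v'))"
    using assms by (intro add_mono mult_mono p order_trans[OF norm_power_ineq power_mono]) auto
  also have "\<dots> = s ^ (i + j) / s * (real i * norm (u - u') + real j * norm (v - v'))"
    by (simp add: power_add distrib_left add_divide_distrib mult_ac)
  also have "\<dots> \<le> s ^ (i + j) / s * (real (i + j) * (norm (u - u') + norm (v - v')))"
    using \<open>s > 0\<close> by (intro mult_left_mono) (auto simp: algebra_simps)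
  finally show ?thesis by (simp add: mult_ac)
qed

text \<open>The origin of the halved radii in the estimates for differences and derivatives: a
  factor as large as the degree is absorbed by the powers of 2 that halving the radius
  gains.\<close>

lemma of_nat_le_two_power: "real n \<le> 2 ^ n"
  using of_nat_less_two_power[of n] by (metis less_eq_real_def)

definition pser_norm :: "(nat \<Rightarrow> nat \<Rightarrow> real) \<Rightarrow> real \<Rightarrow> real" where
  "pser_norm a r = (\<Sum>\<^sub>\<infinity>(i, j). \<bar>a i j\<bar> * r ^ (i + j))"

lemma pser_norm_has_sum:
  "pser_conv a r \<Longrightarrow> ((\<lambda>(i, j). \<bar>a i j\<bar> * r ^ (i + j)) has_sum pser_norm a r) UNIV"
  unfolding pser_norm_def pser_conv_def by (auto intro: has_sum_infsum)

lemma pser_norm_nonneg: "r \<ge> 0 \<Longrightarrow> pser_norm a r \<ge> 0"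
  unfolding pser_norm_def by (rule infsum_nonneg) auto

text \<open>A monomial of degree n has Lipschitz constant at most n s^(n-1); for s \<le> r/2 the
  factor n is paid for by 2^n, and degrees from \<open>N\<close> on leave \<open>s ^ (N - 1)\<close>
  as a common factor. The case \<open>N = 1\<close> bounds substituted series, \<open>N = 2\<close>
  gives a contraction, general \<open>N\<close> gives Taylor remainders.\<close>

lemma pser_lipschitz:
  fixes u v u' v' :: "'a::comm_banach_algebra_1"
  assumes "pser_conv a r" "\<And>i j. i + j < N \<Longrightarrow> a i j = 0" "N \<ge> 1"
    and s: "norm u \<le> s" "norm v \<le> s" "norm u' \<le> s" "norm v' \<le> s" "0 < s" "s \<le> r / 2"
  shows "norm (pser a u v - pser a u' v') \<le>
    pser_norm a r * (2 / r) ^ N * s ^ (N - 1) * (norm (u - u') + norm (v - v'))"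
proof -
  have r: "r > 0" using assms(1) by (rule pser_convD)
  let ?d = "norm (u - u') + norm (v - v')"
  have *: "\<bar>a i j\<bar> * (real (i + j) * s ^ (i + j) / s) \<le> \<bar>a i j\<bar> * r ^ (i + j) * ((2 / r) ^ N * s ^ (N - 1))" for i j
  proof (cases "i + j < N")
    case False
    define k where "k = i + j - N"
    have k: "i + j = N + k" using False by (simp add: k_def)
    have "real (N + k) * s ^ (N + k) / s = s ^ (N - 1) * (real (N + k) * s ^ k)"
      using \<open>N \<ge> 1\<close> \<open>0 < s\<close> by (cases N) (auto simp: power_add)
    also have "\<dots> \<le> s ^ (N - 1) * (2 ^ (N + k) * (r / 2) ^ k)"
      using s of_nat_le_two_power[of "N + k"] by (intro mult_left_mono mult_mono power_mono) auto
    also have "\<dots> = r ^ (N + k) * ((2 / r) ^ N * s ^ (N - 1))"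
      using r by (simp add: power_add power_divide)
    finally show ?thesis unfolding k mult.assoc
      by (intro mult_left_mono) auto
  qed (simp add: assms(2))
  have "((\<lambda>x. (case x of (i, j) \<Rightarrow> a i j *\<^sub>R (u ^ i * v ^ j)) - (case x of (i, j) \<Rightarrow> a i j *\<^sub>R (u' ^ i * v' ^ j)))
      has_sum pser a u v - pser a u' v') UNIV"
    unfolding diff_conv_add_uminus
    by (intro has_sum_add has_sum_uminusI pser_has_sum[OF assms(1)]) (use s r in auto)
  then show ?thesis
  proof (rule norm_infsum_le)
    show "((\<lambda>x. (case x of (i, j) \<Rightarrow> \<bar>a i j\<bar> * r ^ (i + j)) * ((2 / r) ^ N * s ^ (N - 1) * ?d)) has_sum
        pser_norm a r * (2 / r) ^ N * s ^ (N - 1) * ?d) UNIV"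
      using has_sum_cmult_left[OF pser_norm_has_sum[OF assms(1)], of "(2 / r) ^ N * s ^ (N - 1) * ?d"]
      by (simp add: mult.assoc)
    fix x :: "nat \<times> nat"
    obtain i j where x: "x = (i, j)" by fastforce
    have "norm (a i j *\<^sub>R (u ^ i * v ^ j) - a i j *\<^sub>R (u' ^ i * v' ^ j)) =
        \<bar>a i j\<bar> * norm (u ^ i * v ^ j - u' ^ i * v' ^ j)"
      by (simp flip: scaleR_diff_right)
    also have "\<dots> \<le> \<bar>a i j\<bar> * (real (i + j) * s ^ (i + j) / s * ?d)"
      by (intro mult_left_mono norm_monom_diff_le s) auto
    also have "\<dots> \<le> \<bar>a i j\<bar> * r ^ (i + j) * ((2 / r) ^ N * s ^ (N - 1)) * ?d"
      using mult_right_mono[OF *[of i j], of ?d] by (simp add: mult.assoc)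
    finally show "norm ((case x of (i, j) \<Rightarrow> a i j *\<^sub>R (u ^ i * v ^ j)) - (case x of (i, j) \<Rightarrow> a i j *\<^sub>R (u' ^ i * v' ^ j)))
        \<le> (case x of (i, j) \<Rightarrow> \<bar>a i j\<bar> * r ^ (i + j)) * ((2 / r) ^ N * s ^ (N - 1) * ?d)"
      by (simp add: x mult.assoc)
  qed
qed

section \<open>Real-analytic germs as double power series\<close>

text \<open>A closed square rather than a disc: the two arguments of \<open>pser\<close> are bounded
  separately, and absolute convergence at the corner controls the whole square.\<close>

definition ps_rep :: "(nat \<Rightarrow> nat \<Rightarrow> real) \<Rightarrow> real \<Rightarrow> (complex \<Rightarrow> real) \<Rightarrow> bool" where
  "ps_rep a r F \<longleftrightarrow> pser_conv a r \<and> (\<forall>z. \<bar>Re z\<bar> \<le> r \<longrightarrow> \<bar>Im z\<bar> \<le> r \<longrightarrow> F z = pser a (Re z) (Im z))"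

lemma ps_repD:
  assumes "ps_rep a r F"
  shows "pser_conv a r" "r > 0" "\<And>z. \<bar>Re z\<bar> \<le> r \<Longrightarrow> \<bar>Im z\<bar> \<le> r \<Longrightarrow> F z = pser a (Re z) (Im z)"
  using assms by (auto simp: ps_rep_def dest: pser_convD)

lemma ps_rep_mono: "ps_rep a r F \<Longrightarrow> 0 < s \<Longrightarrow> s \<le> r \<Longrightarrow> ps_rep a s F"
  by (auto simp: ps_rep_def intro: pser_conv_mono)

lemma real_analytic_atE:
  assumes "real_analytic_at F c"
  obtains a r where "r > 0" "\<And>z. z \<in> ball c r \<Longrightarrow>
    ((\<lambda>(i, j). (Re (z - c) ^ i * Im (z - c) ^ j) *\<^sub>R a i j) has_sum F z) UNIV"
proof -
  from assms[unfolded real_analytic_at_def] obtain a r where "r > 0 \<and> (\<forall>z\<in>ball c r.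
      ((\<lambda>(i, j). (Re (z - c) ^ i * Im (z - c) ^ j) *\<^sub>R a i j) has_sum F z) UNIV)"
    by (elim exE) (erule that)
  then show thesis by (intro that[of r a]) auto
qed

text \<open>Summability of a family of reals over an unordered index set is absolute, so convergence
  at the single corner point \<open>Complex s s\<close> suffices.\<close>

lemma real_analytic_at_imp_ps_rep:
  assumes "real_analytic_at F 0"
  obtains a r where "ps_rep a r F"
proof -
  obtain a r where r: "r > 0" and *: "\<And>z. z \<in> ball 0 r \<Longrightarrow>
      ((\<lambda>(i, j). (Re (z - 0) ^ i * Im (z - 0) ^ j) *\<^sub>R a i j) has_sum F z) UNIV"
    by (rule real_analytic_atE[OF assms]) (rule that)
  \<comment> \<open>Points of the square of half-side \<open>s\<close> have modulus at most
    \<open>2 * s\<close>, which is below \<open>r\<close>.\<close>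
  define s where "s = r / 3"
  have s: "s > 0" using r by (simp add: s_def)
  have in_ball: "z \<in> ball 0 r" if "\<bar>Re z\<bar> \<le> s" "\<bar>Im z\<bar> \<le> s" for z
    using cmod_le[of z] that r by (simp add: s_def)
  have "Complex s s \<in> ball 0 r"
    by (rule in_ball) (use s in simp_all)
  from *[OF this] have "((\<lambda>(i, j). (s ^ i * s ^ j) *\<^sub>R a i j) has_sum F (Complex s s)) UNIV"
    unfolding complex.sel diff_zero .
  then have "(\<lambda>(i, j). (s ^ i * s ^ j) *\<^sub>R a i j) summable_on UNIV"
    by (rule has_sum_imp_summable)
  then have "(\<lambda>x. norm (case x of (i, j) \<Rightarrow> (s ^ i * s ^ j) *\<^sub>R a i j)) summable_on UNIV"
    by (rule iffD1[OF summable_on_iff_abs_summable_on_real])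
  also have "(\<lambda>x. norm (case x of (i, j) \<Rightarrow> (s ^ i * s ^ j) *\<^sub>R a i j)) = (\<lambda>(i, j). \<bar>a i j\<bar> * s ^ (i + j))"
    using s by (auto simp: fun_eq_iff abs_mult power_add)
  finally have conv: "pser_conv a s" using s by (simp add: pser_conv_def)
  have "F z = pser a (Re z) (Im z)" if "\<bar>Re z\<bar> \<le> s" "\<bar>Im z\<bar> \<le> s" for z
    using *[OF in_ball[OF that]] unfolding pser_def
    by (intro infsumI[symmetric]) (simp add: mult.commute)
  then show ?thesis using that[of a s] conv by (simp add: ps_rep_def)
qed

lemma ps_rep_imp_real_analytic_at:
  assumes "ps_rep a r F"
  shows "real_analytic_at F 0"
  unfolding real_analytic_at_def
proof (intro exI conjI ballI)
  show "r > 0" using assms by (rule ps_repD)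
  fix z :: complex assume "z \<in> ball 0 r"
  then have "norm (Re z) \<le> r" "norm (Im z) \<le> r"
    using abs_Re_le_cmod[of z] abs_Im_le_cmod[of z] by auto
  from pser_has_sum[OF ps_repD(1)[OF assms] this] ps_repD(3)[OF assms] this
  show "((\<lambda>(i, j). (Re (z - 0) ^ i * Im (z - 0) ^ j) *\<^sub>R a i j) has_sum F z) UNIV"
    by (simp add: mult.commute)
qed

section \<open>Change of representative, of centre and of target\<close>

lemma real_analytic_at_cong:
  assumes "real_analytic_at F c" "\<forall>\<^sub>F z in nhds c. F z = G z"
  shows "real_analytic_at G c"
proof -
  obtain a r where r: "r > 0" and *: "\<And>z. z \<in> ball c r \<Longrightarrow>
      ((\<lambda>(i, j). (Re (z - c) ^ i * Im (z - c) ^ j) *\<^sub>R a i j) has_sum F z) UNIV"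
    by (rule real_analytic_atE[OF assms(1)]) (rule that)
  obtain d where d: "d > 0" "\<And>z. dist z c < d \<Longrightarrow> F z = G z"
    using assms(2) by (auto simp: eventually_nhds_metric)
  show ?thesis unfolding real_analytic_at_def
  proof (intro exI conjI ballI)
    show "min r d > 0" using r d by simp
    fix z assume "z \<in> ball c (min r d)"
    then have "z \<in> ball c r" "F z = G z" using d(2)[of z] by (auto simp: dist_commute)
    then show "((\<lambda>(i, j). (Re (z - c) ^ i * Im (z - c) ^ j) *\<^sub>R a i j) has_sum G z) UNIV"
      using *[of z] by simp
  qed
qed

lemma real_analytic_at_translate: "real_analytic_at F c \<longleftrightarrow> real_analytic_at (\<lambda>z. F (c + z)) 0"
proof -
  have "(\<forall>z\<in>ball c r. P (z - c) (F z)) \<longleftrightarrow> (\<forall>z\<in>ball 0 r. P (z - 0) (F (c + z)))" for r P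
  proof
    assume *: "\<forall>z\<in>ball c r. P (z - c) (F z)"
    show "\<forall>z\<in>ball 0 r. P (z - 0) (F (c + z))"
    proof
      fix z :: complex assume "z \<in> ball 0 r"
      then have "c + z \<in> ball c r" by (simp add: dist_norm)
      with * show "P (z - 0) (F (c + z))" by fastforce
    qed
  next
    assume *: "\<forall>z\<in>ball 0 r. P (z - 0) (F (c + z))"
    show "\<forall>z\<in>ball c r. P (z - c) (F z)"
    proof
      fix z :: complex assume "z \<in> ball c r"
      then have "z - c \<in> ball 0 r" by (simp add: dist_norm norm_minus_commute)
      with * show "P (z - c) (F z)" by fastforce
    qed
  qed
  note * = this[where P = "\<lambda>d y. ((\<lambda>(i, j). (Re d ^ i * Im d ^ j) *\<^sub>R a i j) has_sum y) UNIV" for a]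
  show ?thesis unfolding real_analytic_at_def * by simp
qed

lemma real_analytic_at_Re_Im:
  fixes F :: "complex \<Rightarrow> complex"
  shows "real_analytic_at F c \<longleftrightarrow> real_analytic_at (\<lambda>z. Re (F z)) c \<and> real_analytic_at (\<lambda>z. Im (F z)) c"
proof safe
  assume "real_analytic_at F c"
  then obtain a r where "r > 0" and *: "\<And>z. z \<in> ball c r \<Longrightarrow>
      ((\<lambda>(i, j). (Re (z - c) ^ i * Im (z - c) ^ j) *\<^sub>R a i j) has_sum F z) UNIV"
    by (rule real_analytic_atE) (rule that)
  have "\<forall>z\<in>ball c r. ((\<lambda>(i, j). (Re (z - c) ^ i * Im (z - c) ^ j) *\<^sub>R Re (a i j)) has_sum Re (F z)) UNIV"
    "\<forall>z\<in>ball c r. ((\<lambda>(i, j). (Re (z - c) ^ i * Im (z - c) ^ j) *\<^sub>R Im (a i j)) has_sum Im (F z)) UNIV"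
    using has_sum_Re[OF *] has_sum_Im[OF *] by (simp_all add: case_prod_unfold)
  then show "real_analytic_at (\<lambda>z. Re (F z)) c" "real_analytic_at (\<lambda>z. Im (F z)) c"
    unfolding real_analytic_at_def using \<open>r > 0\<close>
    by (intro exI[of _ "\<lambda>i j. Re (a i j)"] exI[of _ "\<lambda>i j. Im (a i j)"] exI[of _ r]; simp)+
next
  assume re: "real_analytic_at (\<lambda>z. Re (F z)) c" and im: "real_analytic_at (\<lambda>z. Im (F z)) c"
  from re obtain a r where "r > 0" and a: "\<And>z. z \<in> ball c r \<Longrightarrow>
      ((\<lambda>(i, j). (Re (z - c) ^ i * Im (z - c) ^ j) *\<^sub>R a i j) has_sum Re (F z)) UNIV"
    by (rule real_analytic_atE) (rule that)
  from im obtain b s where "s > 0" and b: "\<And>z. z \<in> ball c s \<Longrightarrow>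
      ((\<lambda>(i, j). (Re (z - c) ^ i * Im (z - c) ^ j) *\<^sub>R b i j) has_sum Im (F z)) UNIV"
    by (rule real_analytic_atE) (rule that)
  have "\<forall>z\<in>ball c (min r s).
      ((\<lambda>(i, j). (Re (z - c) ^ i * Im (z - c) ^ j) *\<^sub>R Complex (a i j) (b i j)) has_sum F z) UNIV"
  proof
    fix z assume z: "z \<in> ball c (min r s)"
    let ?m = "\<lambda>i j. Re (z - c) ^ i * Im (z - c) ^ j"
    have "((\<lambda>x. complex_of_real (case x of (i, j) \<Rightarrow> ?m i j *\<^sub>R a i j) +
        \<i> * complex_of_real (case x of (i, j) \<Rightarrow> ?m i j *\<^sub>R b i j)) has_sum
        (complex_of_real (Re (F z)) + \<i> * complex_of_real (Im (F z)))) UNIV"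
      using z a b by (intro has_sum_add has_sum_of_real has_sum_cmult_right) auto
    also have "complex_of_real (Re (F z)) + \<i> * complex_of_real (Im (F z)) = F z"
      by (simp add: complex_eq_iff)
    also have "(\<lambda>x. complex_of_real (case x of (i, j) \<Rightarrow> ?m i j *\<^sub>R a i j) +
        \<i> * complex_of_real (case x of (i, j) \<Rightarrow> ?m i j *\<^sub>R b i j)) = (\<lambda>(i, j). ?m i j *\<^sub>R Complex (a i j) (b i j))"
      by (auto simp: fun_eq_iff complex_eq_iff)
    finally show "((\<lambda>(i, j). ?m i j *\<^sub>R Complex (a i j) (b i j)) has_sum F z) UNIV" .
  qed
  then show "real_analytic_at F c"
    unfolding real_analytic_at_def using \<open>r > 0\<close> \<open>s > 0\<close>
    by (intro exI[of _ "\<lambda>i j. Complex (a i j) (b i j)"] exI[of _ "min r s"]) auto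
qed

section \<open>Taylor remainders and differentiability at the origin\<close>

lemma pser_tail_diff_le:
  assumes "pser_conv a r" "N \<ge> 1" "norm z \<le> s" "norm w \<le> s" "0 < s" "s \<le> r / 2"
  shows "\<bar>pser (tail N a) (Re z) (Im z) - pser (tail N a) (Re w) (Im w)\<bar> \<le>
    2 * pser_norm (tail N a) r * (2 / r) ^ N * s ^ (N - 1) * norm (z - w)"
proof -
  have r: "r > 0" using assms(1) by (rule pser_convD)
  have "norm (pser (tail N a) (Re z) (Im z) - pser (tail N a) (Re w) (Im w)) \<le>
      pser_norm (tail N a) r * (2 / r) ^ N * s ^ (N - 1) * (norm (Re z - Re w) + norm (Im z - Im w))"
    using abs_Re_le_cmod[of z] abs_Im_le_cmod[of z] abs_Re_le_cmod[of w] abs_Im_le_cmod[of w] assms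
    by (intro pser_lipschitz pser_conv_tail) (auto simp: tail_def)
  also have "\<dots> \<le> pser_norm (tail N a) r * (2 / r) ^ N * s ^ (N - 1) * (2 * norm (z - w))"
    using abs_Re_le_cmod[of "z - w"] abs_Im_le_cmod[of "z - w"] r assms pser_norm_nonneg[of r]
    by (intro mult_left_mono mult_nonneg_nonneg) auto
  finally show ?thesis by (simp add: mult_ac)
qed

lemma pser_tail_zero: "N \<ge> 1 \<Longrightarrow> pser (tail N a) 0 0 = 0"
  by (simp add: pser_zero tail_def)

lemma ps_rep_split:
  assumes "ps_rep a r F" "norm z \<le> r"
  shows "F z = (\<Sum>n<N. hpart n a (Re z) (Im z)) + pser (tail N a) (Re z) (Im z)"
proof -
  have "\<bar>Re z\<bar> \<le> r" "\<bar>Im z\<bar> \<le> r"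
    using abs_Re_le_cmod[of z] abs_Im_le_cmod[of z] assms(2) by auto
  then show ?thesis
    using ps_repD(3)[OF assms(1)] pser_split[OF ps_repD(1)[OF assms(1)], of "Re z" "Im z" N] by simp
qed

text \<open>The remainder vanishes at 0, so the Lipschitz bound between \<open>z\<close> and 0 with
  \<open>s = norm z\<close> produces the power of \<open>norm z\<close>, with a constant independent
  of \<open>z\<close>.\<close>

lemma pser_tail_le:
  assumes "pser_conv a r" "N \<ge> 1"
  obtains C where "C \<ge> 0" "\<And>z. norm z \<le> r / 2 \<Longrightarrow> \<bar>pser (tail N a) (Re z) (Im z)\<bar> \<le> C * norm z ^ N"
proof
  have r: "r > 0" using assms(1) by (rule pser_convD)
  show "2 * pser_norm (tail N a) r * (2 / r) ^ N \<ge> 0"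
    using r pser_norm_nonneg[of r "tail N a"] by simp
  fix z :: complex assume z: "norm z \<le> r / 2"
  show "\<bar>pser (tail N a) (Re z) (Im z)\<bar> \<le> 2 * pser_norm (tail N a) r * (2 / r) ^ N * norm z ^ N"
  proof (cases "z = 0")
    case False
    then have "\<bar>pser (tail N a) (Re z) (Im z) - pser (tail N a) (Re 0) (Im 0)\<bar> \<le>
      2 * pser_norm (tail N a) r * (2 / r) ^ N * norm z ^ (N - 1) * norm (z - 0)"
      using z by (intro pser_tail_diff_le assms) auto
    with assms(2) show ?thesis by (cases N) (auto simp: pser_tail_zero mult_ac)
  qed (use assms in \<open>auto simp: pser_tail_zero power_0_left\<close>)
qed

lemma ps_rep_has_derivative:
  assumes "ps_rep a r F"
  shows "(F has_derivative (\<lambda>h. a 1 0 * Re h + a 0 1 * Im h)) (at 0)"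
proof -
  have r: "r > 0" using assms by (rule ps_repD)
  obtain C where C: "C \<ge> 0" "\<And>z. norm z \<le> r / 2 \<Longrightarrow> \<bar>pser (tail 2 a) (Re z) (Im z)\<bar> \<le> C * norm z ^ 2"
    using pser_tail_le[OF ps_repD(1)[OF assms], of 2] by auto
  have split: "F z = a 0 0 + (a 1 0 * Re z + a 0 1 * Im z) + pser (tail 2 a) (Re z) (Im z)" if "norm z \<le> r / 2" for z
    using ps_rep_split[OF assms, of z 2] that r
    by (simp add: hpart_def numeral_2_eq_2 add_ac)
  have F0: "F 0 = a 0 0" using split[of 0] r by (simp add: pser_tail_zero)
  show ?thesis unfolding has_derivative_at_alt
  proof (intro conjI allI impI)
    show "bounded_linear (\<lambda>h. a 1 0 * Re h + a 0 1 * Im h)"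
      by (intro bounded_linear_add bounded_linear_const_mult bounded_linear_Re bounded_linear_Im)
    fix e :: real assume e: "e > 0"
    \<comment> \<open>\<open>C + 1\<close> keeps the denominator positive when \<open>C\<close> is
      0.\<close>
    let ?d = "min (r / 2) (e / (C + 1))"
    show "\<exists>d>0. \<forall>y. norm (y - 0) < d \<longrightarrow> norm (F y - F 0 - (a 1 0 * Re (y - 0) + a 0 1 * Im (y - 0))) \<le> e * norm (y - 0)"
    proof (intro exI[of _ ?d] conjI allI impI)
      show "?d > 0" using r e C(1) by simp
      fix y :: complex assume y: "norm (y - 0) < ?d"
      have "norm (F y - F 0 - (a 1 0 * Re (y - 0) + a 0 1 * Im (y - 0))) \<le> C * norm y ^ 2"
        using split[of y] F0 C(2)[of y] y by simp
      also have "\<dots> \<le> (C + 1) * norm y * norm y"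
        by (simp add: power2_eq_square algebra_simps)
      also have "\<dots> \<le> e * norm y"
        using y C(1) by (intro mult_right_mono) (auto simp: field_simps)
      finally show "norm (F y - F 0 - (a 1 0 * Re (y - 0) + a 0 1 * Im (y - 0))) \<le> e * norm (y - 0)" by simp
    qed
  qed
qed

lemma real_analytic_at_isCont:
  fixes F :: "complex \<Rightarrow> real"
  assumes "real_analytic_at F c"
  shows "isCont F c"
proof -
  obtain a r where "ps_rep a r (\<lambda>z. F (c + z))"
    using assms real_analytic_at_translate real_analytic_at_imp_ps_rep by blast
  then have "isCont (\<lambda>z. F (c + z)) 0"
    using ps_rep_has_derivative has_derivative_continuous by blast
  then show ?thesis by (simp add: isCont_def LIM_offset_zero_iff)
qed

text \<open>In \<open>real l1ps l1ps\<close> the inner variable is \<open>x\<close> and the outer variable is \<open>y\<close>.\<close>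

definition l1_eval2 :: "real \<Rightarrow> real \<Rightarrow> real l1ps l1ps \<Rightarrow> real" where
  "l1_eval2 x y w = l1_eval x (l1_eval y w)"

definition l1_X2 :: "real l1ps l1ps" where "l1_X2 = l1_const l1_X"
definition l1_Y2 :: "real l1ps l1ps" where "l1_Y2 = l1_X"

lemma norm_l1_X2_Y2 [simp]: "norm l1_X2 = 1" "norm l1_Y2 = 1"
  by (simp_all add: l1_X2_def l1_Y2_def)

context
  fixes x y :: real
  assumes xy: "\<bar>x\<bar> \<le> 1" "\<bar>y\<bar> \<le> 1"
begin

lemma bounded_linear_l1_eval2: "bounded_linear (l1_eval2 x y)"
  unfolding l1_eval2_def using xy
  by (intro bounded_linear_compose[OF bounded_linear_l1_eval bounded_linear_l1_eval])

lemma norm_l1_eval2_le: "\<bar>l1_eval2 x y w\<bar> \<le> norm w"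
  unfolding l1_eval2_def
  using norm_l1_eval_le[OF xy(1), of "l1_eval y w"] norm_l1_eval_le[OF xy(2), of w] by simp

lemma l1_eval2_simps:
  "l1_eval2 x y (u + w) = l1_eval2 x y u + l1_eval2 x y w"
  "l1_eval2 x y (u - w) = l1_eval2 x y u - l1_eval2 x y w"
  "l1_eval2 x y (c *\<^sub>R w) = c * l1_eval2 x y w"
  "l1_eval2 x y (u * w) = l1_eval2 x y u * l1_eval2 x y w"
  "l1_eval2 x y 1 = 1" "l1_eval2 x y l1_X2 = x" "l1_eval2 x y l1_Y2 = y"
proof -
  interpret bounded_linear "l1_eval2 x y" by (rule bounded_linear_l1_eval2)
  show "l1_eval2 x y (u + w) = l1_eval2 x y u + l1_eval2 x y w"
    "l1_eval2 x y (u - w) = l1_eval2 x y u - l1_eval2 x y w"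
    "l1_eval2 x y (c *\<^sub>R w) = c * l1_eval2 x y w"
    by (simp_all add: add diff scale)
  show "l1_eval2 x y (u * w) = l1_eval2 x y u * l1_eval2 x y w" "l1_eval2 x y 1 = 1"
    using xy by (simp_all add: l1_eval2_def l1_eval_mult)
  show "l1_eval2 x y l1_X2 = x" by (simp add: l1_eval2_def l1_X2_def)
  interpret x: bounded_linear "l1_eval x :: real l1ps \<Rightarrow> real" by (rule bounded_linear_l1_eval[OF xy(1)])
  show "l1_eval2 x y l1_Y2 = y"
    by (simp add: l1_eval2_def l1_Y2_def of_real_def x.scale)
qed

lemma l1_eval2_pser:
  "pser_conv a r \<Longrightarrow> norm u \<le> r \<Longrightarrow> norm w \<le> r \<Longrightarrow>
    l1_eval2 x y (pser a u w) = pser a (l1_eval2 x y u) (l1_eval2 x y w)"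
  by (rule pser_hom[OF bounded_linear_l1_eval2 l1_eval2_simps(4,5)])

end

text \<open>Tonelli for the double array of coefficients: the inner sums of absolute values are the
  norms of the outer coefficients, and these are summable.\<close>

lemma l1_nth2_summable:
  fixes w :: "real l1ps l1ps"
  shows "(\<lambda>x. norm (case x of (j, i) \<Rightarrow> l1_nth (l1_nth w j) i)) summable_on UNIV \<times> UNIV"
  unfolding Infinite_Sum.abs_summable_on_Sigma_iff
proof (intro conjI ballI)
  show "(\<lambda>i. norm (case (j, i) of (j, i) \<Rightarrow> l1_nth (l1_nth w j) i)) summable_on UNIV" for j
    using norm_summable_imp_summable_on[of "\<lambda>i. norm (l1_nth (l1_nth w j) i)"] summable_l1_nth[of "l1_nth w j"]
    by simp
  have "(\<Sum>\<^sub>\<infinity>i. norm (case (j, i) of (j, i) \<Rightarrow> l1_nth (l1_nth w j) i)) = norm (l1_nth w j)" for j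
    unfolding norm_l1_def
    using norm_summable_imp_has_sum[of "\<lambda>i. norm (l1_nth (l1_nth w j) i)"] summable_l1_nth[of "l1_nth w j"]
    by (intro infsumI) (simp add: summable_sums)
  then show "(\<lambda>j. norm (\<Sum>\<^sub>\<infinity>i. norm (case (j, i) of (j, i) \<Rightarrow> l1_nth (l1_nth w j) i))) summable_on UNIV"
    using norm_summable_imp_summable_on[of "\<lambda>j. norm (l1_nth w j)"] summable_l1_nth[of w] by simp
qed

text \<open>Evaluation is defined by nested sums, while analyticity asks for one unordered double
  sum; absolute summability identifies the two. The outer index belongs to \<open>y\<close>, hence
  the final swap.\<close>

lemma l1_eval2_has_sum:
  assumes xy: "\<bar>x\<bar> \<le> 1" "\<bar>y\<bar> \<le> 1"
  shows "((\<lambda>(i, j). x ^ i * y ^ j * l1_nth (l1_nth w j) i) has_sum l1_eval2 x y w) UNIV"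
proof -
  interpret x: bounded_linear "l1_eval x :: real l1ps \<Rightarrow> real" by (rule bounded_linear_l1_eval[OF xy(1)])
  let ?t = "\<lambda>j i. x ^ i * y ^ j * l1_nth (l1_nth w j) i"
  have "((\<lambda>(j, i). ?t j i) has_sum l1_eval2 x y w) (UNIV \<times> UNIV)"
  proof (rule has_sum_SigmaI)
    fix j
    have "((\<lambda>i. x ^ i *\<^sub>R l1_nth (y ^ j *\<^sub>R l1_nth w j) i) has_sum l1_eval x (y ^ j *\<^sub>R l1_nth w j)) UNIV"
      by (rule norm_summable_imp_has_sum[OF summable_l1_eval[OF xy(1)] l1_eval_sums[OF xy(1)]])
    then show "((\<lambda>i. case (j, i) of (j, i) \<Rightarrow> ?t j i) has_sum l1_eval x (y ^ j *\<^sub>R l1_nth w j)) UNIV"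
      by (simp add: mult_ac)
  next
    have "((\<lambda>j. y ^ j *\<^sub>R l1_nth w j) has_sum l1_eval y w) UNIV"
      by (rule norm_summable_imp_has_sum[OF summable_l1_eval[OF xy(2)] l1_eval_sums[OF xy(2)]])
    from has_sum_bounded_linear[OF x.bounded_linear_axioms this]
    show "((\<lambda>j. l1_eval x (y ^ j *\<^sub>R l1_nth w j)) has_sum l1_eval2 x y w) UNIV"
      by (simp add: l1_eval2_def)
  next
    show "(\<lambda>(j, i). ?t j i) summable_on UNIV \<times> UNIV"
    proof (rule abs_summable_summable, rule Infinite_Sum.abs_summable_on_comparison_test[OF l1_nth2_summable[of w]])
      fix q :: "nat \<times> nat"
      obtain j i where q: "q = (j, i)" by fastforce
      have "\<bar>x\<bar> ^ i * \<bar>y\<bar> ^ j \<le> 1" using xy by (simp add: mult_le_one power_le_one)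
      then show "norm (case q of (j, i) \<Rightarrow> ?t j i) \<le> norm (case q of (j, i) \<Rightarrow> l1_nth (l1_nth w j) i)"
        by (simp add: q abs_mult power_abs mult_left_le_one_le)
    qed
  qed
  then show ?thesis
    by (subst (asm) has_sum_swap) simp
qed

text \<open>Rescaling the unit square of evaluation points divides each coefficient by
  \<open>\<rho> ^ (i + j)\<close>. Composites and inverses are shown to be analytic by exhibiting an
  element \<open>w\<close> that represents them.\<close>

lemma real_analytic_at_l1_eval2:
  assumes "\<rho> > 0"
  shows "real_analytic_at (\<lambda>z. l1_eval2 (Re z / \<rho>) (Im z / \<rho>) w) 0"
  unfolding real_analytic_at_def
proof (intro exI conjI ballI)
  fix z :: complex assume "z \<in> ball 0 \<rho>"
  then have "\<bar>Re z / \<rho>\<bar> \<le> 1" "\<bar>Im z / \<rho>\<bar> \<le> 1"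
    using abs_Re_le_cmod[of z] abs_Im_le_cmod[of z] assms by auto
  from l1_eval2_has_sum[OF this, of w]
  show "((\<lambda>(i, j). (Re (z - 0) ^ i * Im (z - 0) ^ j) *\<^sub>R (l1_nth (l1_nth w j) i / \<rho> ^ (i + j))) has_sum
      l1_eval2 (Re z / \<rho>) (Im z / \<rho>) w) UNIV"
    by (simp add: power_divide power_add case_prod_unfold)
qed fact

section \<open>Composition and the inverse function theorem\<close>

lemma eventually_nhds_0I:
  fixes P :: "complex \<Rightarrow> bool"
  assumes "d > 0" "\<And>z. norm z < d \<Longrightarrow> P z"
  shows "\<forall>\<^sub>F z in nhds 0. P z"
  unfolding eventually_nhds_metric using assms by (intro exI[of _ d]) (auto simp: dist_norm)

lemma ps_rep_zero: "ps_rep a r F \<Longrightarrow> F 0 = a 0 0"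
  using ps_repD[of a r F] by (simp add: pser_zero)

text \<open>The Lipschitz bound with \<open>N = 1\<close>, taken against the value 0 at the
  origin.\<close>

lemma pser_norm_le:
  fixes u v :: "'a::comm_banach_algebra_1"
  assumes "pser_conv a r" "a 0 0 = 0" "norm u \<le> s" "norm v \<le> s" "0 < s" "s \<le> r / 2"
  shows "norm (pser a u v) \<le> pser_norm a r * (2 / r) * (2 * s)"
proof -
  have "norm (pser a u v - pser a 0 0) \<le> pser_norm a r * (2 / r) ^ 1 * s ^ (1 - 1) * (norm (u - 0) + norm (v - 0))"
    using assms by (intro pser_lipschitz) auto
  also have "\<dots> \<le> pser_norm a r * (2 / r) * (2 * s)"
    using assms(3,4) pser_norm_nonneg[of r a] pser_convD[OF assms(1)]
    unfolding power_one_right diff_self_eq_0 power_0 mult_1_right diff_0_right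
    by (intro mult_left_mono) auto
  finally show ?thesis using assms by (simp add: pser_zero)
qed

text \<open>The coordinates become the small elements \<open>\<rho> *\<^sub>R l1_X2\<close> and
  \<open>\<rho> *\<^sub>R l1_Y2\<close>. The series of \<open>p\<close> and \<open>q\<close> are
  evaluated there and the series of \<open>F\<close> at the results; evaluation at points identifies
  the element so obtained with the composite.\<close>

lemma real_analytic_at_compose_0:
  assumes F: "real_analytic_at F 0" and p: "real_analytic_at p 0" and q: "real_analytic_at q 0"
    and 0: "p 0 = 0" "q 0 = 0"
  shows "real_analytic_at (\<lambda>z. F (Complex (p z) (q z)) :: real) 0"
proof -
  obtain a r where F: "ps_rep a r F" using real_analytic_at_imp_ps_rep[OF F] .
  obtain b1 r1 where p: "ps_rep b1 r1 p" using real_analytic_at_imp_ps_rep[OF p] .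
  obtain b2 r2 where q: "ps_rep b2 r2 q" using real_analytic_at_imp_ps_rep[OF q] .
  note r = ps_repD(2)[OF F] and r1 = ps_repD(2)[OF p] and r2 = ps_repD(2)[OF q]
  \<comment> \<open>A common linear growth constant for \<open>p\<close> and \<open>q\<close>; the
    summand 1 makes it positive.\<close>
  define C where "C = pser_norm b1 r1 * (2 / r1) + pser_norm b2 r2 * (2 / r2) + 1"
  have C: "C > 0" "pser_norm b1 r1 * (2 / r1) \<le> C" "pser_norm b2 r2 * (2 / r2) \<le> C"
    using pser_norm_nonneg[of r1 b1] pser_norm_nonneg[of r2 b2] r1 r2 by (auto simp: C_def add_nonneg_pos)
  \<comment> \<open>The half radii are what \<open>pser_norm_le\<close> requires of \<open>p\<close>
    and \<open>q\<close>; the last bound brings the norms of \<open>u\<close> and \<open>v\<close>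
    down to at most the radius \<open>r\<close> of \<open>F\<close>.\<close>
  define \<rho> where "\<rho> = min (min (r1 / 2) (r2 / 2)) (r / (2 * C))"
  have \<rho>: "\<rho> > 0" "\<rho> \<le> r1 / 2" "\<rho> \<le> r2 / 2" "\<rho> \<le> r / (2 * C)"
    using r r1 r2 C by (auto simp: \<rho>_def)
  have "C * (2 * \<rho>) \<le> r" using \<rho>(4) C(1) by (simp add: field_simps)
  then have *: "M * (2 * \<rho>) \<le> r" if "M \<le> C" for M
    using mult_right_mono[OF that, of "2 * \<rho>"] \<rho>(1) by linarith
  let ?x = "\<rho> *\<^sub>R l1_X2" and ?y = "\<rho> *\<^sub>R l1_Y2"
  have n: "norm ?x \<le> \<rho>" "norm ?y \<le> \<rho>" using \<rho>(1) by auto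
  define u v where "u = pser b1 ?x ?y" and "v = pser b2 ?x ?y"
  have "norm u \<le> r" unfolding u_def
    using pser_norm_le[OF ps_repD(1)[OF p] _ n \<rho>(1,2)] ps_rep_zero[OF p] 0 *[OF C(2)] by simp
  have "norm v \<le> r" unfolding v_def
    using pser_norm_le[OF ps_repD(1)[OF q] _ n \<rho>(1,3)] ps_rep_zero[OF q] 0 *[OF C(3)] by simp
  show ?thesis
  proof (rule real_analytic_at_cong[OF real_analytic_at_l1_eval2[OF \<rho>(1), of "pser a u v"]],
      rule eventually_nhds_0I[OF \<rho>(1)])
    fix z :: complex assume "norm z < \<rho>"
    then have z: "\<bar>Re z\<bar> \<le> \<rho>" "\<bar>Im z\<bar> \<le> \<rho>"
      using abs_Re_le_cmod[of z] abs_Im_le_cmod[of z] by auto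
    define x y where "x = Re z / \<rho>" and "y = Im z / \<rho>"
    have xy: "\<bar>x\<bar> \<le> 1" "\<bar>y\<bar> \<le> 1" using z \<rho>(1) by (auto simp: x_def y_def)
    have re: "\<rho> * x = Re z" "\<rho> * y = Im z" using \<rho>(1) by (auto simp: x_def y_def)
    have "l1_eval2 x y u = p z" "l1_eval2 x y v = q z"
      unfolding u_def v_def
      using l1_eval2_pser[OF xy ps_repD(1)[OF p], of ?x ?y] l1_eval2_pser[OF xy ps_repD(1)[OF q], of ?x ?y]
        n \<rho> z ps_repD(3)[OF p, of z] ps_repD(3)[OF q, of z]
      by (auto simp: l1_eval2_simps[OF xy] re)
    moreover have "\<bar>l1_eval2 x y u\<bar> \<le> r" "\<bar>l1_eval2 x y v\<bar> \<le> r"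
      using norm_l1_eval2_le[OF xy, of u] norm_l1_eval2_le[OF xy, of v] \<open>norm u \<le> r\<close> \<open>norm v \<le> r\<close> by linarith+
    ultimately show "l1_eval2 (Re z / \<rho>) (Im z / \<rho>) (pser a u v) = F (Complex (p z) (q z))"
      using l1_eval2_pser[OF xy ps_repD(1)[OF F] \<open>norm u \<le> r\<close> \<open>norm v \<le> r\<close>] ps_repD(3)[OF F, of "Complex (p z) (q z)"]
      by (simp flip: x_def y_def)
  qed
qed

section \<open>Arithmetic of analytic germs\<close>

lemma real_analytic_at_polynomial_0:
  "real_analytic_at (\<lambda>z. c00 + c10 * Re z + c01 * Im z + c11 * (Re z * Im z) :: real) 0"
proof -
  define a :: "nat \<Rightarrow> nat \<Rightarrow> real" where
    "a i j = (if (i, j) = (0, 0) then c00 else if (i, j) = (1, 0) then c10 else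
      if (i, j) = (0, 1) then c01 else if (i, j) = (1, 1) then c11 else 0)" for i j
  show ?thesis unfolding real_analytic_at_def
  proof (intro exI conjI ballI)
    fix z :: complex
    show "((\<lambda>(i, j). (Re (z - 0) ^ i * Im (z - 0) ^ j) *\<^sub>R a i j) has_sum
        c00 + c10 * Re z + c01 * Im z + c11 * (Re z * Im z)) UNIV"
      by (rule has_sum_finite_neutralI[of "{(0, 0), (1, 0), (0, 1), (1, 1)}"]) (auto simp: a_def split: if_splits)
  qed (rule zero_less_one)
qed

lemma real_analytic_at_affine: "real_analytic_at (\<lambda>z. c00 + c10 * Re z + c01 * Im z :: real) c"
proof -
  have "real_analytic_at (\<lambda>z. (c00 + c10 * Re c + c01 * Im c) + c10 * Re z + c01 * Im z + 0 * (Re z * Im z)) 0"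
    by (rule real_analytic_at_polynomial_0)
  then show ?thesis unfolding real_analytic_at_translate[of _ c] by (simp add: algebra_simps)
qed

lemma real_analytic_at_Re_Im_prod: "real_analytic_at (\<lambda>z. Re z * Im z :: real) c"
proof -
  have "real_analytic_at (\<lambda>z. Re c * Im c + Im c * Re z + Re c * Im z + 1 * (Re z * Im z)) 0"
    by (rule real_analytic_at_polynomial_0)
  then show ?thesis unfolding real_analytic_at_translate[of _ c] by (simp add: algebra_simps)
qed

lemma real_analytic_at_Re_Im_proj: "real_analytic_at Re c" "real_analytic_at Im c"
  using real_analytic_at_affine[of 0 1 0 c] real_analytic_at_affine[of 0 0 1 c] by simp_all

lemma real_analytic_at_const: "real_analytic_at (\<lambda>z. c0 :: real) c"
  using real_analytic_at_affine[of c0 0 0 c] by simp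

lemma real_analytic_at_shift_compose_0:
  assumes F: "real_analytic_at F 0" and p: "real_analytic_at p 0" and q: "real_analytic_at q 0"
    and "p 0 = a" "q 0 = b"
  shows "real_analytic_at (\<lambda>z. F (Complex (p z - a) (q z - b)) :: real) 0"
proof -
  \<comment> \<open>Done by hand on the constant coefficient: closure under subtraction is itself
    going to be derived from composition.\<close>
  have shift: "real_analytic_at (\<lambda>z. p z - p 0) 0" if p: "real_analytic_at p 0" for p :: "complex \<Rightarrow> real"
  proof -
    obtain \<alpha> r where r: "r > 0" and *: "\<And>z. z \<in> ball 0 r \<Longrightarrow>
        ((\<lambda>(i, j). (Re (z - 0) ^ i * Im (z - 0) ^ j) *\<^sub>R \<alpha> i j) has_sum p z) UNIV"
      by (rule real_analytic_atE[OF p]) (rule that)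
    show ?thesis unfolding real_analytic_at_def
    proof (intro exI conjI ballI)
      fix z :: complex assume z: "z \<in> ball 0 r"
      have "((\<lambda>x. if x = (0, 0) then - p 0 else 0) has_sum - p 0) (UNIV :: (nat \<times> nat) set)"
        by (rule has_sum_finite_neutralI[of "{(0, 0)}"]) auto
      from has_sum_add[OF *[OF z] this]
      have "((\<lambda>x. (case x of (i, j) \<Rightarrow> (Re (z - 0) ^ i * Im (z - 0) ^ j) *\<^sub>R \<alpha> i j) +
          (if x = (0, 0) then - p 0 else 0)) has_sum (p z - p 0)) UNIV"
        by simp
      also have "(\<lambda>x. (case x of (i, j) \<Rightarrow> (Re (z - 0) ^ i * Im (z - 0) ^ j) *\<^sub>R \<alpha> i j) +
          (if x = (0, 0) then - p 0 else 0)) = (\<lambda>(i, j). (Re (z - 0) ^ i * Im (z - 0) ^ j) *\<^sub>R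
          (\<alpha> i j + (if (i, j) = (0, 0) then - p 0 else 0)))"
        by (auto simp: fun_eq_iff)
      finally show "((\<lambda>(i, j). (Re (z - 0) ^ i * Im (z - 0) ^ j) *\<^sub>R
          (\<alpha> i j + (if (i, j) = (0, 0) then - p 0 else 0))) has_sum (p z - p 0)) UNIV" .
    qed fact
  qed
  show ?thesis
    using real_analytic_at_compose_0[OF F shift[OF p] shift[OF q]] assms(4,5) by simp
qed

lemma real_analytic_at_compose:
  assumes F: "real_analytic_at F (Complex (p c) (q c))" and p: "real_analytic_at p c" and q: "real_analytic_at q c"
  shows "real_analytic_at (\<lambda>z. F (Complex (p z) (q z)) :: real) c"
proof -
  have "real_analytic_at (\<lambda>z. F (Complex (p c) (q c) + Complex (p (c + z) - p c) (q (c + z) - q c))) 0"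
    by (rule real_analytic_at_shift_compose_0[where F = "\<lambda>w. F (Complex (p c) (q c) + w)"])
      (use F p q in \<open>simp_all flip: real_analytic_at_translate\<close>)
  then show ?thesis
    unfolding real_analytic_at_translate[of _ c] by (simp add: complex_add)
qed

text \<open>Sums and products are composites of the outer functions \<open>Re z + Im z\<close> and
  \<open>Re z * Im z\<close> with the pair \<open>p\<close>, \<open>q\<close>.\<close>

lemma real_analytic_at_add:
  "real_analytic_at p c \<Longrightarrow> real_analytic_at q c \<Longrightarrow> real_analytic_at (\<lambda>z. p z + q z :: real) c"
  using real_analytic_at_compose[of "\<lambda>z. 0 + 1 * Re z + 1 * Im z", OF real_analytic_at_affine] by simp

lemma real_analytic_at_mult:
  "real_analytic_at p c \<Longrightarrow> real_analytic_at q c \<Longrightarrow> real_analytic_at (\<lambda>z. p z * q z :: real) c"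
  using real_analytic_at_compose[of "\<lambda>z. Re z * Im z", OF real_analytic_at_Re_Im_prod] by simp

lemma real_analytic_at_minus:
  "real_analytic_at p c \<Longrightarrow> real_analytic_at (\<lambda>z. - p z :: real) c"
  using real_analytic_at_mult[OF real_analytic_at_const[of "-1"]] by simp

lemma real_analytic_at_diff:
  "real_analytic_at p c \<Longrightarrow> real_analytic_at q c \<Longrightarrow> real_analytic_at (\<lambda>z. p z - q z :: real) c"
  using real_analytic_at_add[OF _ real_analytic_at_minus] by fastforce

lemma real_analytic_at_sum:
  assumes "\<And>i. i \<in> A \<Longrightarrow> real_analytic_at (p i) c"
  shows "real_analytic_at (\<lambda>z. \<Sum>i\<in>A. p i z :: real) c"
  using assms
  by (induction A rule: infinite_finite_induct) (auto intro: real_analytic_at_const real_analytic_at_add)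

text \<open>Geometric series for the reciprocal of \<open>k + Re z\<close> in powers of
  \<open>Re z\<close>, composed with \<open>p\<close> minus its value \<open>k\<close>; the second
  inner function is a dummy 0.\<close>

lemma real_analytic_at_inverse:
  assumes p: "real_analytic_at p c" and "p c \<noteq> 0"
  shows "real_analytic_at (\<lambda>z. inverse (p z) :: real) c"
proof -
  define k where "k = p c"
  have k: "k \<noteq> 0" using assms by (simp add: k_def)
  define a :: "nat \<Rightarrow> nat \<Rightarrow> real" where "a i j = (if j = 0 then (- 1) ^ i / k ^ Suc i else 0)" for i j
  have "real_analytic_at (\<lambda>z. inverse (k + Re z)) 0"
    unfolding real_analytic_at_def
  proof (intro exI conjI ballI)
    show "\<bar>k\<bar> > 0" using k by simp
    fix z :: complex assume "z \<in> ball 0 \<bar>k\<bar>"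
    then have "\<bar>Re z\<bar> < \<bar>k\<bar>" using abs_Re_le_cmod[of z] by auto
    then have *: "norm (- Re z / k) < 1" using k by simp
    have "((\<lambda>i. (- Re z / k) ^ i) has_sum (1 / (1 - (- Re z / k)))) UNIV"
    proof (rule norm_summable_imp_has_sum)
      show "summable (\<lambda>i. norm ((- Re z / k) ^ i))"
        unfolding norm_power by (rule summable_geometric) (use * in simp)
    qed (rule geometric_sums[OF *])
    from has_sum_cmult_right[OF this, of "1 / k"]
    have "((\<lambda>i. 1 / k * (- Re z / k) ^ i) has_sum inverse (k + Re z)) UNIV"
      using k \<open>\<bar>Re z\<bar> < \<bar>k\<bar>\<close> by (simp add: divide_simps)
    also have "?this \<longleftrightarrow> ((\<lambda>x. 1 / k * (- Re z / k) ^ fst x) has_sum inverse (k + Re z)) (UNIV \<times> {0 :: nat})"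
      by (rule has_sum_reindex_bij_witness[where i = fst and j = "\<lambda>i. (i, 0)"]) auto
    also have "\<dots> \<longleftrightarrow> ((\<lambda>(i, j). (Re (z - 0) ^ i * Im (z - 0) ^ j) *\<^sub>R a i j) has_sum inverse (k + Re z)) UNIV"
    proof (rule has_sum_cong_neutral)
      fix x :: "nat \<times> nat" assume "x \<in> UNIV \<times> {0} \<inter> UNIV"
      then show "1 / k * (- Re z / k) ^ fst x = (case x of (i, j) \<Rightarrow> (Re (z - 0) ^ i * Im (z - 0) ^ j) *\<^sub>R a i j)"
        by (auto simp: a_def power_divide power_minus[of "Re z / k"])
    qed (auto simp: a_def split: if_splits)
    finally show "((\<lambda>(i, j). (Re (z - 0) ^ i * Im (z - 0) ^ j) *\<^sub>R a i j) has_sum inverse (k + Re z)) UNIV" .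
  qed
  from real_analytic_at_shift_compose_0[OF this, of "\<lambda>z. p (c + z)" "\<lambda>z. 0" k 0]
  have "real_analytic_at (\<lambda>z. inverse (p (c + z))) 0"
    using p by (simp add: k_def real_analytic_at_const flip: real_analytic_at_translate)
  then show ?thesis unfolding real_analytic_at_translate[of _ c] .
qed

lemma real_analytic_at_comp_complex:
  fixes F G :: "complex \<Rightarrow> complex"
  assumes F: "real_analytic_at F (G c)" and G: "real_analytic_at G c"
  shows "real_analytic_at (\<lambda>z. F (G z)) c"
proof -
  have G: "real_analytic_at (\<lambda>z. Re (G z)) c" "real_analytic_at (\<lambda>z. Im (G z)) c"
    using G by (auto simp: real_analytic_at_Re_Im[of G])
  have F: "real_analytic_at (\<lambda>z. Re (F z)) (Complex (Re (G c)) (Im (G c)))"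
    "real_analytic_at (\<lambda>z. Im (F z)) (Complex (Re (G c)) (Im (G c)))"
    using F by (auto simp: real_analytic_at_Re_Im[of F])
  show ?thesis
    using real_analytic_at_compose[OF F(1) G] real_analytic_at_compose[OF F(2) G]
    by (subst real_analytic_at_Re_Im) simp
qed

text \<open>\<open>H\<close> is the identity plus a part (b1, b2) of order two, so its inverse has
  components with u + b1(u, v) = x and v + b2(u, v) = y. The system is solved by a contraction
  inside the algebra, where a solution is automatically a convergent power series.\<close>

theorem real_analytic_inverse_function:
  fixes H :: "complex \<Rightarrow> complex"
  assumes H: "real_analytic_at H 0" "H 0 = 0" "(H has_derivative id) (at 0)"
  obtains \<phi> where "real_analytic_at \<phi> 0" "\<phi> 0 = 0"
    "\<forall>\<^sub>F z in nhds 0. H (\<phi> z) = z" "\<forall>\<^sub>F z in nhds 0. \<phi> (H z) = z"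
proof -
  have ra: "real_analytic_at (\<lambda>z. Re (H z) - Re z) 0" "real_analytic_at (\<lambda>z. Im (H z) - Im z) 0"
    using H(1) by (auto simp: real_analytic_at_Re_Im[of H] intro: real_analytic_at_diff real_analytic_at_Re_Im_proj)
  obtain b1 r1 b2 r2 where b: "ps_rep b1 r1 (\<lambda>z. Re (H z) - Re z)" "ps_rep b2 r2 (\<lambda>z. Im (H z) - Im z)"
    using real_analytic_at_imp_ps_rep[OF ra(1)] real_analytic_at_imp_ps_rep[OF ra(2)] by metis
  define r where "r = min r1 r2"
  have b1: "ps_rep b1 r (\<lambda>z. Re (H z) - Re z)" and b2: "ps_rep b2 r (\<lambda>z. Im (H z) - Im z)"
    using b ps_repD(2)[OF b(1)] ps_repD(2)[OF b(2)] by (auto simp: r_def intro: ps_rep_mono)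
  note r = ps_repD(2)[OF b1]
  have coeff: "b i j = 0" if b: "ps_rep b r G" and d: "(G has_derivative (\<lambda>_. 0)) (at 0)" and "G 0 = 0" "i + j < 2"
    for b G i j
  proof -
    have "(\<lambda>h. b 1 0 * Re h + b 0 1 * Im h) = (\<lambda>_. 0)"
      by (rule has_derivative_unique[OF ps_rep_has_derivative[OF b] d])
    from fun_cong[OF this, of 1] fun_cong[OF this, of \<i>] ps_rep_zero[OF b] that(3,4)
    show ?thesis by (auto simp: numeral_2_eq_2 less_Suc_eq add_is_1)
  qed
  have d: "((\<lambda>z. Re (H z) - Re z) has_derivative (\<lambda>_. 0)) (at 0)" "((\<lambda>z. Im (H z) - Im z) has_derivative (\<lambda>_. 0)) (at 0)"
    using has_derivative_diff[OF has_derivative_compose[OF H(3) bounded_linear_imp_has_derivative[OF bounded_linear_Re]]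
        bounded_linear_imp_has_derivative[OF bounded_linear_Re]]
      has_derivative_diff[OF has_derivative_compose[OF H(3) bounded_linear_imp_has_derivative[OF bounded_linear_Im]]
        bounded_linear_imp_has_derivative[OF bounded_linear_Im]]
    by simp_all
  have z1: "b1 i j = 0" if "i + j < 2" for i j by (rule coeff[OF b1 d(1)]) (use H(2) that in auto)
  have z2: "b2 i j = 0" if "i + j < 2" for i j by (rule coeff[OF b2 d(2)]) (use H(2) that in auto)
  define L where "L = max (pser_norm b1 r) (pser_norm b2 r) * (2 / r) ^ 2"
  have L: "L \<ge> 0" "pser_norm b1 r * (2 / r) ^ 2 \<le> L" "pser_norm b2 r * (2 / r) ^ 2 \<le> L"
    using r pser_norm_nonneg[of r b1] by (auto simp: L_def le_max_iff_disj intro!: mult_right_mono)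
  \<comment> \<open>Chosen so that \<open>L * s \<le> 1 / 8\<close>: each component of the nonlinear
    part then moves by at most a quarter of the distance, and the two together give the contraction
    factor 1/2.\<close>
  define s where "s = min (r / 2) (1 / (8 * (L + 1)))"
  have s: "s > 0" "s \<le> r / 2" using r L by (auto simp: s_def)
  have "s \<le> 1 / (8 * (L + 1))" by (simp add: s_def)
  then have Ls: "L * s \<le> 1 / 8" using L(1) s(1) by (simp add: field_simps)
  \<comment> \<open>Polymorphic in the algebra: over the reals it yields injectivity of
    \<open>H\<close>, over \<open>real l1ps l1ps\<close> the contraction.\<close>
  have lip: "norm (pser b1 u v - pser b1 u' v') \<le> 1 / 8 * (norm (u - u') + norm (v - v'))"
    "norm (pser b2 u v - pser b2 u' v') \<le> 1 / 8 * (norm (u - u') + norm (v - v'))"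
    if "norm u \<le> s" "norm v \<le> s" "norm u' \<le> s" "norm v' \<le> s" for u v u' v' :: "'c::comm_banach_algebra_1"
  proof -
    have *: "M * (2 / r) ^ 2 * s ^ (2 - 1) * (norm (u - u') + norm (v - v')) \<le> 1 / 8 * (norm (u - u') + norm (v - v'))"
      if "M * (2 / r) ^ 2 \<le> L" for M
    proof (rule mult_right_mono)
      have "M * (2 / r) ^ 2 * s \<le> L * s" using that s(1) by (intro mult_right_mono) auto
      then show "M * (2 / r) ^ 2 * s ^ (2 - 1) \<le> 1 / 8" using Ls by simp
    qed auto
    show "norm (pser b1 u v - pser b1 u' v') \<le> 1 / 8 * (norm (u - u') + norm (v - v'))"
      using pser_lipschitz[OF ps_repD(1)[OF b1] z1 _ that s, of 2] *[OF L(2)] by linarith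
    show "norm (pser b2 u v - pser b2 u' v') \<le> 1 / 8 * (norm (u - u') + norm (v - v'))"
      using pser_lipschitz[OF ps_repD(1)[OF b2] z2 _ that s, of 2] *[OF L(3)] by linarith
  qed
  have H_eq: "H z = Complex (Re z + pser b1 (Re z) (Im z)) (Im z + pser b2 (Re z) (Im z))"
    if "\<bar>Re z\<bar> \<le> s" "\<bar>Im z\<bar> \<le> s" for z
    using ps_repD(3)[OF b1, of z] ps_repD(3)[OF b2, of z] that s by (simp add: complex_eq_iff)
  have inj: "z = w" if "\<bar>Re z\<bar> \<le> s" "\<bar>Im z\<bar> \<le> s" "\<bar>Re w\<bar> \<le> s" "\<bar>Im w\<bar> \<le> s" "H z = H w" for z w
  proof -
    have aux: "X \<le> 0" if "X \<le> 1 / 8 * (X + Y)" "Y \<le> 1 / 8 * (X + Y)" for X Y :: real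
      using that by (simp add: field_simps)
    have "Re z - Re w = - (pser b1 (Re z) (Im z) - pser b1 (Re w) (Im w))"
      "Im z - Im w = - (pser b2 (Re z) (Im z) - pser b2 (Re w) (Im w))"
      using that H_eq[of z] H_eq[of w] by auto
    then have "\<bar>Re z - Re w\<bar> \<le> 1 / 8 * (\<bar>Re z - Re w\<bar> + \<bar>Im z - Im w\<bar>)"
      "\<bar>Im z - Im w\<bar> \<le> 1 / 8 * (\<bar>Re z - Re w\<bar> + \<bar>Im z - Im w\<bar>)"
      using lip[of "Re z" "Im z" "Re w" "Im w"] that unfolding real_norm_def by linarith+
    then have "\<bar>Re z - Re w\<bar> \<le> 0" "\<bar>Im z - Im w\<bar> \<le> 0"
      using aux[of "\<bar>Re z - Re w\<bar>" "\<bar>Im z - Im w\<bar>"] aux[of "\<bar>Im z - Im w\<bar>" "\<bar>Re z - Re w\<bar>"]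
      by (simp_all only: add.commute abs_ge_zero)
    then show ?thesis by (simp add: complex_eq_iff)
  qed
  \<comment> \<open>The linear part then has norm \<open>s / 2\<close> and the nonlinear part at
    most \<open>s / 4\<close>, so \<open>T\<close> maps the product of balls into itself.\<close>
  define \<rho> where "\<rho> = s / 2"
  have \<rho>: "\<rho> > 0" using s by (simp add: \<rho>_def)
  let ?x = "\<rho> *\<^sub>R l1_X2" and ?y = "\<rho> *\<^sub>R l1_Y2"
  \<comment> \<open>A fixed point (u, v) solves H(u, v) = (\<rho> x, \<rho> y) in the algebra;
    evaluating at (x, y) gives \<open>H (\<phi> z) = z\<close>.\<close>
  define T where "T w = (?x - pser b1 (fst w) (snd w), ?y - pser b2 (fst w) (snd w))" for w
  define S where "S = cball (0 :: real l1ps l1ps) s \<times> cball (0 :: real l1ps l1ps) s"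
  have "\<exists>!w\<in>S. T w = w"
  proof (rule Banach_fix)
    show "complete S" unfolding S_def complete_eq_closed by (intro closed_Times closed_cball)
    show "S \<noteq> {}" using s by (auto simp: S_def)
    show "T ` S \<subseteq> S"
    proof
      fix w' assume "w' \<in> T ` S"
      then obtain u v where w': "w' = T (u, v)" and uv: "norm u \<le> s" "norm v \<le> s" by (auto simp: S_def)
      have "pser b1 0 0 = (0 :: real l1ps l1ps)" "pser b2 0 0 = (0 :: real l1ps l1ps)" by (simp_all add: pser_zero z1 z2)
      with lip[OF uv, of 0 0] s(1) uv have "norm (pser b1 u v) \<le> s / 4" "norm (pser b2 u v) \<le> s / 4" by auto
      then show "w' \<in> S"
        using norm_triangle_ineq4[of ?x "pser b1 u v"] norm_triangle_ineq4[of ?y "pser b2 u v"] \<rho>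
        by (simp add: w' T_def S_def \<rho>_def)
    qed
    show "dist (T w) (T w') \<le> 1 / 2 * dist w w'" if "w \<in> S" "w' \<in> S" for w w'
    proof -
      obtain u v u' v' where w: "w = (u, v)" "w' = (u', v')" by fastforce
      have uv: "norm u \<le> s" "norm v \<le> s" "norm u' \<le> s" "norm v' \<le> s" using that by (auto simp: w S_def)
      have le: "norm (u - u') \<le> dist w w'" "norm (v - v') \<le> dist w w'"
        using dist_fst_le[of w w'] dist_snd_le[of w w'] by (auto simp: w dist_norm)
      have "dist (T w) (T w') \<le> norm (pser b1 u v - pser b1 u' v') + norm (pser b2 u v - pser b2 u' v')"
        unfolding T_def w dist_prod_def
        by (rule order_trans[OF sqrt_sum_squares_le_sum]) (auto simp: dist_norm norm_minus_commute)
      also have "\<dots> \<le> 1 / 2 * dist w w'" using lip[OF uv] le by (simp add: field_simps)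
      finally show ?thesis .
    qed
  qed auto
  then obtain w where "w \<in> S" "T w = w" by (elim ex1E conjE)
  then obtain u v where "(u, v) \<in> S" and T: "T (u, v) = (u, v)" by (cases w) blast
  then have uv: "norm u \<le> s" "norm v \<le> s" by (auto simp: S_def)
  define \<phi> where "\<phi> z = Complex (l1_eval2 (Re z / \<rho>) (Im z / \<rho>) u) (l1_eval2 (Re z / \<rho>) (Im z / \<rho>) v)" for z
  have \<phi>: "\<bar>Re (\<phi> z)\<bar> \<le> s" "\<bar>Im (\<phi> z)\<bar> \<le> s" "H (\<phi> z) = z" if z: "norm z \<le> \<rho>" for z
  proof -
    define x y where "x = Re z / \<rho>" and "y = Im z / \<rho>"
    have xy: "\<bar>x\<bar> \<le> 1" "\<bar>y\<bar> \<le> 1" using z \<rho> abs_Re_le_cmod[of z] abs_Im_le_cmod[of z] by (auto simp: x_def y_def)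
    have re: "\<rho> * x = Re z" "\<rho> * y = Im z" using \<rho> by (auto simp: x_def y_def)
    have \<phi>_eq: "\<phi> z = Complex (l1_eval2 x y u) (l1_eval2 x y v)" by (simp add: \<phi>_def x_def y_def)
    show le: "\<bar>Re (\<phi> z)\<bar> \<le> s" "\<bar>Im (\<phi> z)\<bar> \<le> s"
      unfolding \<phi>_eq using norm_l1_eval2_le[OF xy, of u] norm_l1_eval2_le[OF xy, of v] uv by auto
    have "?x - pser b1 u v = u" "?y - pser b2 u v = v" using T by (auto simp: T_def)
    then have "l1_eval2 x y (?x - pser b1 u v) = l1_eval2 x y u" "l1_eval2 x y (?y - pser b2 u v) = l1_eval2 x y v"
      by simp_all
    then have "Re z - pser b1 (l1_eval2 x y u) (l1_eval2 x y v) = l1_eval2 x y u"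
      "Im z - pser b2 (l1_eval2 x y u) (l1_eval2 x y v) = l1_eval2 x y v"
      using l1_eval2_pser[OF xy ps_repD(1)[OF b1], of u v] l1_eval2_pser[OF xy ps_repD(1)[OF b2], of u v] uv s
      unfolding l1_eval2_simps[OF xy] re by auto
    then show "H (\<phi> z) = z" unfolding H_eq[OF le] unfolding \<phi>_eq complex_eq_iff complex.sel by linarith
  qed
  show thesis
  proof
    show "real_analytic_at \<phi> 0"
      unfolding real_analytic_at_Re_Im[of \<phi>] \<phi>_def by (simp add: real_analytic_at_l1_eval2[OF \<rho>])
    show "\<phi> 0 = 0"
      \<comment> \<open>\<open>\<phi> 0\<close> and 0 have the same image under \<open>H\<close>.
        The same argument below turns the right inverse into a left inverse.\<close>
      by (rule inj) (use \<phi>[of 0] \<rho> s H(2) in auto)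
    show "\<forall>\<^sub>F z in nhds 0. H (\<phi> z) = z"
      by (rule eventually_nhds_0I[OF \<rho>]) (use \<phi> in auto)
    have "isCont H 0" using H(3) by (rule has_derivative_continuous)
    then have "(H \<longlongrightarrow> H 0) (nhds 0)"
      unfolding isCont_def tendsto_at_iff_tendsto_nhds .
    from tendstoD[OF this \<rho>] have "\<forall>\<^sub>F z in nhds 0. norm (H z) < \<rho>"
      by (simp add: H(2))
    moreover have "\<forall>\<^sub>F z in nhds 0. norm (z::complex) < s"
      by (rule eventually_nhds_0I[OF s(1)])
    ultimately show "\<forall>\<^sub>F z in nhds 0. \<phi> (H z) = z"
    proof eventually_elim
      case (elim z)
      show ?case
        by (rule inj) (use elim \<phi>[of "H z"] abs_Re_le_cmod[of z] abs_Im_le_cmod[of z] in auto)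
    qed
  qed
qed

section \<open>Partial derivatives and homogeneous parts\<close>

definition coeff_dx :: "(nat \<Rightarrow> nat \<Rightarrow> real) \<Rightarrow> nat \<Rightarrow> nat \<Rightarrow> real" where
  "coeff_dx a i j = real (Suc i) * a (Suc i) j"

definition coeff_dy :: "(nat \<Rightarrow> nat \<Rightarrow> real) \<Rightarrow> nat \<Rightarrow> nat \<Rightarrow> real" where
  "coeff_dy a i j = real (Suc j) * a i (Suc j)"

lemma pser_conv_swap: "pser_conv a r \<Longrightarrow> pser_conv (\<lambda>i j. a j i) r"
proof -
  assume a: "pser_conv a r"
  have "((\<lambda>(i, j). \<bar>a j i\<bar> * r ^ (i + j)) has_sum pser_norm a r) (UNIV \<times> UNIV)"
    using pser_norm_has_sum[OF a] by (subst has_sum_swap) (simp add: add.commute)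
  then show ?thesis using a by (auto simp: pser_conv_def intro: has_sum_imp_summable)
qed

lemma pser_swap:
  fixes u v :: "'a::comm_banach_algebra_1"
  assumes "pser_conv a r" "norm u \<le> r" "norm v \<le> r"
  shows "pser (\<lambda>i j. a j i) v u = pser a u v"
proof -
  have "((\<lambda>(i, j). a i j *\<^sub>R (u ^ i * v ^ j)) has_sum pser a u v) (UNIV \<times> UNIV)"
    using pser_has_sum[OF assms] by simp
  then have "((\<lambda>(i, j). a j i *\<^sub>R (v ^ i * u ^ j)) has_sum pser a u v) UNIV"
    by (subst (asm) has_sum_swap) (simp add: mult.commute)
  then show ?thesis unfolding pser_def[of "\<lambda>i j. a j i"] by (rule infsumI)
qed

text \<open>Halving the radius gains the factor 2^(i+j), which up to a constant absorbs
  \<open>Suc i\<close>.\<close>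

lemma pser_conv_dx:
  assumes "pser_conv a r"
  shows "pser_conv (coeff_dx a) (r / 2)"
proof -
  have r: "r > 0" using assms by (rule pser_convD)
  let ?f = "\<lambda>(i, j). \<bar>a i j\<bar> * r ^ (i + j)" and ?s = "\<lambda>(i, j). (Suc i, j :: nat)"
  have "?f summable_on range ?s"
    by (rule summable_on_subset_banach[of ?f UNIV]) (use assms in \<open>auto simp: pser_conv_def\<close>)
  then have "(?f \<circ> ?s) summable_on UNIV"
    by (subst (asm) summable_on_reindex) (auto simp: inj_on_def)
  then have "(\<lambda>x. (2 / r) * (?f \<circ> ?s) x) summable_on UNIV"
    by (rule summable_on_cmult_right)
  then have "(\<lambda>(i, j). \<bar>coeff_dx a i j\<bar> * (r / 2) ^ (i + j)) summable_on UNIV"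
  proof (rule summable_on_comparison_test)
    fix x :: "nat \<times> nat"
    obtain i j where x: "x = (i, j)" by fastforce
    have "real (Suc i) \<le> 2 ^ Suc (i + j)"
      using of_nat_le_two_power[of "Suc i"] power_increasing[of "Suc i" "Suc (i + j)" "2 :: real"] by linarith
    then have "\<bar>a (Suc i) j\<bar> * real (Suc i) * (r / 2) ^ (i + j) \<le> \<bar>a (Suc i) j\<bar> * 2 ^ Suc (i + j) * (r / 2) ^ (i + j)"
      using r by (intro mult_right_mono mult_left_mono) auto
    also have "\<dots> = (2 / r) * (?f \<circ> ?s) (i, j)"
      using r by (simp add: power_divide)
    finally show "(case x of (i, j) \<Rightarrow> \<bar>coeff_dx a i j\<bar> * (r / 2) ^ (i + j)) \<le> (2 / r) * (?f \<circ> ?s) x"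
      by (simp add: x coeff_dx_def abs_mult mult_ac)
    show "0 \<le> (case x of (i, j) \<Rightarrow> \<bar>coeff_dx a i j\<bar> * (r / 2) ^ (i + j))"
      using r by (simp add: x)
  qed
  then show ?thesis using r by (simp add: pser_conv_def)
qed

text \<open>Summing over \<open>j\<close> first leaves an ordinary power series in \<open>x\<close>
  for each fixed \<open>y\<close>, to which termwise differentiation in one variable
  applies.\<close>

lemma pser_sums:
  fixes x y :: real
  assumes a: "pser_conv a r" and xy: "\<bar>x\<bar> \<le> r" "\<bar>y\<bar> \<le> r"
  shows "(\<lambda>j. a i j * y ^ j) summable_on UNIV"
    and "(\<lambda>i. (\<Sum>\<^sub>\<infinity>j. a i j * y ^ j) * x ^ i) sums pser a x y"
proof -
  have r: "r > 0" using a by (rule pser_convD)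
  show inner: "(\<lambda>j. a i j * y ^ j) summable_on UNIV" for i
  proof -
    let ?f = "\<lambda>(i, j). \<bar>a i j\<bar> * r ^ (i + j)"
    have "?f summable_on range (Pair i)"
      by (rule summable_on_subset_banach[of ?f UNIV]) (use a in \<open>auto simp: pser_conv_def\<close>)
    then have "(?f \<circ> Pair i) summable_on UNIV"
      by (subst (asm) summable_on_reindex) (auto simp: inj_on_def)
    then have "(\<lambda>j. (?f \<circ> Pair i) j * (1 / r ^ i)) summable_on UNIV"
      by (rule summable_on_cmult_left)
    then have "(\<lambda>j. norm (a i j * y ^ j)) summable_on UNIV"
      by (rule Infinite_Sum.abs_summable_on_comparison_test')
        (use r xy in \<open>auto simp: abs_mult power_abs power_add intro!: mult_left_mono power_mono\<close>)
    then show ?thesis by (rule abs_summable_summable)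
  qed
  have "((\<lambda>i. (\<Sum>\<^sub>\<infinity>j. a i j * y ^ j) * x ^ i) has_sum pser a x y) UNIV"
  proof (rule has_sum_SigmaD)
    show "((\<lambda>(i, j). a i j *\<^sub>R (x ^ i * y ^ j)) has_sum pser a x y) (UNIV \<times> UNIV)"
      using pser_has_sum[OF a, of x y] xy by simp
    fix i
    have "((\<lambda>j. a i j * y ^ j * x ^ i) has_sum (\<Sum>\<^sub>\<infinity>j. a i j * y ^ j) * x ^ i) UNIV"
      by (rule has_sum_cmult_left[OF has_sum_infsum[OF inner]])
    then show "((\<lambda>j. case (i, j) of (i, j) \<Rightarrow> a i j *\<^sub>R (x ^ i * y ^ j)) has_sum (\<Sum>\<^sub>\<infinity>j. a i j * y ^ j) * x ^ i) UNIV"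
      by (simp add: mult_ac)
  qed
  then show "(\<lambda>i. (\<Sum>\<^sub>\<infinity>j. a i j * y ^ j) * x ^ i) sums pser a x y"
    by (rule has_sum_imp_sums)
qed

lemma pser_has_derivative_x:
  assumes a: "pser_conv a r" and xy: "\<bar>x\<bar> < r / 2" "\<bar>y\<bar> < r / 2"
  shows "((\<lambda>t. pser a t y) has_real_derivative pser (coeff_dx a) x y) (at x)"
proof -
  have r: "r > 0" using a by (rule pser_convD)
  define c where "c i = (\<Sum>\<^sub>\<infinity>j. a i j * y ^ j)" for i
  have sums: "(\<lambda>i. c i * t ^ i) sums pser a t y" if "\<bar>t\<bar> \<le> r" for t
    unfolding c_def by (rule pser_sums[OF a]) (use that xy r in auto)
  have "summable (\<lambda>i. c i * r ^ i)" using sums[of r] r by (auto simp: sums_iff)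
  then have "((\<lambda>t. \<Sum>i. c i * t ^ i) has_real_derivative (\<Sum>i. diffs c i * x ^ i)) (at x)"
    by (rule termdiffs_strong) (use xy r in auto)
  moreover have "(\<Sum>i. diffs c i * x ^ i) = pser (coeff_dx a) x y"
  proof -
    have "(\<lambda>i. (\<Sum>\<^sub>\<infinity>j. coeff_dx a i j * y ^ j) * x ^ i) sums pser (coeff_dx a) x y"
      by (rule pser_sums[OF pser_conv_dx[OF a]]) (use xy in auto)
    moreover have "(\<Sum>\<^sub>\<infinity>j. coeff_dx a i j * y ^ j) = diffs c i" for i
      unfolding coeff_dx_def diffs_def c_def mult.assoc by (rule infsum_cmult_right')
    ultimately show ?thesis by (simp add: sums_iff)
  qed
  ultimately have "((\<lambda>t. \<Sum>i. c i * t ^ i) has_real_derivative pser (coeff_dx a) x y) (at x)" by simp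
  then show ?thesis
  proof (rule has_field_derivative_transform_within_open[where S = "{-r<..<r}"])
    show "(\<Sum>i. c i * t ^ i) = pser a t y" if "t \<in> {-r<..<r}" for t
      using sums[of t] that by (auto simp: sums_iff)
  qed (use xy r in auto)
qed

text \<open>Reduces every statement about \<open>y\<close>-derivatives to the one about
  \<open>x\<close>-derivatives of the array with exchanged indices.\<close>

lemma coeff_dy_swap: "coeff_dy a = (\<lambda>i j. coeff_dx (\<lambda>i j. a j i) j i)"
  by (simp add: fun_eq_iff coeff_dx_def coeff_dy_def)

lemma pser_conv_dy: "pser_conv a r \<Longrightarrow> pser_conv (coeff_dy a) (r / 2)"
  unfolding coeff_dy_swap by (rule pser_conv_swap[OF pser_conv_dx[OF pser_conv_swap]])

lemma pser_has_derivative_y: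
  assumes a: "pser_conv a r" and xy: "\<bar>x\<bar> < r / 2" "\<bar>y\<bar> < r / 2"
  shows "((\<lambda>t. pser a x t) has_real_derivative pser (coeff_dy a) x y) (at y)"
proof -
  have r: "r > 0" using a by (rule pser_convD)
  have "((\<lambda>t. pser (\<lambda>i j. a j i) t x) has_real_derivative pser (coeff_dx (\<lambda>i j. a j i)) y x) (at y)"
    by (rule pser_has_derivative_x[OF pser_conv_swap[OF a]]) fact+
  also have "pser (coeff_dx (\<lambda>i j. a j i)) y x = pser (coeff_dy a) x y"
    unfolding coeff_dy_swap
    by (rule pser_swap[symmetric, OF pser_conv_dx[OF pser_conv_swap[OF a]]]) (use xy in auto)
  finally show ?thesis
  proof (rule has_field_derivative_transform_within_open[where S = "{-r<..<r}"])
    show "pser (\<lambda>i j. a j i) t x = pser a x t" if "t \<in> {-r<..<r}" for t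
      by (rule pser_swap[OF a]) (use that xy r in auto)
  qed (use xy r in auto)
qed

text \<open>The derivatives are required throughout a neighbourhood, because the Jacobian built from
  them is treated as a germ.\<close>

definition has_partials :: "(complex \<Rightarrow> real) \<Rightarrow> (complex \<Rightarrow> real) \<Rightarrow> (complex \<Rightarrow> real) \<Rightarrow> bool" where
  "has_partials F Fx Fy \<longleftrightarrow> (\<forall>\<^sub>F z in nhds 0.
     ((\<lambda>t. F (Complex t (Im z))) has_real_derivative Fx z) (at (Re z)) \<and>
     ((\<lambda>t. F (Complex (Re z) t)) has_real_derivative Fy z) (at (Im z)))"

lemma ps_rep_has_partials:
  assumes F: "ps_rep a r F"
  defines "Fx \<equiv> \<lambda>z. pser (coeff_dx a) (Re z) (Im z)" and "Fy \<equiv> \<lambda>z. pser (coeff_dy a) (Re z) (Im z)"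
  shows "has_partials F Fx Fy" "ps_rep (coeff_dx a) (r / 2) Fx" "ps_rep (coeff_dy a) (r / 2) Fy"
proof -
  note a = ps_repD(1)[OF F] and r = ps_repD(2)[OF F]
  show "ps_rep (coeff_dx a) (r / 2) Fx" "ps_rep (coeff_dy a) (r / 2) Fy"
    using pser_conv_dx[OF a] pser_conv_dy[OF a] by (simp_all add: ps_rep_def Fx_def Fy_def)
  show "has_partials F Fx Fy"
    unfolding has_partials_def
  proof (rule eventually_nhds_0I[of "r / 2"])
    fix z :: complex assume "norm z < r / 2"
    then have z: "\<bar>Re z\<bar> < r / 2" "\<bar>Im z\<bar> < r / 2"
      using abs_Re_le_cmod[of z] abs_Im_le_cmod[of z] by linarith+
    have "((\<lambda>t. F (Complex t (Im z))) has_real_derivative Fx z) (at (Re z))"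
      unfolding Fx_def
      by (rule has_field_derivative_transform_within_open[OF pser_has_derivative_x[OF a z], of "{-r<..<r}"])
        (use z r ps_repD(3)[OF F] in auto)
    moreover have "((\<lambda>t. F (Complex (Re z) t)) has_real_derivative Fy z) (at (Im z))"
      unfolding Fy_def
      by (rule has_field_derivative_transform_within_open[OF pser_has_derivative_y[OF a z], of "{-r<..<r}"])
        (use z r ps_repD(3)[OF F] in auto)
    ultimately show "((\<lambda>t. F (Complex t (Im z))) has_real_derivative Fx z) (at (Re z)) \<and>
      ((\<lambda>t. F (Complex (Re z) t)) has_real_derivative Fy z) (at (Im z))" ..
  qed (use r in auto)
qed

lemma coeff_dx_tail: "coeff_dx (tail (Suc N) a) = tail N (coeff_dx a)"
  and coeff_dy_tail: "coeff_dy (tail (Suc N) a) = tail N (coeff_dy a)"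
  by (auto simp: fun_eq_iff coeff_dx_def coeff_dy_def tail_def)

section \<open>Homogeneous parts and orders of vanishing\<close>

definition hform :: "nat \<Rightarrow> (nat \<Rightarrow> nat \<Rightarrow> real) \<Rightarrow> complex \<Rightarrow> real" where
  "hform n a z = (\<Sum>i\<le>n. a i (n - i) * (Re z ^ i * Im z ^ (n - i)))"

lemma hpart_real: "hpart n a (Re z) (Im z) = hform n a z"
  by (simp add: hpart_def hform_def)

lemma hform_scale: "hform n a (of_real t * z) = t ^ n * hform n a z"
  unfolding hform_def sum_distrib_left
proof (intro sum.cong refl)
  fix i assume "i \<in> {..n}"
  then have "t ^ n = t ^ i * t ^ (n - i)" by (simp flip: power_add)
  then show "a i (n - i) * (Re (of_real t * z) ^ i * Im (of_real t * z) ^ (n - i)) =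
      t ^ n * (a i (n - i) * (Re z ^ i * Im z ^ (n - i)))"
    by (simp add: power_mult_distrib mult_ac)
qed

lemma hform_at_0: "n > 0 \<Longrightarrow> hform n a 0 = 0"
  using hform_scale[of n a 0 0] by (auto simp: power_0_left)

lemma pser_norm_tail_le: "pser_conv a r \<Longrightarrow> pser_norm (tail N a) r \<le> pser_norm a r"
  unfolding pser_norm_def
  by (rule infsum_mono) (use pser_conv_tail[of a r N] pser_convD in \<open>auto simp: pser_conv_def tail_def\<close>)

lemma ps_rep_hform_split:
  assumes "ps_rep a r F" "norm z \<le> r"
  shows "F z = (\<Sum>n<N. hform n a z) + pser (tail N a) (Re z) (Im z)"
  using ps_rep_split[OF assms, of N] by (simp add: hpart_real)

text \<open>The low forms are known to vanish as functions; exchanging the array for its tail makes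
  the low coefficients zero without an argument about them. The square of half-side
  \<open>r / 2\<close> lies in the disc of radius \<open>r\<close>, where the splitting
  holds.\<close>

lemma ps_rep_tail:
  assumes F: "ps_rep a r F" and "\<And>n p. n < N \<Longrightarrow> hform n a p = 0"
  shows "ps_rep (tail N a) (r / 2) F"
  unfolding ps_rep_def
proof (intro conjI allI impI)
  show "pser_conv (tail N a) (r / 2)"
    using pser_conv_tail[OF ps_repD(1)[OF F], of N] ps_repD(2)[OF F] by (auto intro: pser_conv_mono)
  fix z assume "\<bar>Re z\<bar> \<le> r / 2" "\<bar>Im z\<bar> \<le> r / 2"
  then have "norm z \<le> r" using cmod_le[of z] by linarith
  with ps_rep_hform_split[OF F this, of N] assms(2) show "F z = pser (tail N a) (Re z) (Im z)" by simp
qed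

lemma pser_tail_bigo:
  assumes "pser_conv a r" "N \<ge> 1"
  shows "(\<lambda>z. pser (tail N a) (Re z) (Im z)) \<in> O[at 0](\<lambda>z. norm z ^ N)"
proof -
  obtain C where C: "C \<ge> 0" "\<And>z. norm z \<le> r / 2 \<Longrightarrow> \<bar>pser (tail N a) (Re z) (Im z)\<bar> \<le> C * norm z ^ N"
    using pser_tail_le[OF assms] by blast
  show ?thesis
  proof (rule bigoI[of _ C])
    show "\<forall>\<^sub>F z in at 0. norm (pser (tail N a) (Re z) (Im z)) \<le> C * norm (norm z ^ N)"
      unfolding eventually_at using C(2) pser_convD[OF assms(1)]
      by (intro exI[of _ "r / 2"]) (auto simp: dist_norm)
  qed
qed

text \<open>Along the ray z = t p the form of degree \<open>n\<close> scales like
  \<open>t ^ n\<close>, while \<open>F\<close> and the Taylor remainder have order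
  \<open>t ^ Suc n\<close>; the forms of smaller degree are gone by induction.\<close>

lemma hform_eq_0_of_bigo:
  assumes F: "ps_rep a r F" and O: "F \<in> O[at 0](\<lambda>z. norm z ^ N)" and "n < N"
  shows "hform n a p = 0"
  using \<open>n < N\<close>
proof (induction n arbitrary: p rule: less_induct)
  case (less n)
  note r = ps_repD(2)[OF F]
  have nonzero: "hform n a p = 0" if "p \<noteq> 0" for p
  proof -
    obtain C where C: "C > 0" "\<forall>\<^sub>F z in at 0. norm (F z) \<le> C * norm (norm z ^ N)"
      using landau_o.bigE[OF O] by auto
    obtain d where d: "d > 0" "\<And>z. z \<noteq> 0 \<Longrightarrow> norm z < d \<Longrightarrow> \<bar>F z\<bar> \<le> C * norm z ^ N"
      using C(2) by (auto simp: eventually_at dist_norm)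
    obtain B where B: "B \<ge> 0" "\<And>z. norm z \<le> r / 2 \<Longrightarrow> \<bar>pser (tail (Suc n) a) (Re z) (Im z)\<bar> \<le> B * norm z ^ Suc n"
      using pser_tail_le[OF ps_repD(1)[OF F], of "Suc n"] by auto
    \<comment> \<open>\<open>t < \<delta>\<close> puts the modulus of t p below 1, \<open>d\<close>
      and \<open>r / 2\<close> at once.\<close>
    define \<delta> where "\<delta> = min 1 (min d (r / 2)) / (norm p + 1)"
    have \<delta>: "\<delta> > 0" using d r by (simp add: \<delta>_def add_nonneg_pos)
    have bound: "\<bar>hform n a p\<bar> \<le> t * ((B + C) * norm p ^ Suc n)" if t: "0 < t" "t < \<delta>" for t
    proof -
      define z where "z = of_real t * p"
      have "t * (norm p + 1) < min 1 (min d (r / 2))" using t(2) by (simp add: \<delta>_def pos_less_divide_eq add_nonneg_pos)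
      then have z: "z \<noteq> 0" "norm z < d" "norm z < r / 2" "norm z < 1" "norm z = t * norm p"
        using t that \<open>p \<noteq> 0\<close> by (auto simp: z_def norm_mult distrib_left)
      have "F z = hform n a z + pser (tail (Suc n) a) (Re z) (Im z)"
        using ps_rep_hform_split[OF F, of z "Suc n"] less z(3) r by simp
      then have "\<bar>hform n a z\<bar> \<le> \<bar>F z\<bar> + \<bar>pser (tail (Suc n) a) (Re z) (Im z)\<bar>" by linarith
      also have "\<dots> \<le> C * norm z ^ N + B * norm z ^ Suc n"
        using d(2)[OF z(1,2)] B(2)[of z] z(3) by linarith
      also have "\<dots> \<le> C * norm z ^ Suc n + B * norm z ^ Suc n"
        using C(1) z(4) less.prems by (intro add_right_mono mult_left_mono power_decreasing) auto
      also have "\<dots> = t ^ n * (t * ((B + C) * norm p ^ Suc n))"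
        by (simp add: z(5) power_mult_distrib algebra_simps)
      finally have "t ^ n * \<bar>hform n a p\<bar> \<le> t ^ n * (t * ((B + C) * norm p ^ Suc n))"
        using t(1) by (simp add: z_def hform_scale abs_mult)
      then show ?thesis using t(1) by simp
    qed
    have "((\<lambda>t. t * ((B + C) * norm p ^ Suc n)) \<longlongrightarrow> 0 * ((B + C) * norm p ^ Suc n)) (at_right 0)"
      by (intro tendsto_intros)
    moreover have "\<forall>\<^sub>F t in at_right 0. \<bar>hform n a p\<bar> \<le> t * ((B + C) * norm p ^ Suc n)"
      unfolding eventually_at_right_field using bound \<delta> by auto
    ultimately have "\<bar>hform n a p\<bar> \<le> 0 * ((B + C) * norm p ^ Suc n)"
      by (rule tendsto_lowerbound) simp
    then show ?thesis by simp
  qed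
  show ?case
  proof (cases "p = 0")
    case True
    \<comment> \<open>At the origin only degree 0 is in question, and a form of degree 0 has the
      same value at 1.\<close>
    then show ?thesis using hform_at_0[of n a] nonzero[of 1] by (cases n) (auto simp: hform_def)
  qed (rule nonzero)
qed

text \<open>The remainders decay geometrically with ratio \<open>2 * norm z / r\<close>, below 1,
  and with a constant independent of the order, since the norm of a tail is at most that of the
  whole series.\<close>

lemma ps_rep_eventually_0:
  assumes F: "ps_rep a r F" and "\<And>n p. hform n a p = 0"
  shows "\<forall>\<^sub>F z in nhds 0. F z = 0"
proof (rule eventually_nhds_0I[of "r / 2"])
  note a = ps_repD(1)[OF F] and r = ps_repD(2)[OF F]
  show "r / 2 > 0" using r by simp
  fix z :: complex assume z: "norm z < r / 2"
  show "F z = 0"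
  proof (cases "z = 0")
    case True
    then show ?thesis using ps_rep_hform_split[OF F, of 0 1] assms(2) pser_tail_zero[of 1 a] r by simp
  next
    case False
    have "\<bar>F z\<bar> \<le> 2 * pser_norm a r * (2 * norm z / r) ^ Suc N" for N
    proof -
      have "\<bar>F z\<bar> = \<bar>pser (tail (Suc N) a) (Re z) (Im z) - pser (tail (Suc N) a) (Re 0) (Im 0)\<bar>"
        using ps_rep_hform_split[OF F, of z "Suc N"] assms(2) r z by (simp add: pser_tail_zero)
      also have "\<dots> \<le> 2 * pser_norm (tail (Suc N) a) r * (2 / r) ^ Suc N * norm z ^ (Suc N - 1) * norm (z - 0)"
        using False z by (intro pser_tail_diff_le[OF a]) auto
      also have "\<dots> = pser_norm (tail (Suc N) a) r * (2 * (2 * norm z / r) ^ Suc N)"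
        by (simp add: power_divide power_mult_distrib)
      also have "\<dots> \<le> pser_norm a r * (2 * (2 * norm z / r) ^ Suc N)"
        using r by (intro mult_right_mono pser_norm_tail_le[OF a]) auto
      finally show ?thesis by (simp add: mult_ac)
    qed
    moreover have "(\<lambda>N. 2 * pser_norm a r * (2 * norm z / r) ^ Suc N) \<longlonglongrightarrow> 2 * pser_norm a r * 0"
      by (intro tendsto_mult_left LIMSEQ_Suc LIMSEQ_power_zero) (use z r in auto)
    ultimately have "\<bar>F z\<bar> \<le> 2 * pser_norm a r * 0"
      by (intro LIMSEQ_le_const) auto
    then show ?thesis by simp
  qed
qed

section \<open>Leading forms of first integrals\<close>

text \<open>Formal partial derivatives. The truncated exponents, at \<open>i = 0\<close> here and at
  \<open>i = n\<close> in \<open>hform_y\<close>, come with a factor 0.\<close>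

definition hform_x :: "nat \<Rightarrow> (nat \<Rightarrow> nat \<Rightarrow> real) \<Rightarrow> complex \<Rightarrow> real" where
  "hform_x n a z = (\<Sum>i\<le>n. a i (n - i) * (real i * Re z ^ (i - 1) * Im z ^ (n - i)))"

definition hform_y :: "nat \<Rightarrow> (nat \<Rightarrow> nat \<Rightarrow> real) \<Rightarrow> complex \<Rightarrow> real" where
  "hform_y n a z = (\<Sum>i\<le>n. a i (n - i) * (Re z ^ i * (real (n - i) * Im z ^ (n - i - 1))))"

lemma hform_has_derivative:
  "(hform n a has_derivative (\<lambda>v. hform_x n a p * Re v + hform_y n a p * Im v)) (at p)"
proof -
  have "((\<lambda>z. \<Sum>i\<le>n. a i (n - i) * (Re z ^ i * Im z ^ (n - i))) has_derivative
      (\<lambda>v. \<Sum>i\<le>n. a i (n - i) * (Re p ^ i * (of_nat (n - i) * Im v * Im p ^ (n - i - 1)) +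
         of_nat i * Re v * Re p ^ (i - 1) * Im p ^ (n - i)))) (at p)"
    by (intro has_derivative_sum has_derivative_mult_right has_derivative_mult has_derivative_power
      bounded_linear_imp_has_derivative bounded_linear_Re bounded_linear_Im)
  also have "(\<lambda>v. \<Sum>i\<le>n. a i (n - i) * (Re p ^ i * (of_nat (n - i) * Im v * Im p ^ (n - i - 1)) +
         of_nat i * Re v * Re p ^ (i - 1) * Im p ^ (n - i))) = (\<lambda>v. hform_x n a p * Re v + hform_y n a p * Im v)"
    unfolding hform_x_def hform_y_def sum_distrib_right sum.distrib[symmetric]
    by (intro ext sum.cong refl) (simp add: algebra_simps)
  finally show ?thesis unfolding hform_def[abs_def] .
qed

lemma hform_euler: "hform_x n a p * Re p + hform_y n a p * Im p = real n * hform n a p"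
  unfolding hform_def hform_x_def hform_y_def sum_distrib_right sum_distrib_left sum.distrib[symmetric]
proof (intro sum.cong refl)
  fix i assume i: "i \<in> {..n}"
  have *: "real k * (x ^ (k - 1) * x) = real k * x ^ k" for k and x :: real by (cases k) auto
  have "a i (n - i) * (real i * Re p ^ (i - 1) * Im p ^ (n - i)) * Re p +
      a i (n - i) * (Re p ^ i * (real (n - i) * Im p ^ (n - i - 1))) * Im p =
      a i (n - i) * (real i * (Re p ^ (i - 1) * Re p)) * Im p ^ (n - i) +
      a i (n - i) * Re p ^ i * (real (n - i) * (Im p ^ (n - i - 1) * Im p))"
    by (simp only: mult_ac)
  also have "\<dots> = (real i + real (n - i)) * (a i (n - i) * (Re p ^ i * Im p ^ (n - i)))"
    unfolding * by (simp add: algebra_simps)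
  also have "real i + real (n - i) = real n" using i by (simp add: of_nat_diff)
  finally show "a i (n - i) * (real i * Re p ^ (i - 1) * Im p ^ (n - i)) * Re p +
      a i (n - i) * (Re p ^ i * (real (n - i) * Im p ^ (n - i - 1))) * Im p =
      real n * (a i (n - i) * (Re p ^ i * Im p ^ (n - i)))" .
qed

section \<open>Functions that are polynomial along every real line\<close>

definition line_poly :: "(complex \<Rightarrow> real) \<Rightarrow> bool" where
  "line_poly G \<longleftrightarrow> (\<forall>p v. \<exists>q :: real poly. \<forall>t. G (p + of_real t * v) = poly q t)"

lemma line_poly_const: "line_poly (\<lambda>z. c)"
  unfolding line_poly_def by (intro allI exI[of _ "[:c:]"]) simp

lemma line_poly_Re_Im: "line_poly Re" "line_poly Im"
  unfolding line_poly_def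
  by (intro allI, rule_tac x = "[:Re p, Re v:]" in exI, simp)
    (intro allI, rule_tac x = "[:Im p, Im v:]" in exI, simp)

lemma line_poly_add:
  assumes "line_poly F" "line_poly G"
  shows "line_poly (\<lambda>z. F z + G z)"
  unfolding line_poly_def
proof (intro allI)
  fix p v
  obtain f g where "\<forall>t. F (p + of_real t * v) = poly f t" "\<forall>t. G (p + of_real t * v) = poly g t"
    using assms unfolding line_poly_def by meson
  then show "\<exists>q. \<forall>t. F (p + of_real t * v) + G (p + of_real t * v) = poly q t"
    by (intro exI[of _ "f + g"]) simp
qed

lemma line_poly_mult:
  assumes "line_poly F" "line_poly G"
  shows "line_poly (\<lambda>z. F z * G z)"
  unfolding line_poly_def
proof (intro allI)
  fix p v
  obtain f g where "\<forall>t. F (p + of_real t * v) = poly f t" "\<forall>t. G (p + of_real t * v) = poly g t"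
    using assms unfolding line_poly_def by meson
  then show "\<exists>q. \<forall>t. F (p + of_real t * v) * G (p + of_real t * v) = poly q t"
    by (intro exI[of _ "f * g"]) simp
qed

lemma line_poly_power: "line_poly F \<Longrightarrow> line_poly (\<lambda>z. F z ^ n)"
  by (induction n) (auto intro: line_poly_const line_poly_mult)

lemma line_poly_sum: "(\<And>i. i \<in> A \<Longrightarrow> line_poly (F i)) \<Longrightarrow> line_poly (\<lambda>z. \<Sum>i\<in>A. F i z)"
  by (induction A rule: infinite_finite_induct) (auto intro: line_poly_const line_poly_add)

lemma line_poly_diff: "line_poly F \<Longrightarrow> line_poly G \<Longrightarrow> line_poly (\<lambda>z. F z - G z)"
  using line_poly_add[OF _ line_poly_mult[OF line_poly_const[of "-1"]]] by fastforce

lemmas line_poly_intros = line_poly_const line_poly_Re_Im line_poly_mult line_poly_power line_poly_sum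

lemma line_poly_hform: "line_poly (hform n a)" "line_poly (hform_x n a)" "line_poly (hform_y n a)"
  unfolding hform_def[abs_def] hform_x_def[abs_def] hform_y_def[abs_def] by (intro line_poly_intros)+

text \<open>On the line joining \<open>p\<close> to \<open>z\<close> both factors are one-variable
  polynomials, and their ring has no zero divisors. An identity thereby extends from the points
  where \<open>G\<close> does not vanish to the whole plane.\<close>

lemma line_poly_mult_eq_0:
  assumes "line_poly F" "line_poly G" "\<And>z. F z * G z = 0" "G p \<noteq> 0"
  shows "F z = 0"
proof -
  obtain f g where f: "\<And>t. F (p + of_real t * (z - p)) = poly f t" and g: "\<And>t. G (p + of_real t * (z - p)) = poly g t"
    using assms(1,2) unfolding line_poly_def by meson
  have "poly (f * g) = poly 0" using assms(3) by (simp add: fun_eq_iff flip: f g)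
  then have "f * g = 0" by (simp only: poly_eq_poly_eq_iff)
  moreover have "poly g 0 \<noteq> 0" using g[of 0] assms(4) by simp
  ultimately have "f = 0" by auto
  then show ?thesis using f[of 1] by simp
qed

text \<open>
  Along the ray \<open>z = t p\<close> the difference \<open>J (z + h z) - J z\<close> is \<open>t ^ (m + k - 1)\<close> times the left-hand
  side below, up to higher order in \<open>t\<close>.
\<close>

lemma leading_form_invariant:
  assumes J: "ps_rep a r J" and J0: "\<And>n p. n < m \<Longrightarrow> hform n a p = 0"
    and h1: "ps_rep b1 r1 h1" "\<And>n p. n < k \<Longrightarrow> hform n b1 p = 0"
    and h2: "ps_rep b2 r2 h2" "\<And>n p. n < k \<Longrightarrow> hform n b2 p = 0"
    and "k \<ge> 2"
    and inv: "\<forall>\<^sub>F z in nhds 0. J (z + Complex (h1 z) (h2 z)) = J z"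
  shows "hform_x m a p * hform k b1 p + hform_y m a p * hform k b2 p = 0"
proof -
  define \<eta> where "\<eta> = Complex (hform k b1 p) (hform k b2 p)"
  \<comment> \<open>The displacement divided by its expected order; as t decreases to 0 it tends to
    \<open>\<eta>\<close>, the leading displacement at \<open>p\<close>.\<close>
  define v where "v t = Complex (h1 (of_real t * p) / t ^ k) (h2 (of_real t * p) / t ^ k)" for t
  define D where "D w = hform_x m a p * Re w + hform_y m a p * Im w" for w
  define E where "E z = pser (tail (Suc m) a) (Re z) (Im z)" for z
  note r = ps_repD(2)[OF J]
  have small: "\<forall>\<^sub>F t in at_right 0. P (of_real t * p)" if "\<forall>\<^sub>F z in nhds 0. P z" for P
  proof -
    have "((\<lambda>t. complex_of_real t * p) \<longlongrightarrow> of_real 0 * p) (at_right 0)" by (intro tendsto_intros)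
    then show ?thesis using that by (simp add: filterlim_iff)
  qed
  have lim: "((\<lambda>t. h (of_real t * p) / t ^ k) \<longlongrightarrow> hform k b p) (at_right 0)"
    if h: "ps_rep b s h" and h0: "\<And>n p. n < k \<Longrightarrow> hform n b p = 0" for b s h
  proof -
    obtain B where B: "B \<ge> 0" "\<And>z. norm z \<le> s / 2 \<Longrightarrow> \<bar>pser (tail (Suc k) b) (Re z) (Im z)\<bar> \<le> B * norm z ^ Suc k"
      using pser_tail_le[OF ps_repD(1)[OF h], of "Suc k"] by auto
    have "((\<lambda>t. h (of_real t * p) / t ^ k - hform k b p) \<longlongrightarrow> 0) (at_right 0)"
    proof (rule Lim_null_comparison)
      have "\<forall>\<^sub>F z :: complex in nhds 0. norm z < s / 2"
        by (rule eventually_nhds_0I[of "s / 2"]) (use ps_repD(2)[OF h] in auto)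
      from small[OF this] eventually_at_right_less[of 0]
      show "\<forall>\<^sub>F t in at_right 0. norm (h (of_real t * p) / t ^ k - hform k b p) \<le> B * norm p ^ Suc k * t"
      proof eventually_elim
        case (elim t)
        define z where "z = of_real t * p"
        have z: "norm z < s / 2" "norm z = t * norm p" using elim by (auto simp: z_def norm_mult)
        have "h z = t ^ k * hform k b p + pser (tail (Suc k) b) (Re z) (Im z)"
          using ps_rep_hform_split[OF h, of z "Suc k"] z(1) h0 hform_scale[of k b t p] ps_repD(2)[OF h]
          by (simp add: z_def)
        then have "h z / t ^ k - hform k b p = pser (tail (Suc k) b) (Re z) (Im z) / t ^ k"
          using elim by (simp add: field_simps)
        also have "\<bar>\<dots>\<bar> \<le> B * norm z ^ Suc k / t ^ k"
          using B(2)[of z] z(1) elim by (simp add: divide_right_mono)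
        also have "\<dots> = B * norm p ^ Suc k * t"
          using elim by (simp add: z(2) power_mult_distrib)
        finally show ?case by (simp add: z_def)
      qed
      have "((\<lambda>t. B * norm p ^ Suc k * t) \<longlongrightarrow> B * norm p ^ Suc k * 0) (at_right 0)"
        by (intro tendsto_intros)
      then show "((\<lambda>t. B * norm p ^ Suc k * t) \<longlongrightarrow> 0) (at_right 0)" by simp
    qed
    then show ?thesis by (simp add: LIM_zero_iff)
  qed
  have v: "(v \<longlongrightarrow> \<eta>) (at_right 0)"
    unfolding v_def \<eta>_def by (intro tendsto_Complex lim[OF h1] lim[OF h2])
  \<comment> \<open>Once \<open>norm (v t) < norm \<eta> + 1\<close> and \<open>t < 1\<close>, both
    a point t p and its image have modulus at most \<open>t * B\<close>.\<close>
  define B where "B = norm p + norm \<eta> + 1"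
  have B: "B > 0" by (simp add: B_def add_nonneg_pos)
  define C where "C = 2 * pser_norm (tail (Suc m) a) r * (2 / r) ^ Suc m"
  have C: "C \<ge> 0" using pser_norm_nonneg[of r "tail (Suc m) a"] r by (simp add: C_def)
  have Elip: "\<bar>E z - E w\<bar> \<le> C * s ^ m * norm (z - w)" if "norm z \<le> s" "norm w \<le> s" "0 < s" "s \<le> r / 2" for z w s
    using pser_tail_diff_le[OF ps_repD(1)[OF J], of "Suc m" z s w] that by (simp add: E_def C_def)
  have Jsplit: "J z = hform m a z + E z" if "norm z \<le> r / 2" for z
    using ps_rep_hform_split[OF J, of z "Suc m"] J0 that r by (simp add: E_def)
  \<comment> \<open>The error \<open>e\<close> comes from differentiability of the leading form at
    \<open>p\<close>; being arbitrary, it forces \<open>D \<eta> = 0\<close>.\<close>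
  have key: "\<bar>D \<eta>\<bar> \<le> e * norm \<eta>" if e: "e > 0" for e
  proof -
    obtain d where d: "d > 0" "\<And>y. norm (y - p) < d \<Longrightarrow>
        norm (hform m a y - hform m a p - D (y - p)) \<le> e * norm (y - p)"
      using hform_has_derivative[of m a p] e unfolding has_derivative_at_alt D_def by blast
    have "\<forall>\<^sub>F t in at_right 0. norm (v t) < norm \<eta> + 1"
      using order_tendstoD(2)[OF tendsto_norm[OF v], of "norm \<eta> + 1"] by simp
    moreover have "\<forall>\<^sub>F t in at_right (0::real). t < min (min 1 (r / (2 * B))) (d / B)"
      by (rule eventually_at_rightI[of 0 "min (min 1 (r / (2 * B))) (d / B)"]) (use r B d in auto)
    ultimately have "\<forall>\<^sub>F t in at_right 0. \<bar>D (v t)\<bar> \<le> e * norm (v t) + C * B ^ m * norm (v t) * t"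
      using small[OF inv] eventually_at_right_less[of 0]
    proof eventually_elim
      case (elim t)
      have t: "t > 0" "t < 1" "t * B < r / 2" "t * B < d"
        using elim(2,4) B by (auto simp: field_simps)
      \<comment> \<open>The image is written as \<open>t\<close> times a perturbation of
        \<open>p\<close>, so that homogeneity applies to both points; \<open>k \<ge> 2\<close> makes
        the perturbation tend to 0.\<close>
      define z w where "z = of_real t * p" and "w = of_real t * (p + of_real (t ^ (k - 1)) * v t)"
      have tk: "t * t ^ (k - 1) = t ^ k" using \<open>k \<ge> 2\<close> by (cases k) auto
      have le_t: "t ^ (k - 1) \<le> t"
        using power_decreasing[of 1 "k - 1" t] t \<open>k \<ge> 2\<close> by simp
      have w_eq: "w = z + of_real (t ^ k) * v t"
        by (simp add: w_def z_def distrib_left tk[symmetric] mult.assoc)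
      have "of_real (t ^ k) * v t = Complex (h1 z) (h2 z)"
        using t(1) by (simp add: v_def z_def complex_eq_iff)
      then have "J w = J z" using elim(3) by (simp add: w_eq z_def)
      have nz: "norm z \<le> t * B" using t(1) by (auto simp: z_def norm_mult B_def intro!: mult_left_mono)
      have "norm (p + of_real (t ^ (k - 1)) * v t) \<le> norm p + t ^ (k - 1) * norm (v t)"
        using norm_triangle_ineq[of p "of_real (t ^ (k - 1)) * v t"] t(1) by (simp add: norm_mult norm_power)
      also have "\<dots> \<le> norm p + 1 * (norm \<eta> + 1)"
        using elim(1) le_t t by (intro add_left_mono mult_mono) auto
      finally have nw: "norm w \<le> t * B"
        using t(1) by (simp add: w_def norm_mult B_def)
      have "hform m a z + E z = hform m a w + E w"
        using \<open>J w = J z\<close> Jsplit[of z] Jsplit[of w] nz nw t(3) by simp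
      \<comment> \<open>The higher-order parts differ by order t^(m+k), one factor t better than the
        main term.\<close>
      then have "\<bar>hform m a w - hform m a z\<bar> = \<bar>E z - E w\<bar>" by linarith
      also have "\<dots> \<le> C * (t * B) ^ m * norm (z - w)"
        using nz nw t B by (intro Elip) auto
      also have "norm (z - w) = t ^ k * norm (v t)"
        using t(1) by (simp add: w_eq norm_mult norm_power)
      finally have "\<bar>hform m a w - hform m a z\<bar> \<le> t ^ m * (C * B ^ m * (t ^ k * norm (v t)))"
        by (simp add: power_mult_distrib mult_ac)
      moreover have "hform m a w - hform m a z = t ^ m * (hform m a (p + of_real (t ^ (k - 1)) * v t) - hform m a p)"
        unfolding w_def z_def hform_scale by (simp add: right_diff_distrib)
      ultimately have "t ^ m * \<bar>hform m a (p + of_real (t ^ (k - 1)) * v t) - hform m a p\<bar> \<le> t ^ m * (C * B ^ m * (t ^ k * norm (v t)))"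
        using t(1) by (simp add: abs_mult)
      then have 1: "\<bar>hform m a (p + of_real (t ^ (k - 1)) * v t) - hform m a p\<bar> \<le> C * B ^ m * (t ^ k * norm (v t))"
        using t(1) by simp
      define y where "y = p + of_real (t ^ (k - 1)) * v t"
      have ny: "norm (y - p) = t ^ (k - 1) * norm (v t)" using t(1) by (simp add: y_def norm_mult norm_power)
      also have "\<dots> \<le> t * B"
        using elim(1) le_t t by (intro mult_mono) (auto simp: B_def intro: order_trans[OF less_imp_le])
      also have "\<dots> < d" by fact
      finally have "norm (hform m a y - hform m a p - D (y - p)) \<le> e * norm (y - p)" by (rule d(2))
      moreover have "D (y - p) = t ^ (k - 1) * D (v t)" by (simp add: D_def y_def algebra_simps)
      ultimately have "\<bar>t ^ (k - 1) * D (v t)\<bar> \<le> e * (t ^ (k - 1) * norm (v t)) + C * B ^ m * (t ^ k * norm (v t))"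
        using 1[folded y_def] unfolding ny real_norm_def by linarith
      then have "t ^ (k - 1) * \<bar>D (v t)\<bar> \<le> t ^ (k - 1) * (e * norm (v t) + C * B ^ m * norm (v t) * t)"
        using t(1) by (simp add: abs_mult algebra_simps flip: tk)
      then show ?case using t(1) by simp
    qed
    moreover have "((\<lambda>t. \<bar>D (v t)\<bar>) \<longlongrightarrow> \<bar>D \<eta>\<bar>) (at_right 0)"
      unfolding D_def by (intro tendsto_intros v)
    moreover have "((\<lambda>t. e * norm (v t) + C * B ^ m * norm (v t) * t) \<longlongrightarrow> e * norm \<eta> + C * B ^ m * norm \<eta> * 0) (at_right 0)"
      by (intro tendsto_intros v)
    ultimately have "\<bar>D \<eta>\<bar> \<le> e * norm \<eta> + C * B ^ m * norm \<eta> * 0"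
      by (intro tendsto_le[OF trivial_limit_at_right_real])
    then show ?thesis by simp
  qed
  have "\<bar>D \<eta>\<bar> \<le> 0"
  proof (rule ccontr)
    assume "\<not> \<bar>D \<eta>\<bar> \<le> 0"
    then have pos: "\<bar>D \<eta>\<bar> > 0" by simp
    let ?e = "\<bar>D \<eta>\<bar> / (2 * (norm \<eta> + 1))"
    have "?e > 0" using pos by (simp add: add_nonneg_pos)
    from key[OF this] have "\<bar>D \<eta>\<bar> * (2 * (norm \<eta> + 1)) \<le> \<bar>D \<eta>\<bar> * norm \<eta>"
      by (simp add: pos_le_divide_eq add_nonneg_pos)
    then have "2 * (norm \<eta> + 1) \<le> norm \<eta>" using pos by (simp only: mult_le_cancel_left_pos)
    then have "norm \<eta> + 2 \<le> 0" by (simp add: algebra_simps)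
    then show False using norm_ge_zero[of \<eta>] by linarith
  qed
  then show ?thesis by (simp add: D_def \<eta>_def)
qed

text \<open>Both gradients annihilate a field that is not identically zero, so their determinant
  vanishes. With Euler's identity this reads 2 F dP = m P dF, so P / F^(m/2) is constant on the
  punctured plane. The degree relation is tied to \<open>\<kappa> \<noteq> 0\<close>, as the zero
  form fits every degree.\<close>

lemma hform_eq_power_of_definite:
  assumes pos: "\<And>p. p \<noteq> 0 \<Longrightarrow> hform 2 c p > 0"
    and inv: "\<And>p. hform_x m a p * \<eta>1 p + hform_y m a p * \<eta>2 p = 0"
    and inv2: "\<And>p. hform_x 2 c p * \<eta>1 p + hform_y 2 c p * \<eta>2 p = 0"
    and \<eta>: "line_poly \<eta>1" "line_poly \<eta>2" "\<eta>1 p0 \<noteq> 0 \<or> \<eta>2 p0 \<noteq> 0"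
  obtains \<kappa> l where "\<And>p. hform m a p = \<kappa> * hform 2 c p ^ l" "\<kappa> \<noteq> 0 \<Longrightarrow> m = 2 * l"
proof -
  let ?P = "hform m a" and ?Px = "hform_x m a" and ?Py = "hform_y m a"
  let ?F = "hform 2 c" and ?Fx = "hform_x 2 c" and ?Fy = "hform_y 2 c"
  \<comment> \<open>The Jacobian of the two forms. By Cramer's rule its product with either
    component of the field is a combination of the two invariance relations.\<close>
  define \<Delta> where "\<Delta> p = ?Fx p * ?Py p - ?Fy p * ?Px p" for p
  have lp: "line_poly \<Delta>" unfolding \<Delta>_def by (intro line_poly_diff line_poly_mult line_poly_hform)
  have "\<Delta> p * \<eta>1 p = 0" for p
  proof -
    have "\<Delta> p * \<eta>1 p = ?Py p * (?Fx p * \<eta>1 p + ?Fy p * \<eta>2 p) - ?Fy p * (?Px p * \<eta>1 p + ?Py p * \<eta>2 p)"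
      by (simp add: \<Delta>_def algebra_simps)
    then show ?thesis by (simp add: inv inv2)
  qed
  moreover have "\<Delta> p * \<eta>2 p = 0" for p
  proof -
    have "\<Delta> p * \<eta>2 p = ?Fx p * (?Px p * \<eta>1 p + ?Py p * \<eta>2 p) - ?Px p * (?Fx p * \<eta>1 p + ?Fy p * \<eta>2 p)"
      by (simp add: \<Delta>_def algebra_simps)
    then show ?thesis by (simp add: inv inv2)
  qed
  ultimately have \<Delta>: "\<Delta> p = 0" for p
    using line_poly_mult_eq_0[OF lp \<eta>(1)] line_poly_mult_eq_0[OF lp \<eta>(2)] \<eta>(3) by blast
  have euler: "2 * ?F p * (?Px p * Re v + ?Py p * Im v) = real m * ?P p * (?Fx p * Re v + ?Fy p * Im v)" for p v
  proof -
    have "2 * ?F p * (?Px p * Re v + ?Py p * Im v) - real m * ?P p * (?Fx p * Re v + ?Fy p * Im v) =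
        (?Fx p * Re p + ?Fy p * Im p) * (?Px p * Re v + ?Py p * Im v) -
        (?Px p * Re p + ?Py p * Im p) * (?Fx p * Re v + ?Fy p * Im v)"
      by (simp add: hform_euler)
    also have "\<dots> = \<Delta> p * (Re p * Im v - Im p * Re v)" by (simp add: \<Delta>_def algebra_simps)
    finally show ?thesis by (simp add: \<Delta>)
  qed
  \<comment> \<open>\<open>q\<close> is F^(-1/2), which makes \<open>G\<close> the quotient P /
    F^(m/2), smooth away from 0 by definiteness.\<close>
  define q where "q p = inverse (sqrt (?F p))" for p
  define G where "G p = ?P p * q p ^ m" for p
  have dG: "(G has_derivative (\<lambda>_. 0)) (at p)" if "p \<noteq> 0" for p
  proof -
    let ?P' = "\<lambda>v. ?Px p * Re v + ?Py p * Im v" and ?F' = "\<lambda>v. ?Fx p * Re v + ?Fy p * Im v"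
    have F: "?F p > 0" by (rule pos) fact
    have q: "q p > 0" "q p * q p * ?F p = 1"
      using F by (simp_all add: q_def flip: inverse_mult_distrib)
    have "((\<lambda>p. sqrt (?F p)) has_derivative (\<lambda>v. inverse (sqrt (?F p)) / 2 * ?F' v)) (at p)"
      using has_derivative_compose[OF hform_has_derivative[of 2 c p],
          of sqrt "(*) (inverse (sqrt (?F p)) / 2)"] DERIV_real_sqrt[OF F]
      by (simp add: has_field_derivative_def)
    then have "(q has_derivative (\<lambda>v. - (q p * (q p / 2 * ?F' v) * q p))) (at p)"
      unfolding q_def by (rule Deriv.has_derivative_inverse[rotated]) (use F in auto)
    then have "(G has_derivative (\<lambda>v. ?P p * (of_nat m * (- (q p * (q p / 2 * ?F' v) * q p)) * q p ^ (m - 1)) + ?P' v * q p ^ m)) (at p)"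
      unfolding G_def by (intro has_derivative_mult has_derivative_power hform_has_derivative)
    moreover have "?P p * (of_nat m * (- (q p * (q p / 2 * ?F' v) * q p)) * q p ^ (m - 1)) + ?P' v * q p ^ m = 0" for v
    proof -
      have "of_nat m * (- (q p * (q p / 2 * ?F' v) * q p)) * q p ^ (m - 1) = - (of_nat m * (q p * q p * ?F' v / 2) * q p ^ m)"
        by (cases m) auto
      moreover have "?P' v = real m * ?P p * ?F' v * (q p * q p / 2)"
      proof -
        have "?P' v = (q p * q p * ?F p) * ?P' v" by (simp only: q(2) mult_1)
        also have "\<dots> = (2 * ?F p * ?P' v) * (q p * q p / 2)" by simp
        finally show ?thesis unfolding euler by simp
      qed
      ultimately show ?thesis by (simp only:) (simp add: field_simps)
    qed
    ultimately show ?thesis by (simp only:)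
  qed
  have const: "G p = G 1" if "p \<noteq> 0" for p
    by (rule has_derivative_zero_unique_connected[of "- {0}"])
      (use that dG in \<open>auto intro: connected_punctured_universe\<close>)
  define \<kappa> where "\<kappa> = G 1"
  have P_eq: "?P p = \<kappa> * sqrt (?F p) ^ m" if "p \<noteq> 0" for p
  proof -
    have "sqrt (?F p) > 0" using pos[OF that] by simp
    then show ?thesis using const[OF that] by (simp add: G_def q_def \<kappa>_def field_simps)
  qed
  \<comment> \<open>The form has the parity of \<open>m\<close>, whereas every power of the square
    root of F is even; a nonzero multiple thus requires even \<open>m\<close>.\<close>
  have "?F (- 1) = ?F 1" "?P (- 1) = (- 1) ^ m * ?P 1"
    using hform_scale[of 2 c "-1" 1] hform_scale[of m a "-1" 1] by simp_all
  then have "\<kappa> * sqrt (?F 1) ^ m = (- 1) ^ m * (\<kappa> * sqrt (?F 1) ^ m)"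
    using P_eq[of 1] P_eq[of "- 1"] by simp
  moreover have "sqrt (?F 1) ^ m \<noteq> 0" using pos[of 1] by simp
  ultimately have \<kappa>: "\<kappa> = 0 \<or> even m" by (cases "even m") auto
  show thesis
  proof (cases "\<kappa> = 0")
    case True
    then have "?P p = 0" for p
      using P_eq[of p] P_eq[of 1] hform_at_0[of m a] by (cases "p = 0"; cases m) (auto simp: hform_def)
    then show ?thesis using that[of 0 0] by simp
  next
    case False
    then obtain l where l: "m = 2 * l" using \<kappa> by (auto elim: evenE)
    have "?P p = \<kappa> * ?F p ^ l" for p
    proof (cases "p = 0")
      case True
      then show ?thesis using P_eq[of 1] l hform_at_0[of m a] hform_at_0[of 2 c] by (cases l) (auto simp: hform_def)
    next
      case False
      then show ?thesis using P_eq[of p] pos[of p] by (simp add: l power_mult)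
    qed
    then show ?thesis using that l by blast
  qed
qed

section \<open>Maps tangent to the identity with two independent first integrals\<close>

lemma real_analytic_at_poly:
  "real_analytic_at p c \<Longrightarrow> real_analytic_at (\<lambda>z. poly q (p z) :: real) c"
  by (induction q) (auto intro: real_analytic_at_const real_analytic_at_add real_analytic_at_mult)

lemma hform_bigo: "hform n a \<in> O[at 0](\<lambda>z. norm z ^ n)"
proof (rule bigoI, rule always_eventually, rule allI)
  fix z :: complex
  have "norm (hform n a z) \<le> (\<Sum>i\<le>n. \<bar>a i (n - i)\<bar> * norm z ^ n)"
    unfolding hform_def
  proof (rule sum_norm_le)
    fix i assume "i \<in> {..n}"
    have "\<bar>Re z\<bar> ^ i * \<bar>Im z\<bar> ^ (n - i) \<le> norm z ^ i * norm z ^ (n - i)"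
      by (intro mult_mono power_mono abs_Re_le_cmod abs_Im_le_cmod) auto
    also have "\<dots> = norm z ^ n" using \<open>i \<in> {..n}\<close> by (simp flip: power_add)
    finally show "norm (a i (n - i) * (Re z ^ i * Im z ^ (n - i))) \<le> \<bar>a i (n - i)\<bar> * norm z ^ n"
      by (simp add: abs_mult power_abs mult_left_mono)
  qed
  then show "norm (hform n a z) \<le> (\<Sum>i\<le>n. \<bar>a i (n - i)\<bar>) * norm (norm z ^ n)"
    by (simp add: sum_distrib_right)
qed

lemma real_analytic_at_bigo_1:
  fixes F :: "complex \<Rightarrow> real"
  assumes "real_analytic_at F 0"
  shows "F \<in> O[at 0](\<lambda>z. norm z ^ 0)"
  by (rule bigoI_tendsto[of _ _ "F 0"])
    (use real_analytic_at_isCont[OF assms] in \<open>simp_all add: isCont_def\<close>)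

lemma bigo_norm_mult:
  fixes F G :: "complex \<Rightarrow> real"
  assumes "F \<in> O[at 0](\<lambda>z. norm z ^ m)" "G \<in> O[at 0](\<lambda>z. norm z ^ n)"
  shows "(\<lambda>z. F z * G z) \<in> O[at 0](\<lambda>z. norm z ^ (m + n))"
  using landau_o.big.mult[OF assms] by (simp add: power_add)

lemma ps_rep_remainder_bigo:
  assumes F: "ps_rep a r F" and "\<And>n p. n < N \<Longrightarrow> hform n a p = 0"
  shows "(\<lambda>z. F z - hform N a z) \<in> O[at 0](\<lambda>z. norm z ^ Suc N)"
proof -
  note r = ps_repD(2)[OF F]
  have "\<forall>\<^sub>F z in nhds 0. pser (tail (Suc N) a) (Re z) (Im z) = F z - hform N a z"
    by (rule eventually_nhds_0I[OF r])
      (use ps_rep_hform_split[OF F, of _ "Suc N"] assms(2) in auto)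
  then have "\<forall>\<^sub>F z in at 0. pser (tail (Suc N) a) (Re z) (Im z) = F z - hform N a z"
    by (simp add: eventually_at_filter eventually_mono)
  from landau_o.big.in_cong[OF this] pser_tail_bigo[OF ps_repD(1)[OF F], of "Suc N"]
  show ?thesis by simp
qed

text \<open>Replacing one factor \<open>K\<close> by \<open>F\<close> gains one order, 3 in place of
  2. The induction rests on splitting the next difference as K (K^l - F^l) + (K - F) F^l.\<close>

lemma power_diff_bigo:
  fixes K F :: "complex \<Rightarrow> real"
  assumes F: "F \<in> O[at 0](\<lambda>z. norm z ^ 2)" and KF: "(\<lambda>z. K z - F z) \<in> O[at 0](\<lambda>z. norm z ^ 3)"
    and K: "K \<in> O[at 0](\<lambda>z. norm z ^ 2)"
  shows "(\<lambda>z. K z ^ l - F z ^ l) \<in> O[at 0](\<lambda>z. norm z ^ Suc (2 * l))"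
proof (induction l)
  case (Suc l)
  have "(\<lambda>z. F z ^ l) \<in> O[at 0](\<lambda>z. norm z ^ (2 * l))"
    using landau_o.big_power[OF F, of l] by (simp add: power_mult)
  then have "(\<lambda>z. K z * (K z ^ l - F z ^ l) + (K z - F z) * F z ^ l) \<in> O[at 0](\<lambda>z. norm z ^ Suc (2 * Suc l))"
    using bigo_norm_mult[OF K Suc] bigo_norm_mult[OF KF, of "\<lambda>z. F z ^ l" "2 * l"]
    by (intro sum_in_bigo) (simp_all add: eval_nat_numeral)
  then show ?case by (simp add: algebra_simps)
qed simp

text \<open>The form of degree \<open>N\<close> may be zero; then \<open>\<kappa> = 0\<close> and
  the correction \<open>monom \<kappa> l\<close> is empty. Otherwise \<open>N = 2 * l\<close>, and
  using \<open>K\<close> instead of its quadratic form in the correction makes an error of order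
  \<open>Suc N\<close>.\<close>

lemma first_integral_approx_poly:
  assumes K: "ps_rep c s K" "\<And>n p. n < 2 \<Longrightarrow> hform n c p = 0" "\<And>p. p \<noteq> 0 \<Longrightarrow> hform 2 c p > 0"
    and J: "real_analytic_at J 0"
    and h1: "ps_rep b1 r1 h1" "\<And>n p. n < k \<Longrightarrow> hform n b1 p = 0"
    and h2: "ps_rep b2 r2 h2" "\<And>n p. n < k \<Longrightarrow> hform n b2 p = 0"
    and k: "k \<ge> 2" "hform k b1 p0 \<noteq> 0 \<or> hform k b2 p0 \<noteq> 0"
    and invK: "\<forall>\<^sub>F z in nhds 0. K (z + Complex (h1 z) (h2 z)) = K z"
    and invJ: "\<forall>\<^sub>F z in nhds 0. J (z + Complex (h1 z) (h2 z)) = J z"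
  shows "\<exists>q. (\<lambda>z. J z - poly q (K z)) \<in> O[at 0](\<lambda>z. norm z ^ N)"
proof (induction N)
  case 0
  show ?case using real_analytic_at_bigo_1[OF J] by (intro exI[of _ 0]) simp
next
  case (Suc N)
  then obtain q where q: "(\<lambda>z. J z - poly q (K z)) \<in> O[at 0](\<lambda>z. norm z ^ N)" ..
  have raK: "real_analytic_at K 0" by (rule ps_rep_imp_real_analytic_at) fact
  have "real_analytic_at (\<lambda>z. J z - poly q (K z)) 0"
    by (intro real_analytic_at_diff real_analytic_at_poly J raK)
  then obtain a r where S: "ps_rep a r (\<lambda>z. J z - poly q (K z))"
    by (rule real_analytic_at_imp_ps_rep)
  have a0: "hform n a p = 0" if "n < N" for n p
    by (rule hform_eq_0_of_bigo[OF S q that])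
  have inv: "hform_x N a p * hform k b1 p + hform_y N a p * hform k b2 p = 0" for p
  proof (rule leading_form_invariant[OF S a0 h1 h2 k(1)])
    show "\<forall>\<^sub>F z in nhds 0. J (z + Complex (h1 z) (h2 z)) - poly q (K (z + Complex (h1 z) (h2 z))) = J z - poly q (K z)"
      using invK invJ by eventually_elim simp
  qed
  have inv2: "hform_x 2 c p * hform k b1 p + hform_y 2 c p * hform k b2 p = 0" for p
    by (rule leading_form_invariant[OF K(1,2) h1 h2 k(1) invK])
  obtain \<kappa> l where \<kappa>: "\<And>p. hform N a p = \<kappa> * hform 2 c p ^ l" "\<kappa> \<noteq> 0 \<Longrightarrow> N = 2 * l"
    using hform_eq_power_of_definite[OF K(3) inv inv2 line_poly_hform(1) line_poly_hform(1) k(2)] by metis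
  have KF: "(\<lambda>z. K z - hform 2 c z) \<in> O[at 0](\<lambda>z. norm z ^ 3)"
    using ps_rep_remainder_bigo[OF K(1), of 2] K(2) by simp
  have Kbig: "K \<in> O[at 0](\<lambda>z. norm z ^ 2)"
  proof -
    have "\<forall>\<^sub>F z in nhds 0. pser (tail 2 c) (Re z) (Im z) = K z"
      by (rule eventually_nhds_0I[OF ps_repD(2)[OF K(1)]]) (use ps_rep_hform_split[OF K(1), of _ 2] K(2) in auto)
    then have "\<forall>\<^sub>F z in at 0. pser (tail 2 c) (Re z) (Im z) = K z"
      by (simp add: eventually_at_filter eventually_mono)
    from landau_o.big.in_cong[OF this] pser_tail_bigo[OF ps_repD(1)[OF K(1)], of 2] show ?thesis by simp
  qed
  have "(\<lambda>z. \<kappa> * (K z ^ l - hform 2 c z ^ l)) \<in> O[at 0](\<lambda>z. norm z ^ Suc N)"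
    using power_diff_bigo[OF hform_bigo KF Kbig, of l] \<kappa>(2) by (cases "\<kappa> = 0") auto
  from sum_in_bigo(2)[OF ps_rep_remainder_bigo[OF S a0] this]
  have "(\<lambda>z. J z - poly (q + monom \<kappa> l) (K z)) \<in> O[at 0](\<lambda>z. norm z ^ Suc N)"
    by (simp add: \<kappa>(1) poly_monom algebra_simps)
  then show ?case ..
qed

text \<open>The differential of a polynomial in \<open>K\<close> is a multiple of that of
  \<open>K\<close>, so in the Jacobian \<open>J\<close> may be replaced by a remainder of
  arbitrarily high order.\<close>

lemma jacobian_eventually_0:
  assumes K: "real_analytic_at K 0" "has_partials K Kx Ky" "real_analytic_at Kx 0" "real_analytic_at Ky 0"
    and J: "real_analytic_at J 0" "has_partials J Jx Jy" "real_analytic_at Jx 0" "real_analytic_at Jy 0"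
    and approx: "\<And>N. \<exists>q. (\<lambda>z. J z - poly q (K z)) \<in> O[at 0](\<lambda>z. norm z ^ N)"
  shows "\<forall>\<^sub>F z in nhds 0. Kx z * Jy z - Ky z * Jx z = 0"
proof -
  have "real_analytic_at (\<lambda>z. Kx z * Jy z - Ky z * Jx z) 0"
    by (intro real_analytic_at_diff real_analytic_at_mult K J)
  then obtain d s where d: "ps_rep d s (\<lambda>z. Kx z * Jy z - Ky z * Jx z)"
    by (rule real_analytic_at_imp_ps_rep)
  have "hform n d p = 0" for n p
  proof (rule hform_eq_0_of_bigo[OF d _ lessI])
    \<comment> \<open>Order n + 2: differentiation loses one, and order n + 1 is what annihilates
      the form of degree n.\<close>
    obtain q where q: "(\<lambda>z. J z - poly q (K z)) \<in> O[at 0](\<lambda>z. norm z ^ Suc (Suc n))"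
      using approx by blast
    have "real_analytic_at (\<lambda>z. J z - poly q (K z)) 0"
      by (intro real_analytic_at_diff real_analytic_at_poly J K)
    then obtain a r where S: "ps_rep a r (\<lambda>z. J z - poly q (K z))"
      by (rule real_analytic_at_imp_ps_rep)
    \<comment> \<open>With a tail as coefficient array the derivative arrays are tails as well, so
      the order of the partial derivatives can be read off.\<close>
    have "ps_rep (tail (Suc (Suc n)) a) (r / 2) (\<lambda>z. J z - poly q (K z))"
      by (rule ps_rep_tail[OF S hform_eq_0_of_bigo[OF S q]])
    note part = ps_rep_has_partials(1)[OF this]
    define Sx where "Sx z = pser (tail (Suc n) (coeff_dx a)) (Re z) (Im z)" for z
    define Sy where "Sy z = pser (tail (Suc n) (coeff_dy a)) (Re z) (Im z)" for z
    have big: "Sx \<in> O[at 0](\<lambda>z. norm z ^ Suc n)" "Sy \<in> O[at 0](\<lambda>z. norm z ^ Suc n)"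
      unfolding Sx_def Sy_def
      by (rule pser_tail_bigo[OF pser_conv_dx[OF ps_repD(1)[OF S]]], simp,
        rule pser_tail_bigo[OF pser_conv_dy[OF ps_repD(1)[OF S]]], simp)
    have "\<forall>\<^sub>F z in nhds 0. Kx z * Sy z - Ky z * Sx z = Kx z * Jy z - Ky z * Jx z"
      using part K(2) J(2) unfolding has_partials_def coeff_dx_tail coeff_dy_tail Sx_def[symmetric] Sy_def[symmetric]
    proof eventually_elim
      case (elim z)
      have "((\<lambda>t. J (Complex t (Im z)) - poly q (K (Complex t (Im z)))) has_real_derivative
          Jx z - Kx z * poly (pderiv q) (K z)) (at (Re z))"
        using elim by (auto intro!: derivative_eq_intros DERIV_chain2[OF poly_DERIV])
      with elim have x: "Sx z = Jx z - Kx z * poly (pderiv q) (K z)" by (blast intro: DERIV_unique)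
      have "((\<lambda>t. J (Complex (Re z) t) - poly q (K (Complex (Re z) t))) has_real_derivative
          Jy z - Ky z * poly (pderiv q) (K z)) (at (Im z))"
        using elim by (auto intro!: derivative_eq_intros DERIV_chain2[OF poly_DERIV])
      with elim have y: "Sy z = Jy z - Ky z * poly (pderiv q) (K z)" by (blast intro: DERIV_unique)
      show ?case by (simp add: x y algebra_simps)
    qed
    then have "\<forall>\<^sub>F z in at 0. Kx z * Sy z - Ky z * Sx z = Kx z * Jy z - Ky z * Jx z"
      by (simp add: eventually_at_filter eventually_mono)
    moreover have "(\<lambda>z. Kx z * Sy z - Ky z * Sx z) \<in> O[at 0](\<lambda>z. norm z ^ Suc n)"
      using bigo_norm_mult[OF real_analytic_at_bigo_1[OF K(3)] big(2)]
        bigo_norm_mult[OF real_analytic_at_bigo_1[OF K(4)] big(1)]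
      by (intro sum_in_bigo) simp_all
    ultimately show "(\<lambda>z. Kx z * Jy z - Ky z * Jx z) \<in> O[at 0](\<lambda>z. norm z ^ Suc n)"
      by (rule iffD1[OF landau_o.big.in_cong])
  qed
  then show ?thesis by (rule ps_rep_eventually_0[OF d])
qed

lemma real_analytic_at_obtain_partials:
  assumes "real_analytic_at F 0"
  obtains Fx Fy where "has_partials F Fx Fy" "real_analytic_at Fx 0" "real_analytic_at Fy 0"
proof -
  obtain a r where "ps_rep a r F" using real_analytic_at_imp_ps_rep[OF assms] .
  from ps_rep_has_partials[OF this] that show thesis
    by (blast intro: ps_rep_imp_real_analytic_at)
qed

section \<open>From differentials and Hessians to partial derivatives and coefficients\<close>

lemma differentiable_partials:
  fixes F :: "complex \<Rightarrow> real"
  assumes "F differentiable (at z)"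
  shows "((\<lambda>t. F (Complex t (Im z))) has_real_derivative frechet_derivative F (at z) 1) (at (Re z))"
    and "((\<lambda>t. F (Complex (Re z) t)) has_real_derivative frechet_derivative F (at z) \<i>) (at (Im z))"
    and "frechet_derivative F (at z) h = Re h * frechet_derivative F (at z) 1 + Im h * frechet_derivative F (at z) \<i>"
proof -
  let ?D = "frechet_derivative F (at z)"
  have D: "(F has_derivative ?D) (at z)" using assms by (simp add: frechet_derivative_works)
  then interpret bounded_linear ?D by (rule has_derivative_bounded_linear)
  have h: "h = Re h *\<^sub>R 1 + Im h *\<^sub>R \<i>" for h by (simp add: complex_eq_iff)
  show "?D h = Re h * ?D 1 + Im h * ?D \<i>"
    by (subst h) (simp only: add scale real_scaleR_def)
  have "((\<lambda>t. Complex t (Im z)) has_derivative (\<lambda>t. t *\<^sub>R 1)) (at (Re z))"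
  proof -
    have "(\<lambda>t. Complex t (Im z)) = (\<lambda>t. t *\<^sub>R 1 + Complex 0 (Im z))"
      by (simp add: fun_eq_iff complex_eq_iff)
    then show ?thesis by (auto intro!: derivative_eq_intros)
  qed
  then have "((\<lambda>t. F (Complex t (Im z))) has_derivative (\<lambda>t. t * ?D 1)) (at (Re z))"
    using has_derivative_compose[of "\<lambda>t. Complex t (Im z)" "\<lambda>t. t *\<^sub>R 1" "Re z" UNIV F ?D] D
    by (simp add: scale)
  then show "((\<lambda>t. F (Complex t (Im z))) has_real_derivative ?D 1) (at (Re z))"
    by (rule has_derivative_imp_has_field_derivative) simp
  have "((\<lambda>t. Complex (Re z) t) has_derivative (\<lambda>t. t *\<^sub>R \<i>)) (at (Im z))"
  proof -
    have "(\<lambda>t. Complex (Re z) t) = (\<lambda>t. t *\<^sub>R \<i> + complex_of_real (Re z))"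
      by (simp add: fun_eq_iff complex_eq_iff)
    then show ?thesis by (auto intro!: derivative_eq_intros)
  qed
  then have "((\<lambda>t. F (Complex (Re z) t)) has_derivative (\<lambda>t. t * ?D \<i>)) (at (Im z))"
    using has_derivative_compose[of "\<lambda>t. Complex (Re z) t" "\<lambda>t. t *\<^sub>R \<i>" "Im z" UNIV F ?D] D
    by (simp add: scale)
  then show "((\<lambda>t. F (Complex (Re z) t)) has_real_derivative ?D \<i>) (at (Im z))"
    by (rule has_derivative_imp_has_field_derivative) simp
qed

text \<open>The Hessian is given as the derivative of the gradient and the quadratic form by
  coefficients; they are compared through growth. Integrating the gradient along the ray through
  \<open>p\<close> bounds the increment of \<open>I\<close> below by
  \<open>\<epsilon> * t ^ 2\<close>, and dividing by \<open>t ^ 2\<close> isolates the quadratic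
  form.\<close>

lemma nondegenerate_local_min_hform:
  assumes I: "nondegenerate_local_min I 0" and K: "ps_rep c r (\<lambda>z. I z - I 0)"
  shows "n < 2 \<Longrightarrow> hform n c p = 0" and "p \<noteq> 0 \<Longrightarrow> hform 2 c p > 0"
proof -
  obtain g H where g: "\<forall>\<^sub>F z in nhds 0. GDERIV I z :> g z" and g0: "g 0 = 0"
    and H: "(g has_derivative H) (at 0)" and pos: "\<And>h. h \<noteq> 0 \<Longrightarrow> H h \<bullet> h > 0"
    using I unfolding nondegenerate_local_min_def by blast
  have "(I has_derivative (\<lambda>h. 0)) (at 0)"
    using eventually_nhds_x_imp_x[OF g] by (simp add: gderiv_def g0)
  then have "((\<lambda>z. I z - I 0) has_derivative (\<lambda>h. 0)) (at 0)"
    by (auto intro!: derivative_eq_intros)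
  then have "(\<lambda>h. c 1 0 * Re h + c 0 1 * Im h) = (\<lambda>h. 0)"
    by (rule has_derivative_unique[OF ps_rep_has_derivative[OF K]])
  from fun_cong[OF this, of 1] fun_cong[OF this, of \<i>] ps_rep_zero[OF K]
  have c: "c 1 0 = 0" "c 0 1 = 0" "c 0 0 = 0" by simp_all
  show low: "hform n c p = 0" if "n < 2" for n p
    using c that by (auto simp: hform_def numeral_2_eq_2 less_Suc_eq)
  show "hform 2 c p > 0" if p: "p \<noteq> 0"
  proof -
    \<comment> \<open>The Hessian contributes 4 \<epsilon> t to the derivative along the ray, half
      of it is given up to the linearization error, and integrating 2 \<epsilon> t leaves \<epsilon>
      t^2.\<close>
    define \<epsilon> where "\<epsilon> = H p \<bullet> p / 4"
    have \<epsilon>: "\<epsilon> > 0" using pos[OF p] by (simp add: \<epsilon>_def)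
    have small: "\<exists>\<delta>>0. \<forall>t. 0 \<le> t \<and> t < \<delta> \<longrightarrow> P (t *\<^sub>R p)" if "\<forall>\<^sub>F z in nhds 0. P z" for P
    proof -
      obtain d where d: "d > 0" "\<And>z. norm z < d \<Longrightarrow> P z"
        using \<open>\<forall>\<^sub>F z in nhds 0. P z\<close> by (auto simp: eventually_nhds_metric)
      show ?thesis
        by (rule exI[of _ "d / norm p"]) (use d p in \<open>auto simp: pos_less_divide_eq\<close>)
    qed
    obtain d1 where d1: "d1 > 0" "\<And>t. 0 \<le> t \<Longrightarrow> t < d1 \<Longrightarrow> GDERIV I (t *\<^sub>R p) :> g (t *\<^sub>R p)"
      using small[OF g] by blast
    have "\<forall>\<^sub>F z in nhds 0. norm (g z - g 0 - H (z - 0)) \<le> (2 * \<epsilon> / (norm p * norm p)) * norm (z - 0)"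
    proof -
      have "2 * \<epsilon> / (norm p * norm p) > 0" using \<epsilon> p by simp
      then obtain d where "d > 0" "\<And>z. norm (z - 0) < d \<Longrightarrow> norm (g z - g 0 - H (z - 0)) \<le> (2 * \<epsilon> / (norm p * norm p)) * norm (z - 0)"
        using H unfolding has_derivative_at_alt by blast
      then show ?thesis by (intro eventually_nhds_0I[of d]) auto
    qed
    from small[OF this] obtain d2 where d2: "d2 > 0" "\<And>t. 0 \<le> t \<Longrightarrow> t < d2 \<Longrightarrow>
        norm (g (t *\<^sub>R p) - H (t *\<^sub>R p)) \<le> (2 * \<epsilon> / (norm p * norm p)) * (t * norm p)"
      using g0 by auto
    interpret H: bounded_linear H using H by (rule has_derivative_bounded_linear)
    have grad: "g (t *\<^sub>R p) \<bullet> p \<ge> 2 * \<epsilon> * t" if t: "0 \<le> t" "t < d2" for t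
    proof -
      have "\<bar>(g (t *\<^sub>R p) - H (t *\<^sub>R p)) \<bullet> p\<bar> \<le> norm (g (t *\<^sub>R p) - H (t *\<^sub>R p)) * norm p"
        by (rule Cauchy_Schwarz_ineq2)
      also have "\<dots> \<le> (2 * \<epsilon> / (norm p * norm p)) * (t * norm p) * norm p"
        by (intro mult_right_mono d2(2) t) auto
      also have "\<dots> = 2 * \<epsilon> * t" using p by simp
      finally have "\<bar>(g (t *\<^sub>R p) - H (t *\<^sub>R p)) \<bullet> p\<bar> \<le> 2 * \<epsilon> * t" .
      moreover have "H (t *\<^sub>R p) \<bullet> p = 2 * (2 * \<epsilon> * t)" by (simp add: H.scale \<epsilon>_def)
      ultimately show ?thesis unfolding inner_diff_left by linarith
    qed
    have lower: "I (t *\<^sub>R p) - I 0 \<ge> \<epsilon> * t ^ 2" if t: "0 < t" "t < min d1 d2" for t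
    proof -
      let ?w = "\<lambda>t. I (t *\<^sub>R p) - \<epsilon> * t ^ 2"
      have "?w 0 \<le> ?w t"
      proof (rule DERIV_nonneg_imp_nondecreasing[where f = ?w])
        fix s assume s: "0 \<le> s" "s \<le> t"
        have "(I has_derivative (\<lambda>h. h \<bullet> g (s *\<^sub>R p))) (at (s *\<^sub>R p))"
          using d1(2)[of s] s t by (simp add: gderiv_def)
        then have "((\<lambda>s. I (s *\<^sub>R p)) has_derivative (\<lambda>h. (h *\<^sub>R p) \<bullet> g (s *\<^sub>R p))) (at s)"
          by (rule has_derivative_compose[rotated]) (auto intro!: derivative_eq_intros)
        then have "((\<lambda>s. I (s *\<^sub>R p)) has_derivative (\<lambda>h. h * (g (s *\<^sub>R p) \<bullet> p))) (at s)"
          by (simp add: inner_commute)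
        then have "((\<lambda>s. I (s *\<^sub>R p)) has_real_derivative g (s *\<^sub>R p) \<bullet> p) (at s)"
          by (rule has_derivative_imp_has_field_derivative) simp
        then have "(?w has_real_derivative g (s *\<^sub>R p) \<bullet> p - \<epsilon> * (2 * s)) (at s)"
          by (auto intro!: derivative_eq_intros)
        moreover have "g (s *\<^sub>R p) \<bullet> p - \<epsilon> * (2 * s) \<ge> 0" using grad[of s] s t by simp
        ultimately show "\<exists>y. (?w has_real_derivative y) (at s) \<and> y \<ge> 0" by blast
      qed (use t in auto)
      then show ?thesis by simp
    qed
    obtain B where B: "B \<ge> 0" "\<And>z. norm z \<le> r / 2 \<Longrightarrow> \<bar>pser (tail 3 c) (Re z) (Im z)\<bar> \<le> B * norm z ^ 3"
      using pser_tail_le[OF ps_repD(1)[OF K], of 3] by auto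
    note r = ps_repD(2)[OF K]
    define \<delta> where "\<delta> = min (min d1 d2) (r / (2 * norm p))"
    have \<delta>: "\<delta> > 0" using d1 d2 r p by (simp add: \<delta>_def)
    have "\<epsilon> \<le> hform 2 c p + B * norm p ^ 3 * t" if t: "0 < t" "t < \<delta>" for t
    proof -
      define z where "z = t *\<^sub>R p"
      have z: "norm z \<le> r / 2" "norm z = t * norm p"
        using t p by (auto simp: z_def \<delta>_def field_simps)
      have hz: "hform 2 c z = t ^ 2 * hform 2 c p"
        by (simp add: z_def scaleR_conv_of_real hform_scale)
      have "I z - I 0 = hform 2 c z + pser (tail 3 c) (Re z) (Im z)"
        using ps_rep_hform_split[OF K, of z 3] z(1) r low[of 0 z] low[of 1 z]
        by (simp add: eval_nat_numeral)
      then have "\<epsilon> * t ^ 2 \<le> hform 2 c z + B * norm z ^ 3"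
        using lower[of t] t B(2)[OF z(1)] by (simp add: \<delta>_def z_def)
      also have "\<dots> = t ^ 2 * (hform 2 c p + B * norm p ^ 3 * t)"
        by (simp add: hz z(2) algebra_simps power2_eq_square power3_eq_cube)
      finally have "t ^ 2 * \<epsilon> \<le> t ^ 2 * (hform 2 c p + B * norm p ^ 3 * t)" by (simp add: mult.commute)
      then show ?thesis using t by simp
    qed
    then have ev: "\<forall>\<^sub>F t in at_right 0. \<epsilon> \<le> hform 2 c p + B * norm p ^ 3 * t"
      unfolding eventually_at_right_field using \<delta> by auto
    have "((\<lambda>t. hform 2 c p + B * norm p ^ 3 * t) \<longlongrightarrow> hform 2 c p + B * norm p ^ 3 * 0) (at_right 0)"
      by (intro tendsto_intros)
    from tendsto_lowerbound[OF this ev] \<epsilon> show ?thesis by simp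
  qed
qed

lemma tangent_to_identity_eq_id:
  fixes g :: "complex \<Rightarrow> complex"
  assumes g: "real_analytic_at g 0" "g 0 = 0" "(g has_derivative id) (at 0)"
    and I1: "real_analytic_at I\<^sub>1 0" "nondegenerate_local_min I\<^sub>1 0" "\<forall>\<^sub>F z in nhds 0. I\<^sub>1 (g z) = I\<^sub>1 z"
    and I2: "real_analytic_at I\<^sub>2 0" "\<forall>\<^sub>F z in nhds 0. I\<^sub>2 (g z) = I\<^sub>2 z"
    and W: "0 \<in> closure W" "functionally_independent_on I\<^sub>1 I\<^sub>2 W"
  shows "\<forall>\<^sub>F z in nhds 0. g z = z"
proof (rule ccontr)
  assume not_id: "\<not> ?thesis"
  define h1 h2 where "h1 z = Re (g z) - Re z" and "h2 z = Im (g z) - Im z" for z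
  have gh: "z + Complex (h1 z) (h2 z) = g z" for z by (simp add: h1_def h2_def complex_eq_iff)
  have "real_analytic_at h1 0" "real_analytic_at h2 0"
    using g(1) unfolding h1_def h2_def
    by (auto simp: real_analytic_at_Re_Im[of g] intro: real_analytic_at_diff real_analytic_at_Re_Im_proj)
  then obtain b1 r1 b2 r2 where h1: "ps_rep b1 r1 h1" and h2: "ps_rep b2 r2 h2"
    by (metis real_analytic_at_imp_ps_rep)
  have ex: "\<exists>k p. hform k b1 p \<noteq> 0 \<or> hform k b2 p \<noteq> 0"
  proof (rule ccontr)
    assume "\<not> ?thesis"
    then have "\<forall>\<^sub>F z in nhds 0. h1 z = 0" "\<forall>\<^sub>F z in nhds 0. h2 z = 0"
      using ps_rep_eventually_0[OF h1] ps_rep_eventually_0[OF h2] by blast+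
    then have "\<forall>\<^sub>F z in nhds 0. g z = z"
      by eventually_elim (simp add: h1_def h2_def complex_eq_iff)
    with not_id show False ..
  qed
  \<comment> \<open>The degree of the leading part of g - id. It exists because an analytic germ all
    of whose forms vanish is zero near 0.\<close>
  define k where "k = (LEAST k. \<exists>p. hform k b1 p \<noteq> 0 \<or> hform k b2 p \<noteq> 0)"
  obtain p0 where p0: "hform k b1 p0 \<noteq> 0 \<or> hform k b2 p0 \<noteq> 0"
    using LeastI_ex[OF ex] unfolding k_def by blast
  have low: "hform n b1 p = 0" "hform n b2 p = 0" if "n < k" for n p
    using not_less_Least[OF that[unfolded k_def]] by blast+
  have "k \<ge> 2"
  proof (rule ccontr)
    assume "\<not> k \<ge> 2"
    have d: "(h1 has_derivative (\<lambda>_. 0)) (at 0)" "(h2 has_derivative (\<lambda>_. 0)) (at 0)"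
      unfolding h1_def h2_def
      using has_derivative_diff[OF has_derivative_compose[OF g(3) bounded_linear_imp_has_derivative[OF bounded_linear_Re]]
          bounded_linear_imp_has_derivative[OF bounded_linear_Re]]
        has_derivative_diff[OF has_derivative_compose[OF g(3) bounded_linear_imp_has_derivative[OF bounded_linear_Im]]
          bounded_linear_imp_has_derivative[OF bounded_linear_Im]]
      by simp_all
    have "hform k b p0 = 0" if b: "ps_rep b r h" and "(h has_derivative (\<lambda>_. 0)) (at 0)" "h 0 = 0" for b r h
    proof -
      have "(\<lambda>v. b 1 0 * Re v + b 0 1 * Im v) = (\<lambda>_. 0)"
        by (rule has_derivative_unique[OF ps_rep_has_derivative[OF b]]) fact
      from fun_cong[OF this, of 1] fun_cong[OF this, of \<i>] ps_rep_zero[OF b] that(3)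
      have "b 1 0 = 0" "b 0 1 = 0" "b 0 0 = 0" by simp_all
      then show ?thesis using \<open>\<not> k \<ge> 2\<close> by (auto simp: hform_def numeral_2_eq_2 not_le less_Suc_eq)
    qed
    from this[OF h1 d(1)] this[OF h2 d(2)] p0 g(2) show False by (simp add: h1_def h2_def)
  qed
  \<comment> \<open>Without its value at 0 the integral starts with its quadratic form.\<close>
  define K where "K z = I\<^sub>1 z - I\<^sub>1 0" for z
  have raK: "real_analytic_at K 0"
    unfolding K_def by (intro real_analytic_at_diff real_analytic_at_const I1)
  then obtain c s where K: "ps_rep c s K" by (rule real_analytic_at_imp_ps_rep)
  note nd = nondegenerate_local_min_hform[OF I1(2) K[unfolded K_def]]
  have invK: "\<forall>\<^sub>F z in nhds 0. K (z + Complex (h1 z) (h2 z)) = K z"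
    using I1(3) by (simp add: gh K_def)
  have invI2: "\<forall>\<^sub>F z in nhds 0. I\<^sub>2 (z + Complex (h1 z) (h2 z)) = I\<^sub>2 z"
    using I2(2) by (simp add: gh)
  obtain Kx Ky where Kp: "has_partials K Kx Ky" "real_analytic_at Kx 0" "real_analytic_at Ky 0"
    by (rule real_analytic_at_obtain_partials[OF raK])
  obtain Jx Jy where Jp: "has_partials I\<^sub>2 Jx Jy" "real_analytic_at Jx 0" "real_analytic_at Jy 0"
    by (rule real_analytic_at_obtain_partials[OF I2(1)])
  have "\<forall>\<^sub>F z in nhds 0. Kx z * Jy z - Ky z * Jx z = 0"
    by (rule jacobian_eventually_0[OF raK Kp I2(1) Jp
          first_integral_approx_poly[OF K nd I2(1) h1 low(1) h2 low(2) \<open>k \<ge> 2\<close> p0 invK invI2]])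
  then have "\<forall>\<^sub>F z in nhds 0. z \<notin> W"
    using Kp(1) Jp(1) unfolding has_partials_def
  proof eventually_elim
    case (elim z)
    show ?case
    proof
      assume "z \<in> W"
      then have d1: "I\<^sub>1 differentiable (at z)" and d2: "I\<^sub>2 differentiable (at z)"
        and ind: "\<And>a b. (\<And>h. a * frechet_derivative I\<^sub>1 (at z) h + b * frechet_derivative I\<^sub>2 (at z) h = 0) \<Longrightarrow> a = 0 \<and> b = 0"
        using W(2) unfolding functionally_independent_on_def by blast+
      let ?D1 = "frechet_derivative I\<^sub>1 (at z)" and ?D2 = "frechet_derivative I\<^sub>2 (at z)"
      have "((\<lambda>t. K (Complex t (Im z))) has_real_derivative ?D1 1) (at (Re z))"
        "((\<lambda>t. K (Complex (Re z) t)) has_real_derivative ?D1 \<i>) (at (Im z))"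
        unfolding K_def using differentiable_partials(1,2)[OF d1] by (auto intro!: derivative_eq_intros)
      then have K: "?D1 1 = Kx z" "?D1 \<i> = Ky z"
        using elim(2) by (auto intro: DERIV_unique)
      have J: "?D2 1 = Jx z" "?D2 \<i> = Jy z"
        using differentiable_partials(1,2)[OF d2] elim(3) by (auto intro: DERIV_unique)
      have dep: "a = 0 \<and> b = 0" if "a * Kx z + b * Jx z = 0" "a * Ky z + b * Jy z = 0" for a b
      proof (rule ind)
        fix h
        have "a * ?D1 h + b * ?D2 h = Re h * (a * Kx z + b * Jx z) + Im h * (a * Ky z + b * Jy z)"
          unfolding differentiable_partials(3)[OF d1, of h] differentiable_partials(3)[OF d2, of h] K J
          by (simp add: algebra_simps)
        then show "a * ?D1 h + b * ?D2 h = 0" by (simp add: that)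
      qed
      \<comment> \<open>With zero Jacobian, (Jy, -Ky) and (Jx, -Kx) are coefficients of linear
        relations between the differentials. Independence makes them zero, so both differentials
        vanish, and then the coefficients 1, 1 contradict independence.\<close>
      have "Jy z = 0 \<and> - Ky z = 0" by (rule dep) (use elim(1) in \<open>auto simp: algebra_simps\<close>)
      moreover have "Jx z = 0 \<and> - Kx z = 0" by (rule dep) (use elim(1) in \<open>auto simp: algebra_simps\<close>)
      ultimately show False using dep[of 1 1] by simp
    qed
  qed
  then obtain e where "e > 0" "\<And>z. dist z 0 < e \<Longrightarrow> z \<notin> W"
    by (auto simp: eventually_nhds_metric)
  moreover obtain z where "z \<in> W" "dist z 0 < e"
    using W(1) \<open>e > 0\<close> by (meson closure_approachable)
  ultimately show False by blast
qed

section \<open>Germs of finite order\<close>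

lemma real_analytic_at_cmult:
  fixes F :: "complex \<Rightarrow> complex"
  assumes "real_analytic_at F c"
  shows "real_analytic_at (\<lambda>z. a * F z) c"
  using assms unfolding real_analytic_at_Re_Im[of "\<lambda>z. a * F z"] real_analytic_at_Re_Im[of F]
  by (auto intro!: real_analytic_at_diff real_analytic_at_add real_analytic_at_mult real_analytic_at_const)

lemma real_analytic_at_sum_complex:
  fixes F :: "'i \<Rightarrow> complex \<Rightarrow> complex"
  assumes "\<And>i. i \<in> A \<Longrightarrow> real_analytic_at (F i) c"
  shows "real_analytic_at (\<lambda>z. \<Sum>i\<in>A. F i z) c"
  using assms unfolding real_analytic_at_Re_Im[of "\<lambda>z. \<Sum>i\<in>A. F i z"]
  by (auto simp: real_analytic_at_Re_Im[of "F _"] intro!: real_analytic_at_sum)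

lemma real_analytic_at_id: "real_analytic_at (\<lambda>z :: complex. z) c"
  by (simp add: real_analytic_at_Re_Im real_analytic_at_Re_Im_proj)

lemma real_analytic_at_differentiable:
  fixes F :: "complex \<Rightarrow> complex"
  assumes "real_analytic_at F 0"
  shows "F differentiable (at 0)"
proof -
  have F: "real_analytic_at (\<lambda>z. Re (F z)) 0" "real_analytic_at (\<lambda>z. Im (F z)) 0"
    using assms by (auto simp: real_analytic_at_Re_Im[of F])
  obtain a r where "ps_rep a r (\<lambda>z. Re (F z))" using real_analytic_at_imp_ps_rep[OF F(1)] .
  note a = ps_rep_has_derivative[OF this]
  obtain b s where "ps_rep b s (\<lambda>z. Im (F z))" using real_analytic_at_imp_ps_rep[OF F(2)] .
  note b = ps_rep_has_derivative[OF this]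
  have "((\<lambda>z. Re (F z) *\<^sub>R 1 + Im (F z) *\<^sub>R \<i>) has_derivative
      (\<lambda>h. (a 1 0 * Re h + a 0 1 * Im h) *\<^sub>R 1 + (b 1 0 * Re h + b 0 1 * Im h) *\<^sub>R \<i>)) (at 0)"
    by (intro has_derivative_add has_derivative_scaleR_left a b)
  also have "(\<lambda>z. Re (F z) *\<^sub>R 1 + Im (F z) *\<^sub>R \<i>) = F"
    by (simp add: fun_eq_iff complex_eq_iff)
  finally show ?thesis by (auto simp: differentiable_def)
qed

lemma eventually_comp_nhds_0:
  fixes G :: "complex \<Rightarrow> complex"
  assumes "isCont G 0" "G 0 = 0" "\<forall>\<^sub>F z in nhds 0. P z"
  shows "\<forall>\<^sub>F z in nhds 0. P (G z)"
proof -
  have "filterlim G (nhds 0) (nhds 0)"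
    using assms(1,2) unfolding isCont_def tendsto_at_iff_tendsto_nhds by simp
  with assms(3) show ?thesis by (simp add: filterlim_iff)
qed

lemma funpow_germ:
  fixes f :: "complex \<Rightarrow> complex"
  assumes f: "real_analytic_at f 0" "f 0 = 0" "(f has_derivative (*) \<mu>) (at 0)"
  shows "(f ^^ n) 0 = 0" "real_analytic_at (f ^^ n) 0" "(f ^^ n has_derivative (*) (\<mu> ^ n)) (at 0)"
proof -
  show 0: "(f ^^ n) 0 = 0" for n by (induction n) (simp_all add: f)
  show "real_analytic_at (f ^^ n) 0"
  proof (induction n)
    case (Suc n)
    have "real_analytic_at (\<lambda>z. f ((f ^^ n) z)) 0"
      by (rule real_analytic_at_comp_complex[OF _ Suc]) (simp add: 0 f)
    then show ?case by (simp add: o_def)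
  qed (simp add: id_def real_analytic_at_id)
  show "(f ^^ n has_derivative (*) (\<mu> ^ n)) (at 0)"
  proof (induction n)
    case (Suc n)
    have "((\<lambda>z. f ((f ^^ n) z)) has_derivative (\<lambda>h. \<mu> * (\<mu> ^ n * h))) (at 0)"
      by (rule has_derivative_compose[OF Suc]) (simp add: 0 f)
    then show ?case by (simp add: o_def mult.assoc)
  qed (simp add: id_def)
qed

text \<open>Invariance holds near 0 only, so each step carries the neighbourhood through an iterate,
  using its continuity and its fixed point 0.\<close>

lemma first_integral_funpow:
  fixes f :: "complex \<Rightarrow> complex"
  assumes f: "real_analytic_at f 0" "f 0 = 0" "(f has_derivative (*) \<mu>) (at 0)"
    and I: "\<forall>\<^sub>F z in nhds 0. I (f z) = I z"
  shows "\<forall>\<^sub>F z in nhds 0. I ((f ^^ n) z) = I z"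
proof (induction n)
  case (Suc n)
  have "\<forall>\<^sub>F z in nhds 0. I (f ((f ^^ n) z)) = I ((f ^^ n) z)"
    by (rule eventually_comp_nhds_0[OF _ _ I])
      (use funpow_germ[OF f] has_derivative_continuous in blast)+
  with Suc show ?case by eventually_elim simp
qed simp

text \<open>Composition with \<open>f\<close> shifts the averaged sum cyclically, which is the
  relation \<open>H (f z) = \<mu> * H z\<close>. Every summand of the average has derivative the
  identity at 0, so \<open>H\<close> is invertible; its inverse is the conjugating germ and
  \<open>H\<close> plays the role of \<psi>.\<close>

lemma conjugate_of_finite_order:
  fixes f :: "complex \<Rightarrow> complex"
  assumes f: "real_analytic_at f 0" "f 0 = 0" "(f has_derivative (*) \<mu>) (at 0)"
    and \<mu>: "\<mu> ^ q = 1" "q > 0" and fq: "\<forall>\<^sub>F z in nhds 0. (f ^^ q) z = z"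
  shows "real_analytically_conjugate0 f ((*) \<mu>)"
proof -
  have "\<mu> \<noteq> 0" using \<mu> by (auto simp: power_0_left)
  define \<nu> where "\<nu> = inverse \<mu>"
  have \<nu>: "\<mu> * \<nu> = 1" "\<nu> ^ k * \<mu> ^ k = 1" "\<nu> ^ q = 1" for k
    using \<open>\<mu> \<noteq> 0\<close> \<mu> by (simp_all add: \<nu>_def power_inverse flip: power_mult_distrib)
  define H where "H z = inverse (of_nat q) * (\<Sum>k<q. \<nu> ^ k * (f ^^ k) z)" for z
  have H1: "real_analytic_at H 0"
    unfolding H_def by (intro real_analytic_at_cmult real_analytic_at_sum_complex funpow_germ[OF f])
  have H2: "H 0 = 0" by (simp add: H_def funpow_germ[OF f])
  have "(H has_derivative (\<lambda>h. inverse (of_nat q) * (\<Sum>k<q. \<nu> ^ k * (\<mu> ^ k * h)))) (at 0)"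
    unfolding H_def by (intro has_derivative_mult_right has_derivative_sum funpow_germ[OF f])
  also have "(\<lambda>h. inverse (of_nat q) * (\<Sum>k<q. \<nu> ^ k * (\<mu> ^ k * h))) = id"
    using \<mu>(2) by (simp add: fun_eq_iff \<nu> flip: mult.assoc)
  finally have H3: "(H has_derivative id) (at 0)" .
  obtain \<phi> where \<phi>: "real_analytic_at \<phi> 0" "\<phi> 0 = 0"
      "\<forall>\<^sub>F z in nhds 0. H (\<phi> z) = z" "\<forall>\<^sub>F z in nhds 0. \<phi> (H z) = z"
    by (rule real_analytic_inverse_function[OF H1 H2 H3])
  have "\<forall>\<^sub>F z in nhds 0. H (f z) = \<mu> * H z"
    using fq
  proof eventually_elim
    case (elim z)
    let ?G = "\<lambda>k. \<nu> ^ k * (f ^^ k) z"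
    \<comment> \<open>The term of index \<open>q\<close> equals the term of index 0, so the sum over
      one period is unchanged when the index is shifted.\<close>
    have "(\<Sum>k<Suc q. ?G k) = (\<Sum>k<q. ?G k) + z" using elim \<nu>(3) by simp
    moreover have "(\<Sum>k<Suc q. ?G k) = z + (\<Sum>k<q. ?G (Suc k))"
      by (subst sum.lessThan_Suc_shift) simp
    ultimately have "(\<Sum>k<q. ?G k) = (\<Sum>k<q. ?G (Suc k))" by simp
    then have "\<mu> * (\<Sum>k<q. ?G k) = \<mu> * (\<Sum>k<q. ?G (Suc k))" by simp
    also have "\<dots> = (\<Sum>k<q. (\<mu> * \<nu>) * (\<nu> ^ k * (f ^^ k) (f z)))"
      by (simp add: sum_distrib_left mult.assoc funpow_swap1)
    also have "\<dots> = (\<Sum>k<q. \<nu> ^ k * (f ^^ k) (f z))" by (simp add: \<nu>(1))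
    finally show ?case by (simp add: H_def mult.left_commute)
  qed
  then have "\<forall>\<^sub>F z in nhds 0. H (f (\<phi> z)) = \<mu> * H (\<phi> z)"
    by (rule eventually_comp_nhds_0[rotated 2])
      (use \<phi> real_analytic_at_differentiable[OF \<phi>(1)] in \<open>auto intro: differentiable_imp_continuous_within\<close>)
  with \<phi>(3) have "\<forall>\<^sub>F z in nhds 0. H (f (\<phi> z)) = \<mu> * z"
    by eventually_elim simp
  with \<phi> H1 H2 show ?thesis
    unfolding real_analytically_conjugate0_def by blast
qed

section \<open>Domains of the first integrals and the conclusion\<close>

lemma eventually_mem_domain:
  assumes "open U" "0 \<in> U" "real_meromorphic_no_pole0_on I D U"
  shows "\<forall>\<^sub>F z in nhds 0. z \<in> D" and "real_analytic_at I 0"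
proof -
  obtain P Q where PQ: "real_analytic_on P U" "real_analytic_on Q U" "Q 0 \<noteq> 0"
      "D = {z \<in> U. Q z \<noteq> 0}" "\<forall>z\<in>D. I z = P z / Q z"
    using assms(3) unfolding real_meromorphic_no_pole0_on_def by blast
  have P: "real_analytic_at P 0" and Q: "real_analytic_at Q 0"
    using PQ(1,2) assms(2) by (auto simp: real_analytic_on_def)
  have "(Q \<longlongrightarrow> Q 0) (nhds 0)"
    using real_analytic_at_isCont[OF Q] unfolding isCont_def tendsto_at_iff_tendsto_nhds .
  then have "\<forall>\<^sub>F z in nhds 0. Q z \<noteq> 0"
    using PQ(3) by (rule tendsto_imp_eventually_ne)
  moreover have "\<forall>\<^sub>F z in nhds 0. z \<in> U" using assms(1,2) by (rule eventually_nhds_in_open)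
  ultimately show D: "\<forall>\<^sub>F z in nhds 0. z \<in> D"
    by eventually_elim (simp add: PQ(4))
  \<comment> \<open>Near 0 the denominator does not vanish, so the quotient is an analytic germ; it
    agrees with \<open>I\<close> there because \<open>D\<close> contains a neighbourhood of
    0.\<close>
  have "real_analytic_at (\<lambda>z. P z * inverse (Q z)) 0"
    by (intro real_analytic_at_mult real_analytic_at_inverse P Q PQ)
  then show "real_analytic_at I 0"
  proof (rule real_analytic_at_cong)
    show "\<forall>\<^sub>F z in nhds 0. P z * inverse (Q z) = I z"
      using D by eventually_elim (simp add: PQ(5) divide_inverse)
  qed
qed

theorem corollary4p3:
  fixes f :: "complex \<Rightarrow> complex"
    and \<omega>\<^sub>0 :: real and p q :: nat
    and U D W :: "complex set"
    and I\<^sub>1 I\<^sub>2 :: "complex \<Rightarrow> real"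
  assumes f_analytic: "real_analytic_at f 0"
    and elliptic: "elliptic_fixed_point0 f \<omega>\<^sub>0"
    and linear_part: "linear_part f = (\<lambda>z. cis (2 * pi * \<omega>\<^sub>0) * z)"
    and rational: "\<omega>\<^sub>0 = real p / real q" "0 < \<omega>\<^sub>0" "\<omega>\<^sub>0 < 1/2" "coprime p q" "q \<ge> 3"
    and U: "open U" "0 \<in> U"
    and I1: "real_analytic_on I\<^sub>1 U" "first_integral f I\<^sub>1 U" "nondegenerate_local_min I\<^sub>1 0"
    and I2: "real_meromorphic_no_pole0_on I\<^sub>2 D U" "first_integral f I\<^sub>2 D"
    and W: "open W" "W \<subseteq> (U - {0}) \<inter> D" "U - {0} \<subseteq> closure W"
    and indep: "functionally_independent_on I\<^sub>1 I\<^sub>2 W"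
  shows "real_analytically_conjugate0 f (linear_part f)"
proof -
  define \<mu> where "\<mu> = cis (2 * pi * \<omega>\<^sub>0)"
  have f0: "f 0 = 0" using elliptic by (simp add: elliptic_fixed_point0_def)
  have fd: "(f has_derivative (*) \<mu>) (at 0)"
    using real_analytic_at_differentiable[OF f_analytic] linear_part
    unfolding frechet_derivative_works linear_part_def \<mu>_def by simp
  note f = f_analytic f0 fd
  have \<mu>: "\<mu> ^ q = 1"
  proof -
    have "\<mu> ^ q = cis (real q * (2 * pi * \<omega>\<^sub>0))" by (simp add: \<mu>_def Complex.DeMoivre)
    also have "real q * (2 * pi * \<omega>\<^sub>0) = 2 * pi * real p" using rational by simp
    also have "cis \<dots> = 1" by (simp add: cis_multiple_2pi)
    finally show ?thesis .
  qed
  \<comment> \<open>Near 0 both \<open>z\<close> and \<open>f z\<close> lie in \<open>S\<close>, so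
    the proviso in the notion of a first integral is met.\<close>
  have inv: "\<forall>\<^sub>F z in nhds 0. I ((f ^^ q) z) = I z"
    if "first_integral f I S" "\<forall>\<^sub>F z in nhds 0. z \<in> S" for I :: "complex \<Rightarrow> real" and S
  proof (rule first_integral_funpow[OF f])
    have "\<forall>\<^sub>F z in nhds 0. f z \<in> S"
      by (rule eventually_comp_nhds_0[where P = "\<lambda>z. z \<in> S", OF has_derivative_continuous[OF fd] f0 that(2)])
    with that show "\<forall>\<^sub>F z in nhds 0. I (f z) = I z"
      unfolding first_integral_def by eventually_elim blast
  qed
  note q = funpow_germ[OF f, of q]
  \<comment> \<open>The origin is a limit point of the open set \<open>U\<close>; density of
    \<open>W\<close> then produces points of independence arbitrarily close to it.\<close>
  have "0 \<in> closure (U - {0})"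
    using interior_limit_point[of 0 U] U by (simp add: interior_open islimpt_in_closure)
  then have "0 \<in> closure W"
    using closure_mono[OF W(3)] by auto
  moreover have "(f ^^ q has_derivative id) (at 0)"
    using q(3) by (simp add: \<mu> id_def lambda_one)
  ultimately have "\<forall>\<^sub>F z in nhds 0. (f ^^ q) z = z"
    using I1(1) U eventually_mem_domain[OF U I2(1)]
    by (intro tangent_to_identity_eq_id[where W = W and I\<^sub>1 = I\<^sub>1 and I\<^sub>2 = I\<^sub>2] q inv[OF I1(2)] inv[OF I2(2)] I1(3) indep)
      (auto simp: real_analytic_on_def intro: eventually_nhds_in_open)
  from conjugate_of_finite_order[OF f \<mu> _ this] rational(5) show ?thesis
    unfolding linear_part \<mu>_def by simp
qed

end
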